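(* Let $G$ be a countable discrete amenable group acting on a compact metrizable space $X$, and assume that the action $G\curvearrowright X$ is essentially free. Then $G\curvearrowright X$ has the small boundary property if and only if it is almost finite in measure. Moreover, if the action is minimal, then the following are equivalent: (1) the action is almost finite; (2) the action has the small boundary property and comparison.
   Context: $M_G(X)$ denotes the set of $G$-invariant Borel probability measures on $X$. The action is essentially free if for every $g\in G\setminus\{1\}$ and every $\mu\in M_G(X)$ one has $\mu(\{x\in X: g\cdot x=x\})=0$. It has the small boundary property if $X$ admits a basis for its topology consisting of (open) sets $U$ with $\mu(\partial U)=0$ for all $\mu\in M_G(X)$. For subsets $A,B\subseteq X$, write $A\precsim B$ ($A$ is dynamically subequivalent to $B$) if for every closed subset $C\subseteq X$ with $C\subseteq A$ there are a finite collection $\mathcal{U}$ of open subsets of $X$ covering $C$ and elements $g_U\in G$ for $U\in\mathcal{U}$ such that the sets $g_U\cdot U$, $U\in\mathcal{U}$, are pairwise disjoint and contained in $B$. The action has comparison if for all open subsets $A,B\subseteq X$, the condition $\mu(A)<\mu(B)$ for all $\mu\in M_G(X)$ implies $A\precsim B$. For a finite set $K\subseteq G$ and $\delta>0$, a nonempty finite set $F\subseteq G$ is $(K,\delta)$-invariant if $|KF\triangle F|/|F|<\delta$, where $KF=\{kf:k\in K,f\in F\}$. For a nonempty finite $F\subseteq G$ and $A\subseteq X$ put $\underline{D}_F(A)=\inf_{x\in X}\frac{|\{t\in F: tx\in A\}|}{|F|}$; the lower Banach density of $A$ is $\underline{D}(A)=\sup_F\underline{D}_F(A)$, with $F$ ranging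 over nonempty finite subsets of $G$. A tower is a pair $(S,V)$ with $S\subseteq G$ finite and $V\subseteq X$ such that the sets $sV$, $s\in S$ (its levels), are pairwise disjoint; $S$ is its shape and $V$ its base. A castle is a finite collection $\{(S_i,V_i)\}_{i\in I}$ of towers such that all levels of all towers are pairwise disjoint; its footprint is $\bigsqcup_{i\in I}S_iV_i$. A castle is open if all its bases are open. Fix a metric on $X$ compatible with its topology. The action is almost finite in measure if for every finite $K\subseteq G$ and all $\delta,\varepsilon>0$ there is an open castle $\{(S_i,V_i)\}_{i\in I}$ such that (i) each level $sV_i$ ($s\in S_i$, $i\in I$) has diameter at most $\delta$; (ii) each shape $S_i$ is $(K,\delta)$-invariant; (iii) $\underline{D}\big(\bigsqcup_{i\in I}S_iV_i\big)\ge 1-\varepsilon$. A minimal action is almost finite if for every finite $K\subseteq G$, every nonempty open $B\subseteq X$ and every $\delta>0$ there is an open castle $\{(S_i,V_i)\}_{i\in I}$ satisfying (i) and (ii) above and (iii') $X\setminus\bigsqcup_{i\in I}S_iV_i\precsim B$. *)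

theory Defs
  imports "HOL-Probability.Probability_Measure" "HOL-Algebra.Group_Action"
begin

text \<open>
  The compact metrizable space is the universe of a type of class \<open>metric_space\<close>; the metric of that
  class is the fixed compatible metric.  The group is discrete, so an action is continuous
  as soon as each group element acts continuously.
\<close>

locale topological_action = group_action G UNIV \<phi>
  for G :: "('g, 'm) monoid_scheme" and \<phi> :: "'g \<Rightarrow> 'x::metric_space \<Rightarrow> 'x" +
  assumes continuous_action: "g \<in> carrier G \<Longrightarrow> continuous_on UNIV (\<phi> g)"

definition invariant_finset :: "('g, 'm) monoid_scheme \<Rightarrow> 'g set \<Rightarrow> real \<Rightarrow> 'g set \<Rightarrow> bool" where
  "invariant_finset G K \<delta> F \<longleftrightarrow>
     finite F \<and> F \<noteq> {} \<and> F \<subseteq> carrier G \<and>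
     real (card (sym_diff (K <#>\<^bsub>G\<^esub> F) F)) / real (card F) < \<delta>"

text \<open>
  Amenability is the Foelner condition.  Here and below the finite set \<open>K\<close> is required to be
  nonempty: since \<open>{} <#> F = {}\<close>, no set is \<open>({}, \<delta>)\<close>-invariant for \<open>\<delta> \<le> 1\<close>, so admitting
  \<open>K = {}\<close> would make these conditions unsatisfiable.
\<close>

definition amenable_group :: "('g, 'm) monoid_scheme \<Rightarrow> bool" where
  "amenable_group G \<longleftrightarrow>
     group G \<and>
     (\<forall>K \<delta>. finite K \<and> K \<noteq> {} \<and> K \<subseteq> carrier G \<and> \<delta> > 0 \<longrightarrow> (\<exists>F. invariant_finset G K \<delta> F))"

definition invariant_measures ::
    "('g, 'm) monoid_scheme \<Rightarrow> ('g \<Rightarrow> 'x::metric_space \<Rightarrow> 'x) \<Rightarrow> 'x measure set" where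
  "invariant_measures G \<phi> =
     {\<mu>. sets \<mu> = sets borel \<and> prob_space \<mu> \<and> (\<forall>g\<in>carrier G. distr \<mu> borel (\<phi> g) = \<mu>)}"

definition essentially_free ::
    "('g, 'm) monoid_scheme \<Rightarrow> ('g \<Rightarrow> 'x::metric_space \<Rightarrow> 'x) \<Rightarrow> bool" where
  "essentially_free G \<phi> \<longleftrightarrow>
     (\<forall>g\<in>carrier G - {\<one>\<^bsub>G\<^esub>}. \<forall>\<mu>\<in>invariant_measures G \<phi>. measure \<mu> {x. \<phi> g x = x} = 0)"

definition small_boundary_property ::
    "('g, 'm) monoid_scheme \<Rightarrow> ('g \<Rightarrow> 'x::metric_space \<Rightarrow> 'x) \<Rightarrow> bool" where
  "small_boundary_property G \<phi> \<longleftrightarrow>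
     (\<exists>\<B>. topological_basis \<B> \<and>
        (\<forall>U\<in>\<B>. \<forall>\<mu>\<in>invariant_measures G \<phi>. measure \<mu> (frontier U) = 0))"

definition dyn_subequivalent ::
    "('g, 'm) monoid_scheme \<Rightarrow> ('g \<Rightarrow> 'x::metric_space \<Rightarrow> 'x) \<Rightarrow> 'x set \<Rightarrow> 'x set \<Rightarrow> bool" where
  "dyn_subequivalent G \<phi> A B \<longleftrightarrow>
     (\<forall>C. closed C \<and> C \<subseteq> A \<longrightarrow>
        (\<exists>\<U> g. finite \<U> \<and> (\<forall>U\<in>\<U>. open U) \<and> C \<subseteq> \<Union>\<U> \<and>
           (\<forall>U\<in>\<U>. g U \<in> carrier G \<and> \<phi> (g U) ` U \<subseteq> B) \<and>
           disjoint_family_on (\<lambda>U. \<phi> (g U) ` U) \<U>))"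

definition has_comparison ::
    "('g, 'm) monoid_scheme \<Rightarrow> ('g \<Rightarrow> 'x::metric_space \<Rightarrow> 'x) \<Rightarrow> bool" where
  "has_comparison G \<phi> \<longleftrightarrow>
     (\<forall>A B. open A \<and> open B \<and> (\<forall>\<mu>\<in>invariant_measures G \<phi>. measure \<mu> A < measure \<mu> B) \<longrightarrow>
        dyn_subequivalent G \<phi> A B)"

definition lower_density_on :: "('g \<Rightarrow> 'x \<Rightarrow> 'x) \<Rightarrow> 'g set \<Rightarrow> 'x set \<Rightarrow> real" where
  "lower_density_on \<phi> F A = (INF x. real (card {t \<in> F. \<phi> t x \<in> A}) / real (card F))"

definition lower_banach_density ::
    "('g, 'm) monoid_scheme \<Rightarrow> ('g \<Rightarrow> 'x \<Rightarrow> 'x) \<Rightarrow> 'x set \<Rightarrow> real" where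
  "lower_banach_density G \<phi> A =
     (SUP F \<in> {F. finite F \<and> F \<noteq> {} \<and> F \<subseteq> carrier G}. lower_density_on \<phi> F A)"

definition tower ::
    "('g, 'm) monoid_scheme \<Rightarrow> ('g \<Rightarrow> 'x \<Rightarrow> 'x) \<Rightarrow> 'g set \<Rightarrow> 'x set \<Rightarrow> bool" where
  "tower G \<phi> S V \<longleftrightarrow> finite S \<and> S \<subseteq> carrier G \<and> disjoint_family_on (\<lambda>s. \<phi> s ` V) S"

text \<open>A castle is a finite set of pairs (shape, base).\<close>

definition castle ::
    "('g, 'm) monoid_scheme \<Rightarrow> ('g \<Rightarrow> 'x \<Rightarrow> 'x) \<Rightarrow> ('g set \<times> 'x set) set \<Rightarrow> bool" where
  "castle G \<phi> \<C> \<longleftrightarrow>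
     finite \<C> \<and> (\<forall>(S, V)\<in>\<C>. tower G \<phi> S V) \<and>
     disjoint_family_on (\<lambda>((S, V), s). \<phi> s ` V) (SIGMA T:\<C>. fst T)"

definition footprint :: "('g \<Rightarrow> 'x \<Rightarrow> 'x) \<Rightarrow> ('g set \<times> 'x set) set \<Rightarrow> 'x set" where
  "footprint \<phi> \<C> = (\<Union>(S, V)\<in>\<C>. \<Union>s\<in>S. \<phi> s ` V)"

definition open_castle ::
    "('g, 'm) monoid_scheme \<Rightarrow> ('g \<Rightarrow> 'x::metric_space \<Rightarrow> 'x) \<Rightarrow> ('g set \<times> 'x set) set \<Rightarrow> bool" where
  "open_castle G \<phi> \<C> \<longleftrightarrow> castle G \<phi> \<C> \<and> (\<forall>(S, V)\<in>\<C>. open V)"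

definition almost_finite_in_measure ::
    "('g, 'm) monoid_scheme \<Rightarrow> ('g \<Rightarrow> 'x::metric_space \<Rightarrow> 'x) \<Rightarrow> bool" where
  "almost_finite_in_measure G \<phi> \<longleftrightarrow>
     (\<forall>K \<delta> \<epsilon>. finite K \<and> K \<noteq> {} \<and> K \<subseteq> carrier G \<and> \<delta> > 0 \<and> \<epsilon> > 0 \<longrightarrow>
        (\<exists>\<C>. open_castle G \<phi> \<C> \<and>
           (\<forall>(S, V)\<in>\<C>. \<forall>s\<in>S. diameter (\<phi> s ` V) \<le> \<delta>) \<and>
           (\<forall>(S, V)\<in>\<C>. invariant_finset G K \<delta> S) \<and>
           lower_banach_density G \<phi> (footprint \<phi> \<C>) \<ge> 1 - \<epsilon>))"

definition minimal_action ::
    "('g, 'm) monoid_scheme \<Rightarrow> ('g \<Rightarrow> 'x::metric_space \<Rightarrow> 'x) \<Rightarrow> bool" where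
  "minimal_action G \<phi> \<longleftrightarrow>
     (\<forall>A. closed A \<and> (\<forall>g\<in>carrier G. \<phi> g ` A \<subseteq> A) \<longrightarrow> A = {} \<or> A = UNIV)"

text \<open>The following is the definition of almost finiteness for minimal actions only.\<close>

definition almost_finite ::
    "('g, 'm) monoid_scheme \<Rightarrow> ('g \<Rightarrow> 'x::metric_space \<Rightarrow> 'x) \<Rightarrow> bool" where
  "almost_finite G \<phi> \<longleftrightarrow>
     (\<forall>K B \<delta>. finite K \<and> K \<noteq> {} \<and> K \<subseteq> carrier G \<and> open B \<and> B \<noteq> {} \<and> \<delta> > 0 \<longrightarrow>
        (\<exists>\<C>. open_castle G \<phi> \<C> \<and>
           (\<forall>(S, V)\<in>\<C>. \<forall>s\<in>S. diameter (\<phi> s ` V) \<le> \<delta>) \<and>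
           (\<forall>(S, V)\<in>\<C>. invariant_finset G K \<delta> S) \<and>
           dyn_subequivalent G \<phi> (UNIV - footprint \<phi> \<C>) B))"

end

theory Submission
  imports Defs
begin

text \<open>
  All the conditions in the theorem are compared with one statement about measures: for all
  \<open>\<delta>, \<epsilon> > 0\<close> there is an open castle whose levels have diameter at most \<open>\<delta>\<close> and whose footprint has
  a complement of measure less than \<open>\<epsilon>\<close> for all invariant measures simultaneously.

  Measures and densities are exchanged through \<open>uniform_density_bound\<close>.  If two closed sets satisfy
  \<open>\<mu> C + \<mu> D < a\<close> for every invariant \<open>\<mu>\<close>, then along every sufficiently invariant finite set every
  orbit visits \<open>C\<close> and \<open>D\<close>, and even neighbourhoods of them, with total frequency less than \<open>a\<close>, by a
  definite margin.  Otherwise there are orbit pieces along a Foelner sequence that visit too often;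
  a cluster point of their empirical means is an invariant finitely additive mean on all subsets of the
  space, and \<open>finitely_additive_to_borel\<close> turns it into an invariant Borel measure that
  contradicts the hypothesis.  In the opposite direction counting bounds are integrated.

  From castles to small boundaries (\<open>small_boundary_of_castles\<close>): the levels of an open castle are
  open and disjoint, so the boundary of any union of levels lies outside the footprint and has small
  measure.  A closed set can thus be separated from the complement of an open neighbourhood by
  an open set with a boundary of small measure.  Repeating this inside ever smaller neighbourhoods of
  the boundary gives, in the limit, a boundary of measure zero.

  From small boundaries to castles (\<open>castles_of_small_boundary\<close>): this is the Ornstein--Weiss
  quasi-tiling argument, carried out with Borel sets whose frontier is null.  These sets form a
  Boolean algebra that is preserved by the action.  Away from a small neighbourhood of the points that
  are not free, the space is covered by finitely many bases of towers of a given Foelner shape \<open>F\<close>.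
  One goes through them in turn and adds the part of each tower that is not yet occupied, wherever at
  most a fraction \<open>e\<close> of the tower is occupied.  After this round every good point \<open>x\<close> has at
  least a fraction \<open>e\<close> of \<open>F x\<close> in the footprint.  If the points outside the old footprint whose
  \<open>F\<close>-orbit meets it are rare, the part still uncovered shrinks by the factor \<open>1 - e\<close>, up to a
  small error.  These points are rare when the earlier shapes are very invariant under \<open>F\<close>; so the
  shapes are chosen in reverse order, which makes \<open>quasi_tiling_exists\<close> an induction over an
  arbitrary finite set \<open>L\<close> that the footprint must respect.  Passing to interiors makes the castle
  open and costs a null set.

  For minimal actions, every nonempty open set has measure bounded below, so comparison moves a
  remainder of small measure into it; this gives almost finiteness.  Conversely, if \<open>\<mu> A < \<mu> B\<close> for
  all \<open>\<mu>\<close> and \<open>C\<close> is a closed subset of \<open>A\<close>, set aside a small open piece \<open>B\<^sub>0\<close> of \<open>B\<close>.  In each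
  tower of a fine castle with sufficiently invariant shapes there are at least as many levels contained
  in \<open>B - closure B\<^sub>0\<close> as there are levels that meet \<open>C\<close>, by \<open>uniform_density_bound\<close>.  So these levels
  can be moved inside their towers, and the remainder of the castle goes into \<open>B\<^sub>0\<close>.  Finite spaces,
  which have no open pieces of small measure, are treated separately.
\<close>

section \<open>From finitely additive means to Borel measures\<close>

text \<open>
  A Lebesgue number \<open>e\<close> of the cover does it: \<open>L i\<close> consists of the points of \<open>K\<close> whose \<open>e\<close>-ball
  lies in \<open>U i\<close>, which is a closed condition.
\<close>

lemma closed_finite_shrinking:
  fixes K :: "'x::metric_space set"
  assumes "compact K" and "finite I" and "\<And>i. i \<in> I \<Longrightarrow> open (U i)" and "K \<subseteq> (\<Union>i\<in>I. U i)"
  obtains L where "\<And>i. i \<in> I \<Longrightarrow> closed (L i)" and "\<And>i. i \<in> I \<Longrightarrow> L i \<subseteq> U i" and "K = (\<Union>i\<in>I. L i)"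
proof -
  obtain e where e: "e > 0" "\<And>x. x \<in> K \<Longrightarrow> \<exists>V\<in>U ` I. ball x e \<subseteq> V"
    using Heine_Borel_lemma[of K "U ` I"] assms by (metis imageE)
  define L where "L i = K \<inter> {x. ball x e \<subseteq> U i}" for i
  have "closed {x. ball x e \<subseteq> V}" for V :: "'x set"
  proof -
    have "{x. ball x e \<subseteq> V} = - (\<Union>z\<in>-V. ball z e)"
      by (auto simp: dist_commute)
    then show ?thesis by (metis open_UN open_ball closed_Compl)
  qed
  then have "closed (L i)" for i
    unfolding L_def using \<open>compact K\<close> by (simp add: closed_Int compact_imp_closed)
  moreover have "L i \<subseteq> U i" for i
    using \<open>e > 0\<close> by (auto simp: L_def)
  moreover have "K = (\<Union>i\<in>I. L i)"
    using e(2) by (force simp: L_def)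
  ultimately show ?thesis using that by blast
qed

lemma finitely_additive_subadditive:
  fixes m :: "'x set \<Rightarrow> real"
  assumes nonneg: "\<And>A. 0 \<le> m A" and add: "\<And>A B. A \<inter> B = {} \<Longrightarrow> m (A \<union> B) = m A + m B"
  shows "A \<subseteq> B \<Longrightarrow> m A \<le> m B" and "m {} = 0"
    and "finite I \<Longrightarrow> m (\<Union>i\<in>I. D i) \<le> (\<Sum>i\<in>I. m (D i))"
proof -
  have mono: "m A \<le> m B" if "A \<subseteq> B" for A B
  proof -
    have "m B = m (A \<union> (B - A))" using that by (simp add: Un_absorb1)
    also have "\<dots> = m A + m (B - A)" by (rule add) auto
    finally show ?thesis using nonneg[of "B - A"] by simp
  qed
  show "A \<subseteq> B \<Longrightarrow> m A \<le> m B" by (rule mono)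
  show empty: "m {} = 0" using add[of "{}" "{}"] by simp
  show "m (\<Union>i\<in>I. D i) \<le> (\<Sum>i\<in>I. m (D i))" if "finite I"
    using that
  proof induction
    case empty
    then show ?case using \<open>m {} = 0\<close> by simp
  next
    case (insert j I)
    have "m (\<Union>i\<in>insert j I. D i) = m (D j \<union> ((\<Union>i\<in>I. D i) - D j))" by (simp add: Un_Diff_cancel)
    also have "\<dots> = m (D j) + m ((\<Union>i\<in>I. D i) - D j)" by (rule add) auto
    also have "\<dots> \<le> m (D j) + m (\<Union>i\<in>I. D i)" by (simp add: mono)
    finally show ?case using insert by simp
  qed
qed

text \<open>
  The Riesz construction with the mean \<open>m\<close> as the only datum: the value on an open set is the
  supremum of \<open>m\<close> over its closed subsets, and the outer measure of a set is the infimum over its open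
  supersets.  Countable subadditivity on open sets comes from compactness, because a closed subset
  of a countable union is split into finitely many closed pieces.  The two inequalities are what
  remains of \<open>m\<close>; they correspond to upper and lower semicontinuity in the weak topology.
\<close>

proposition finitely_additive_to_borel:
  fixes m :: "'x::metric_space set \<Rightarrow> real"
  assumes cpt: "compact (UNIV :: 'x set)"
    and nonneg: "\<And>A. 0 \<le> m A"
    and add: "\<And>A B. A \<inter> B = {} \<Longrightarrow> m (A \<union> B) = m A + m B"
  obtains \<mu> :: "'x measure" where "sets \<mu> = sets borel"
    and "\<And>K. closed K \<Longrightarrow> ennreal (m K) \<le> emeasure \<mu> K"
    and "\<And>U. open U \<Longrightarrow> emeasure \<mu> U \<le> ennreal (m U)"
proof -
  note mono = finitely_additive_subadditive(1)[of m, OF nonneg add]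
  note m_empty = finitely_additive_subadditive(2)[of m, OF nonneg add]
  note subadd = finitely_additive_subadditive(3)[of m, OF nonneg add]
  define b where "b U = (SUP K\<in>{K. closed K \<and> K \<subseteq> U}. ennreal (m K))" for U
  define f where "f A = (INF U\<in>{U. open U \<and> A \<subseteq> U}. b U)" for A
  have b_ge: "ennreal (m K) \<le> b U" if "closed K" "K \<subseteq> U" for K U
    unfolding b_def using that by (intro SUP_upper) auto
  have b_le: "b U \<le> ennreal (m U)" for U
    unfolding b_def by (intro SUP_least) (auto intro!: ennreal_leI mono)
  have b_fin: "b U < \<infinity>" for U
    using b_le[of U] by (simp add: le_less_trans)
  have b_mono: "b U \<le> b V" if "U \<subseteq> V" for U V
    unfolding b_def using that by (intro SUP_subset_mono) auto
  have b_approx: "\<exists>K. closed K \<and> K \<subseteq> U \<and> b U \<le> ennreal (m K) + ennreal e" if "e > 0" for U e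
  proof -
    have "\<exists>K\<in>{K. closed K \<and> K \<subseteq> U}. b U < ennreal (m K) + ennreal e"
      by (rule SUP_approx_ennreal[OF that _ b_def]) (use b_fin[of U] in auto)
    then show ?thesis by (auto intro: less_imp_le)
  qed
  have f_le: "f A \<le> b U" if "open U" "A \<subseteq> U" for A U
    unfolding f_def using that by (intro INF_lower) auto
  have f_open: "f U = b U" if "open U" for U
    using that f_le[of U U] unfolding f_def by (intro antisym INF_greatest) (auto intro: b_mono)
  have f_mono: "f A \<le> f B" if "A \<subseteq> B" for A B
    unfolding f_def using that by (intro INF_superset_mono) auto
  have f_approx: "\<exists>U. open U \<and> A \<subseteq> U \<and> b U \<le> f A + ennreal e" if "e > 0" for A e
  proof -
    have "f A < \<infinity>" using f_le[of UNIV A] b_fin[of UNIV] by (simp add: le_less_trans)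
    then have "\<exists>U\<in>{U. open U \<and> A \<subseteq> U}. b U < f A + ennreal e"
      by (intro INF_approx_ennreal[OF that f_def]) auto
    then show ?thesis by (auto intro: less_imp_le)
  qed
  have b_UN: "b (\<Union>i. U i) \<le> (\<Sum>i. b (U i))" if U: "\<And>i::nat. open (U i)" for U
    unfolding b_def
  proof (rule SUP_least, fold b_def)
    fix K assume "K \<in> {K. closed K \<and> K \<subseteq> (\<Union>i. U i)}"
    then have K: "closed K" "K \<subseteq> (\<Union>i. U i)" by auto
    then have cK: "compact K" using cpt compact_Int_closed[of UNIV K] by simp
    obtain I where I: "finite I" "K \<subseteq> (\<Union>i\<in>I. U i)"
      using compactE_image[OF cK, of UNIV U] U K by metis
    obtain L where L: "\<And>i. i \<in> I \<Longrightarrow> closed (L i)" "\<And>i. i \<in> I \<Longrightarrow> L i \<subseteq> U i" "K = (\<Union>i\<in>I. L i)"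
      using closed_finite_shrinking[of K I U] I U cK by metis
    have "ennreal (m K) \<le> ennreal (\<Sum>i\<in>I. m (L i))"
      unfolding L(3) using I subadd by (intro ennreal_leI)
    also have "\<dots> = (\<Sum>i\<in>I. ennreal (m (L i)))" using nonneg by simp
    also have "\<dots> \<le> (\<Sum>i\<in>I. b (U i))" using L b_ge by (intro sum_mono) auto
    also have "\<dots> \<le> (\<Sum>i. b (U i))" using I by (intro sum_le_suminf) auto
    finally show "ennreal (m K) \<le> (\<Sum>i. b (U i))" .
  qed
  have csub: "countably_subadditive UNIV f"
    unfolding countably_subadditive_def
  proof (intro allI impI)
    fix A :: "nat \<Rightarrow> 'x set"
    show "f (\<Union>i. A i) \<le> (\<Sum>i. f (A i))"
    proof (rule ennreal_le_epsilon)
      fix e :: real assume "0 < e"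
      have "\<exists>U. open U \<and> A i \<subseteq> U \<and> b U \<le> f (A i) + ennreal (e * (1/2)^Suc i)" for i
        using f_approx \<open>0 < e\<close> by simp
      then obtain U where U: "\<And>i. open (U i)" "\<And>i. A i \<subseteq> U i"
          "\<And>i. b (U i) \<le> f (A i) + ennreal (e * (1/2)^Suc i)" by metis
      have "f (\<Union>i. A i) \<le> b (\<Union>i. U i)" using U by (intro f_le) auto
      also have "\<dots> \<le> (\<Sum>i. b (U i))" by (rule b_UN) (rule U)
      also have "\<dots> \<le> (\<Sum>i. f (A i) + ennreal (e * (1/2)^Suc i))"
        using U by (intro suminf_le) auto
      also have "\<dots> = (\<Sum>i. f (A i)) + (\<Sum>i. ennreal (e * (1/2)^Suc i))"
        by (intro suminf_add[symmetric]) auto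
      also have "(\<Sum>i. ennreal (e * (1/2)^Suc i)) = ennreal e"
      proof (rule suminf_ennreal_eq)
        show "0 \<le> e * (1/2)^Suc i" for i using \<open>0 < e\<close> by simp
        show "(\<lambda>i. e * (1/2)^Suc i) sums e"
          using sums_mult[OF power_half_series, of e] by (simp only: mult_1_right)
      qed
      finally show "f (\<Union>i. A i) \<le> (\<Sum>i. f (A i)) + ennreal e" .
    qed
  qed
  have f_empty: "f {} = 0"
    using f_open[of "{}"] b_le[of "{}"] m_empty by simp
  interpret S: sigma_algebra UNIV "UNIV :: 'x set set"
    by (metis Pow_UNIV sigma_algebra_Pow)
  have ms: "measure_space UNIV (lambda_system UNIV UNIV f) f"
    using csub f_empty f_mono
    by (intro S.caratheodory_lemma) (auto simp: outer_measure_space_def positive_def increasing_def)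
  \<comment> \<open>Caratheodory measurability of open sets: inside an open W approximate W \<inter> U from
      within by a closed K, and then W - K, which contains W - U, by a disjoint closed L.\<close>
  have open_lambda: "U \<in> lambda_system UNIV UNIV f" if U: "open U" for U
  proof -
    have "f (A \<inter> U) + f (A - U) = f A" for A
    proof (rule antisym)
      show "f A \<le> f (A \<inter> U) + f (A - U)"
      proof -
        have "subadditive UNIV f"
          using csub f_empty by (intro S.countably_subadditive_subadditive) (simp_all add: positive_def)
        then have "f ((A \<inter> U) \<union> (A - U)) \<le> f (A \<inter> U) + f (A - U)"
          by (rule subadditiveD) auto
        moreover have "(A \<inter> U) \<union> (A - U) = A" by auto
        ultimately show ?thesis by simp
      qed
      show "f (A \<inter> U) + f (A - U) \<le> f A"
        unfolding f_def[of A]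
      proof (rule INF_greatest)
        fix W assume "W \<in> {U. open U \<and> A \<subseteq> U}"
        then have W: "open W" "A \<subseteq> W" by auto
        show "f (A \<inter> U) + f (A - U) \<le> b W"
        proof (rule ennreal_le_epsilon)
          fix e :: real assume "0 < e"
          obtain K where K: "closed K" "K \<subseteq> W \<inter> U" "b (W \<inter> U) \<le> ennreal (m K) + ennreal (e/2)"
            using b_approx \<open>0 < e\<close> by (metis half_gt_zero)
          obtain L where L: "closed L" "L \<subseteq> W - K" "b (W - K) \<le> ennreal (m L) + ennreal (e/2)"
            using b_approx \<open>0 < e\<close> by (metis half_gt_zero)
          have "f (A \<inter> U) + f (A - U) \<le> b (W \<inter> U) + b (W - K)"
            using W U K by (intro add_mono f_le) auto
          also have "\<dots> \<le> ennreal (m K) + ennreal (e/2) + (ennreal (m L) + ennreal (e/2))"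
            using K L by (intro add_mono) auto
          also have "\<dots> = ennreal (m K + m L) + ennreal e"
            using \<open>0 < e\<close> nonneg by (simp flip: ennreal_plus)
          also have "m K + m L = m (K \<union> L)" using L by (intro add[symmetric]) auto
          also have "ennreal (m (K \<union> L)) \<le> b W" using K L by (intro b_ge) auto
          finally show "f (A \<inter> U) + f (A - U) \<le> b W + ennreal e" by simp
        qed
      qed
    qed
    then show ?thesis by (simp add: S.lambda_system_eq)
  qed
  have "sigma_algebra UNIV (lambda_system UNIV UNIV f)"
    using ms by (simp add: measure_space_def)
  then have "sigma_sets UNIV {U. open U} \<subseteq> lambda_system UNIV UNIV f"
    by (rule sigma_algebra.sigma_sets_subset) (use open_lambda in auto)
  then have "sets borel \<subseteq> lambda_system UNIV UNIV f"
    by (simp add: borel_def)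
  then have msb: "measure_space UNIV (sets (borel :: 'x measure)) f"
    using ms sets.sigma_algebra_axioms[of "borel :: 'x measure"] by (auto intro: measure_down)
  define \<mu> where "\<mu> = measure_of UNIV (sets (borel :: 'x measure)) f"
  have sets: "sets \<mu> = sets borel"
    unfolding \<mu>_def by (metis sets.sets_measure_of_eq space_borel)
  have em: "emeasure \<mu> A = f A" if "A \<in> sets borel" for A
    unfolding \<mu>_def using msb that by (auto simp: measure_space_def intro!: emeasure_measure_of_sigma)
  show ?thesis
  proof
    show "sets \<mu> = sets borel" by (rule sets)
    show "ennreal (m K) \<le> emeasure \<mu> K" if "closed K" for K
      using that b_ge[of K] by (auto simp: em f_def intro!: INF_greatest)
    show "emeasure \<mu> U \<le> ennreal (m U)" if "open U" for U
      using that b_le[of U] by (simp add: em f_open)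
  qed
qed

text \<open>
  Tychonoff's theorem for \<open>[0, 1]\<close>-valued functions.  A filter replaces the subsequence, which need not
  exist because the index type \<open>'a\<close> may be uncountable.
\<close>

lemma bounded_functions_cluster:
  fixes m :: "nat \<Rightarrow> 'a \<Rightarrow> real"
  assumes "\<And>n a. m n a \<in> {0..1}"
  obtains F l where "F \<noteq> bot" "F \<le> sequentially" "\<And>a. ((\<lambda>n. m n a) \<longlongrightarrow> l a) F"
proof -
  let ?K = "PiE UNIV (\<lambda>_::'a. {0..1::real})"
  have "compactin (product_topology (\<lambda>_. euclidean) UNIV) ?K"
    by (auto simp: compactin_PiE)
  then have "compact ?K" by (simp add: euclidean_product_topology)
  moreover have "eventually (\<lambda>f. f \<in> ?K) (filtermap m sequentially)"
    using assms by (auto simp: eventually_filtermap PiE_def)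
  ultimately obtain l where l: "inf (nhds l) (filtermap m sequentially) \<noteq> bot"
    unfolding compact_filter by (metis filtermap_bot_iff sequentially_bot)
  define F where "F = inf sequentially (filtercomap m (nhds l))"
  have "F \<noteq> bot"
  proof
    assume "F = bot"
    then have "eventually (\<lambda>_. False) F" by simp
    then obtain P Q where P: "eventually P sequentially" and Q: "eventually Q (filtercomap m (nhds l))"
      and PQ: "\<And>n. P n \<Longrightarrow> Q n \<Longrightarrow> False"
      unfolding F_def eventually_inf by auto
    obtain R where R: "eventually R (nhds l)" "\<And>n. R (m n) \<Longrightarrow> Q n"
      using Q unfolding eventually_filtercomap by auto
    have "eventually (\<lambda>f. \<not> R f) (filtermap m sequentially)"
      unfolding eventually_filtermap using P by (rule eventually_mono) (use PQ R in blast)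
    then have "eventually (\<lambda>_. False) (inf (nhds l) (filtermap m sequentially))"
      using R(1) unfolding eventually_inf by blast
    then show False using l by simp
  qed
  moreover have "F \<le> sequentially" unfolding F_def by simp
  moreover have "((\<lambda>n. m n a) \<longlongrightarrow> l a) F" for a
  proof -
    have lim: "filterlim m (nhds l) F"
      unfolding F_def by (meson filterlim_filtercomap filterlim_mono inf_le2 order_refl)
    show ?thesis
    proof (rule topological_tendstoI)
      fix V :: "real set" assume "open V" "l a \<in> V"
      then have "eventually (\<lambda>f. f a \<in> V) (nhds l)"
        using open_vimage[OF \<open>open V\<close> continuous_on_product_coordinates[of a]]
        by (auto simp: eventually_nhds)
      then show "eventually (\<lambda>n. m n a \<in> V) F"
        using lim by (auto simp: filterlim_iff)
    qed
  qed
  ultimately show ?thesis using that by blast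
qed

section \<open>Compact actions of countable amenable groups\<close>

locale compact_amenable_action = topological_action G \<phi>
  for G (structure) and \<phi> :: "'g \<Rightarrow> 'x::metric_space \<Rightarrow> 'x" +
  assumes countable_carrier: "countable (carrier G)"
    and amenable: "amenable_group G"
    and compact_space: "compact (UNIV :: 'x set)"
begin

sublocale group G
  using amenable by (simp add: amenable_group_def)

abbreviation "IM \<equiv> invariant_measures G \<phi>"

lemma act_mult [simp]: "g \<in> carrier G \<Longrightarrow> h \<in> carrier G \<Longrightarrow> \<phi> (g \<otimes> h) x = \<phi> g (\<phi> h x)"
  by (rule composition_rule) auto

lemma act_one [simp]: "\<phi> \<one> x = x"
  using id_eq_one by (metis UNIV_I restrict_apply')

lemma act_inv_left [simp]: "g \<in> carrier G \<Longrightarrow> \<phi> (inv g) (\<phi> g x) = x"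
  using act_mult[of "inv g" g x] by simp

lemma act_inv_right [simp]: "g \<in> carrier G \<Longrightarrow> \<phi> g (\<phi> (inv g) x) = x"
  using act_mult[of g "inv g" x] by simp

lemma act_eq_iff [simp]: "g \<in> carrier G \<Longrightarrow> \<phi> g x = \<phi> g y \<longleftrightarrow> x = y"
  by (metis act_inv_left)

lemma act_image_eq_vimage: "g \<in> carrier G \<Longrightarrow> \<phi> g ` A = \<phi> (inv g) -` A"
  by (force simp: image_iff)

lemma open_act_vimage: "g \<in> carrier G \<Longrightarrow> open A \<Longrightarrow> open (\<phi> g -` A)"
  by (simp add: continuous_action open_vimage)

lemma closed_act_vimage: "g \<in> carrier G \<Longrightarrow> closed A \<Longrightarrow> closed (\<phi> g -` A)"
  by (simp add: continuous_action closed_vimage)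

lemma open_act_image: "g \<in> carrier G \<Longrightarrow> open A \<Longrightarrow> open (\<phi> g ` A)"
  by (simp add: act_image_eq_vimage open_act_vimage)

lemma borel_act_vimage: "g \<in> carrier G \<Longrightarrow> A \<in> sets borel \<Longrightarrow> \<phi> g -` A \<in> sets borel"
  using measurable_sets_borel[OF borel_measurable_continuous_onI[OF continuous_action]] by blast

lemma borel_act_image: "g \<in> carrier G \<Longrightarrow> A \<in> sets borel \<Longrightarrow> \<phi> g ` A \<in> sets borel"
  by (simp add: act_image_eq_vimage borel_act_vimage)

lemma frontier_act_vimage: "g \<in> carrier G \<Longrightarrow> frontier (\<phi> g -` A) = \<phi> g -` frontier A"
proof -
  assume g: "g \<in> carrier G"
  have int: "\<phi> h -` interior A \<subseteq> interior (\<phi> h -` A)" if "h \<in> carrier G" for A h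
    using that by (intro interior_maximal open_act_vimage vimage_mono interior_subset) auto
  have "interior (\<phi> g -` A) \<subseteq> \<phi> g -` interior A" for A
  proof -
    have sub: "\<phi> (inv g) -` interior (\<phi> g -` A) \<subseteq> interior A"
      using int[of "inv g" "\<phi> g -` A"] g by (simp add: vimage_def)
    show ?thesis
    proof
      fix x assume "x \<in> interior (\<phi> g -` A)"
      then have "\<phi> g x \<in> \<phi> (inv g) -` interior (\<phi> g -` A)" using g by simp
      then show "x \<in> \<phi> g -` interior A" using sub by blast
    qed
  qed
  then have *: "interior (\<phi> g -` A) = \<phi> g -` interior A" for A using int[OF g] by blast
  show ?thesis
    unfolding frontier_def closure_interior by (simp add: * vimage_Diff flip: vimage_Compl)
qed

lemma compact_of_closed: "closed C \<Longrightarrow> compact (C :: 'x set)"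
  using compact_Int_closed[OF compact_space, of C] by simp

lemma invariant_measureD:
  assumes "\<mu> \<in> IM"
  shows "prob_space \<mu>" and "sets \<mu> = sets borel" and "space \<mu> = UNIV"
proof -
  show "prob_space \<mu>" and s: "sets \<mu> = sets borel" using assms by (auto simp: invariant_measures_def)
  show "space \<mu> = UNIV" using sets_eq_imp_space_eq[OF s] by simp
qed

lemma invariant_measure_act_vimage:
  assumes "\<mu> \<in> IM" and "g \<in> carrier G" and "A \<in> sets borel"
  shows "measure \<mu> (\<phi> g -` A) = measure \<mu> A"
proof -
  have "\<phi> g \<in> measurable \<mu> borel"
    using borel_measurable_continuous_onI[OF continuous_action[OF assms(2)]] invariant_measureD[OF assms(1)]
    by (simp cong: measurable_cong_sets)
  then have "measure (distr \<mu> borel (\<phi> g)) A = measure \<mu> (\<phi> g -` A)"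
    using assms(3) invariant_measureD[OF assms(1)] by (simp add: measure_distr)
  then show ?thesis using assms by (simp add: invariant_measures_def)
qed

lemma invariant_measure_act_image:
  assumes "\<mu> \<in> IM" and "g \<in> carrier G" and "A \<in> sets borel"
  shows "measure \<mu> (\<phi> g ` A) = measure \<mu> A"
  using assms by (simp add: act_image_eq_vimage invariant_measure_act_vimage)

text \<open>
  By invariance each of the translates \<open>\<phi> f -` B\<close> has the measure of \<open>B\<close>.  Pointwise bounds for
  the number of visits to \<open>B\<close> therefore integrate to bounds for \<open>measure \<mu> B\<close>; the next two lemmas
  record a lower and an upper bound.
\<close>

lemma integral_hits:
  assumes \<mu>: "\<mu> \<in> IM" and F: "finite F" "F \<subseteq> carrier G" and B: "B \<in> sets borel"
  shows "integrable \<mu> (\<lambda>x. real (card {f \<in> F. \<phi> f x \<in> B}))"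
    and "(\<integral>x. real (card {f \<in> F. \<phi> f x \<in> B}) \<partial>\<mu>) = real (card F) * measure \<mu> B"
proof -
  interpret prob_space \<mu> using \<mu> by (rule invariant_measureD)
  note S = invariant_measureD[OF \<mu>]
  have vm: "\<phi> f -` B \<in> sets borel" if "f \<in> F" for f using that F B borel_act_vimage by auto
  have int: "integrable \<mu> (indicator (\<phi> f -` B) :: 'x \<Rightarrow> real)" if "f \<in> F" for f
    using vm[OF that] S by (intro integrable_real_indicator) (auto simp: emeasure_eq_measure)
  have eq: "(\<lambda>x. real (card {f \<in> F. \<phi> f x \<in> B})) = (\<lambda>x. \<Sum>f\<in>F. indicator (\<phi> f -` B) x)"
    using F by (simp add: indicator_def sum.If_cases Int_def)
  show "integrable \<mu> (\<lambda>x. real (card {f \<in> F. \<phi> f x \<in> B}))"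
    unfolding eq using int by simp
  have "(\<integral>x. (\<Sum>f\<in>F. indicator (\<phi> f -` B) x) \<partial>\<mu>) = (\<Sum>f\<in>F. measure \<mu> (\<phi> f -` B))"
    using int vm S by (subst Bochner_Integration.integral_sum) auto
  also have "\<dots> = real (card F) * measure \<mu> B"
    using invariant_measure_act_vimage[OF \<mu> _ B] F by (simp add: subset_iff)
  finally show "(\<integral>x. real (card {f \<in> F. \<phi> f x \<in> B}) \<partial>\<mu>) = real (card F) * measure \<mu> B"
    unfolding eq .
qed

lemma invariant_measure_ge_of_counting:
  assumes \<mu>: "\<mu> \<in> IM" and F: "finite F" "F \<noteq> {}" "F \<subseteq> carrier G"
    and B: "B \<in> sets borel" and Q: "Q \<in> sets borel"
    and count: "\<And>x. x \<in> Q \<Longrightarrow> c * real (card F) \<le> real (card {f \<in> F. \<phi> f x \<in> B})"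
  shows "c * measure \<mu> Q \<le> measure \<mu> B"
proof -
  interpret prob_space \<mu> using \<mu> by (rule invariant_measureD)
  note S = invariant_measureD[OF \<mu>]
  have int: "integrable \<mu> (indicator Q :: 'x \<Rightarrow> real)"
    using Q S by (intro integrable_real_indicator) (auto simp: emeasure_eq_measure)
  have "real (card F) * c * measure \<mu> Q = (\<integral>x. real (card F) * c * indicator Q x \<partial>\<mu>)"
    using Q S by simp
  also have "\<dots> \<le> (\<integral>x. real (card {f \<in> F. \<phi> f x \<in> B}) \<partial>\<mu>)"
  proof (rule integral_mono)
    show "integrable \<mu> (\<lambda>x. real (card F) * c * indicator Q x)" using int by simp
    show "integrable \<mu> (\<lambda>x. real (card {f \<in> F. \<phi> f x \<in> B}))"
      by (rule integral_hits(1)[OF \<mu> F(1,3) B])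
    show "real (card F) * c * indicator Q x \<le> real (card {f \<in> F. \<phi> f x \<in> B})" for x
      using count[of x] by (auto simp: indicator_def mult.commute)
  qed
  also have "\<dots> = real (card F) * measure \<mu> B" by (rule integral_hits(2)[OF \<mu> F(1,3) B])
  finally show ?thesis using F by (simp add: mult.assoc card_gt_0_iff)
qed

lemma invariant_measures_le_of_counting:
  assumes \<mu>: "\<mu> \<in> IM" and F: "finite F" "F \<noteq> {}" "F \<subseteq> carrier G"
    and B: "B \<in> sets borel" "D \<in> sets borel"
    and count: "\<And>x. real (card {f \<in> F. \<phi> f x \<in> B}) + real (card {f \<in> F. \<phi> f x \<in> D}) \<le> a * real (card F)"
  shows "measure \<mu> B + measure \<mu> D \<le> a"
proof -
  interpret prob_space \<mu> using \<mu> by (rule invariant_measureD)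
  note hits = integral_hits[OF \<mu> F(1,3)]
  have "real (card F) * measure \<mu> B + real (card F) * measure \<mu> D =
      (\<integral>x. real (card {f \<in> F. \<phi> f x \<in> B}) + real (card {f \<in> F. \<phi> f x \<in> D}) \<partial>\<mu>)"
    using hits[OF B(1)] hits[OF B(2)] by simp
  also have "\<dots> \<le> (\<integral>x. a * real (card F) \<partial>\<mu>)"
    using hits(1)[OF B(1)] hits(1)[OF B(2)] count by (intro integral_mono) auto
  also have "\<dots> = real (card F) * a" by (simp add: prob_space)
  finally have "real (card F) * (measure \<mu> B + measure \<mu> D) \<le> real (card F) * a"
    by (simp add: distrib_left)
  then show ?thesis using F by (simp add: card_gt_0_iff)
qed

end

section \<open>Closed sets that are small for every invariant measure\<close>

definition nbhd :: "real \<Rightarrow> 'x::metric_space set \<Rightarrow> 'x set" where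
  "nbhd r C = (\<Union>c\<in>C. ball c r)"

lemma open_nbhd: "open (nbhd r C)"
  by (auto simp: nbhd_def)

lemma subset_nbhd: "0 < r \<Longrightarrow> C \<subseteq> nbhd r C"
  by (force simp: nbhd_def)

lemma nbhd_mono: "r \<le> s \<Longrightarrow> nbhd r C \<subseteq> nbhd s C"
  by (auto simp: nbhd_def)

lemma closure_nbhd_subset: "0 < r \<Longrightarrow> closure (nbhd r C) \<subseteq> nbhd (2 * r) C"
proof
  fix x assume "0 < r" "x \<in> closure (nbhd r C)"
  then obtain y where y: "y \<in> nbhd r C" "dist y x < r"
    unfolding closure_approachable by blast
  then obtain c where "c \<in> C" "dist c y < r" by (auto simp: nbhd_def)
  then show "x \<in> nbhd (2 * r) C"
    using y dist_triangle[of c x y] by (force simp: nbhd_def)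
qed

lemma nbhd_separated:
  fixes C U :: "'x::metric_space set"
  assumes "compact C" "open U" "C \<subseteq> U"
  obtains r where "0 < r" "nbhd r C \<subseteq> U"
proof -
  obtain r where "0 < r" "\<And>x. x \<in> C \<Longrightarrow> \<exists>V\<in>{U}. ball x r \<subseteq> V"
    using Heine_Borel_lemma[of C "{U}"] assms by auto
  then show ?thesis using that[of r] by (force simp: nbhd_def)
qed

lemma measure_closure_nbhd_tendsto:
  fixes C :: "'x::metric_space set"
  assumes "prob_space \<mu>" and S: "sets \<mu> = sets borel" and C: "closed C"
  shows "(\<lambda>n. measure \<mu> (closure (nbhd (1 / real (Suc n)) C))) \<longlonglongrightarrow> measure \<mu> C"
proof -
  interpret prob_space \<mu> by fact
  let ?A = "\<lambda>n. closure (nbhd (1 / real (Suc n)) C)"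
  have "(\<Inter>n. ?A n) \<subseteq> C"
  proof
    fix x assume x: "x \<in> (\<Inter>n. ?A n)"
    have "\<exists>c\<in>C. dist c x < e" if "e > 0" for e
    proof -
      obtain n where "inverse (real (Suc n)) < e / 2"
        using reals_Archimedean[of "e / 2"] \<open>e > 0\<close> by auto
      then have "2 * (1 / real (Suc n)) \<le> e" by (simp add: inverse_eq_divide)
      then have "x \<in> nbhd e C"
        using x closure_nbhd_subset[of "1 / real (Suc n)" C] nbhd_mono[of "2 * (1 / real (Suc n))" e C] by auto
      then show ?thesis by (auto simp: nbhd_def)
    qed
    then have "x \<in> closure C" by (simp add: closure_approachable)
    then show "x \<in> C" using C by simp
  qed
  moreover have "C \<subseteq> ?A n" for n
    using subset_nbhd[of "1 / real (Suc n)" C] closure_subset by force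
  ultimately have eq: "(\<Inter>n. ?A n) = C" by blast
  have "decseq ?A"
    unfolding decseq_def by (intro allI impI closure_mono nbhd_mono) (simp add: divide_simps)
  then have "(\<lambda>n. measure \<mu> (?A n)) \<longlonglongrightarrow> measure \<mu> (\<Inter>n. ?A n)"
    by (intro finite_Lim_measure_decseq) (simp_all add: S image_subset_iff)
  then show ?thesis by (simp only: eq)
qed

context compact_amenable_action
begin

text \<open>
  Translating by \<open>g\<close> is an injection of the visits to \<open>\<phi> g -` A\<close> along \<open>S\<close> into the visits to
  \<open>A\<close> along \<open>g S\<close>; only those in \<open>g S - S\<close> are lost.
\<close>

lemma card_translate_hits_le:
  assumes S: "finite S" "S \<subseteq> carrier G" and g: "g \<in> carrier G"
  shows "card {t \<in> S. \<phi> t x \<in> \<phi> g -` A} \<le> card {t \<in> S. \<phi> t x \<in> A} + card ((\<lambda>s. g \<otimes> s) ` S - S)"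
proof -
  have "inj_on (\<lambda>s. g \<otimes> s) {t \<in> S. \<phi> t x \<in> \<phi> g -` A}"
    using inj_on_cmult[OF g] by (rule inj_on_subset) (use S in auto)
  then have "card {t \<in> S. \<phi> t x \<in> \<phi> g -` A} = card ((\<lambda>s. g \<otimes> s) ` {t \<in> S. \<phi> t x \<in> \<phi> g -` A})"
    by (simp add: card_image)
  also have "\<dots> \<le> card ({t \<in> S. \<phi> t x \<in> A} \<union> ((\<lambda>s. g \<otimes> s) ` S - S))"
    using S g by (intro card_mono) auto
  also have "\<dots> \<le> card {t \<in> S. \<phi> t x \<in> A} + card ((\<lambda>s. g \<otimes> s) ` S - S)"
    by (rule card_Un_le)
  finally show ?thesis .
qed

lemma invariant_finset_translate:
  assumes S: "invariant_finset G K d S" and K: "finite K" and g: "g \<in> K" "K \<subseteq> carrier G"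
  shows "real (card ((\<lambda>s. g \<otimes> s) ` S - S)) \<le> d * real (card S)"
proof -
  have fin: "finite S" "S \<noteq> {}" and lt: "real (card (sym_diff (K <#> S) S)) / real (card S) < d"
    using S by (auto simp: invariant_finset_def)
  have "finite (K <#> S)" using fin K by (simp add: set_mult_def)
  moreover have "(\<lambda>s. g \<otimes> s) ` S \<subseteq> K <#> S" using g by (auto simp: set_mult_def)
  ultimately have "card ((\<lambda>s. g \<otimes> s) ` S - S) \<le> card (sym_diff (K <#> S) S)"
    using fin by (intro card_mono) auto
  moreover have "real (card (sym_diff (K <#> S) S)) < d * real (card S)"
    using lt fin by (simp add: divide_less_eq card_gt_0_iff split: if_splits)
  ultimately show ?thesis by linarith
qed

text \<open>
  For invariance of the measure it suffices to compare \<open>\<phi> g -` C\<close> with \<open>C\<close> for closed \<open>C\<close>.  Insert an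
  open neighbourhood \<open>N\<close> of \<open>C\<close>: on open sets the measure is at most the mean, the mean is invariant,
  and on the closure of \<open>N\<close> the mean is at most the measure; then let \<open>N\<close> shrink to \<open>C\<close>.  One
  inequality for all \<open>g\<close> gives equality by applying it to the inverse.
\<close>

lemma invariant_measure_of_mean:
  fixes m :: "'x set \<Rightarrow> real"
  assumes nonneg: "\<And>A. 0 \<le> m A" and add: "\<And>A B. A \<inter> B = {} \<Longrightarrow> m (A \<union> B) = m A + m B"
    and total: "m UNIV = 1"
    and inv: "\<And>g A. g \<in> carrier G \<Longrightarrow> m (\<phi> g -` A) \<le> m A"
  obtains \<mu> where "\<mu> \<in> IM" and "\<And>K. closed K \<Longrightarrow> m K \<le> measure \<mu> K"
proof -
  have mono: "m A \<le> m B" if "A \<subseteq> B" for A B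
    using finitely_additive_subadditive(1)[of m] nonneg add that by blast
  obtain \<mu> :: "'x measure" where sets: "sets \<mu> = sets borel"
    and ge: "\<And>K. closed K \<Longrightarrow> ennreal (m K) \<le> emeasure \<mu> K"
    and le: "\<And>U. open U \<Longrightarrow> emeasure \<mu> U \<le> ennreal (m U)"
    using finitely_additive_to_borel[of m, OF compact_space nonneg add] by blast
  have space: "space \<mu> = UNIV" using sets_eq_imp_space_eq[OF sets] by simp
  have "emeasure \<mu> UNIV = 1"
    using ge[of UNIV] le[of UNIV] total by (intro antisym) auto
  then have prob: "prob_space \<mu>" by (intro prob_spaceI) (simp add: space)
  interpret prob_space \<mu> by (rule prob)
  have ge': "m K \<le> measure \<mu> K" if "closed K" for K
    using ge[OF that] by (simp add: emeasure_eq_measure)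
  have le': "measure \<mu> U \<le> m U" if "open U" for U
    using le[OF that] nonneg by (simp add: emeasure_eq_measure)
  have closed_le: "measure \<mu> (\<phi> g -` C) \<le> measure \<mu> C" if g: "g \<in> carrier G" and C: "closed C" for g C
  proof (rule LIMSEQ_le_const[OF measure_closure_nbhd_tendsto[OF prob sets C]], intro exI allI impI)
    fix n
    let ?N = "nbhd (1 / real (Suc n)) C"
    have "measure \<mu> (\<phi> g -` C) \<le> measure \<mu> (\<phi> g -` ?N)"
      using sets g open_nbhd[of "1 / real (Suc n)" C] subset_nbhd[of "1 / real (Suc n)" C]
      by (intro finite_measure_mono vimage_mono) (auto intro: borel_act_vimage)
    also have "\<dots> \<le> m (\<phi> g -` ?N)" using g open_nbhd by (intro le' open_act_vimage)
    also have "\<dots> \<le> m ?N" using g by (rule inv)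
    also have "\<dots> \<le> m (closure ?N)" by (rule mono) (rule closure_subset)
    also have "\<dots> \<le> measure \<mu> (closure ?N)" by (rule ge') simp
    finally show "measure \<mu> (\<phi> g -` C) \<le> measure \<mu> (closure ?N)" .
  qed
  have closed_eq: "measure \<mu> (\<phi> g -` C) = measure \<mu> C" if g: "g \<in> carrier G" and C: "closed C" for g C
  proof (rule antisym)
    show "measure \<mu> (\<phi> g -` C) \<le> measure \<mu> C" using closed_le g C .
    have "\<phi> (inv g) -` (\<phi> g -` C) = C" using g by (auto simp: vimage_def)
    then show "measure \<mu> C \<le> measure \<mu> (\<phi> g -` C)"
      using closed_le[of "inv g" "\<phi> g -` C"] g C by (simp add: closed_act_vimage)
  qed
  have "distr \<mu> borel (\<phi> g) = \<mu>" if g: "g \<in> carrier G" for g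
  proof (rule measure_eqI_generator_eq[where E = "{C. closed C}" and A = "\<lambda>_. UNIV" and \<Omega> = UNIV])
    have meas: "\<phi> g \<in> measurable \<mu> borel"
      using borel_measurable_continuous_onI[OF continuous_action[OF g]] sets
      by (simp cong: measurable_cong_sets)
    show "Int_stable {C :: 'x set. closed C}" by (auto simp: Int_stable_def)
    show "sets (distr \<mu> borel (\<phi> g)) = sigma_sets UNIV {C. closed C}"
      by (simp add: borel_eq_closed)
    show "sets \<mu> = sigma_sets UNIV {C. closed C}" by (simp add: sets borel_eq_closed)
    show "emeasure (distr \<mu> borel (\<phi> g)) C = emeasure \<mu> C" if "C \<in> {C. closed C}" for C
      using that closed_eq[OF g] meas by (simp add: emeasure_distr space emeasure_eq_measure)
    show "emeasure (distr \<mu> borel (\<phi> g)) UNIV \<noteq> \<infinity>"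
      using meas by (simp add: emeasure_distr space emeasure_eq_measure)
  qed auto
  then have "\<mu> \<in> IM" using sets prob by (simp add: invariant_measures_def)
  then show ?thesis using ge' that by blast
qed

text \<open>
  The bound holds for all sufficiently invariant \<open>S\<close> and not just for some \<open>S\<close>, since the proof by
  contradiction makes any choice of bad sets into a Foelner sequence.  Two sets are treated together
  because comparison requires a bound for a sum of measures, such as \<open>\<mu> C + \<mu> (- B)\<close>, and
  not for its terms.
\<close>

theorem uniform_density_bound:
  assumes C: "closed C" and D: "closed D"
    and less: "\<And>\<mu>. \<mu> \<in> IM \<Longrightarrow> measure \<mu> C + measure \<mu> D < a"
  obtains \<eta> r K \<delta> where "0 < \<eta>" "0 < r" "finite K" "K \<noteq> {}" "K \<subseteq> carrier G" "0 < \<delta>"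
    and "\<And>S x. invariant_finset G K \<delta> S \<Longrightarrow>
      real (card {s \<in> S. \<phi> s x \<in> nbhd r C}) + real (card {s \<in> S. \<phi> s x \<in> nbhd r D})
        \<le> (a - \<eta>) * real (card S)"
proof -
  let ?count = "\<lambda>S x A. real (card {s \<in> S. \<phi> s x \<in> A})"
  define h where "h n = 1 / real (Suc n)" for n
  define K where "K n = from_nat_into (carrier G) ` {..n}" for n
  have carrier_ne: "carrier G \<noteq> {}" using one_closed by blast
  have K: "finite (K n)" "K n \<noteq> {}" "K n \<subseteq> carrier G" for n
    using from_nat_into[OF carrier_ne] by (auto simp: K_def)
  have h_pos: "0 < h n" for n by (simp add: h_def)
  have "\<exists>n. \<forall>S x. invariant_finset G (K n) (h n) S \<longrightarrow>
      ?count S x (nbhd (h n) C) + ?count S x (nbhd (h n) D) \<le> (a - h n) * real (card S)"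
  proof (rule ccontr)
    define P where "P n S x \<longleftrightarrow> invariant_finset G (K n) (h n) S \<and>
        (a - h n) * real (card S) < ?count S x (nbhd (h n) C) + ?count S x (nbhd (h n) D)" for n S x
    assume "\<not> ?thesis"
    then have "\<forall>n. \<exists>S x. P n S x"
      unfolding P_def by (simp add: not_le)
    then obtain S x where P: "\<And>n. P n (S n) (x n)"
      by metis
    have S: "invariant_finset G (K n) (h n) (S n)"
      and bad: "(a - h n) * real (card (S n))
        < ?count (S n) (x n) (nbhd (h n) C) + ?count (S n) (x n) (nbhd (h n) D)" for n
      using P[of n] by (simp_all add: P_def)
    have fin: "finite (S n)" and card_pos: "0 < real (card (S n))" and sub: "S n \<subseteq> carrier G" for n
      using S[of n] by (auto simp: invariant_finset_def card_gt_0_iff)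
    define m where "m n A = ?count (S n) (x n) A / real (card (S n))" for n A
    have m_bounds: "m n A \<in> {0..1}" for n A
      unfolding m_def using fin card_pos[of n] by (auto simp: divide_le_eq_1 intro: card_mono)
    have m_add: "m n (A \<union> B) = m n A + m n B" if "A \<inter> B = {}" for n A B
    proof -
      have "card {s \<in> S n. \<phi> s (x n) \<in> A \<union> B}
          = card ({s \<in> S n. \<phi> s (x n) \<in> A} \<union> {s \<in> S n. \<phi> s (x n) \<in> B})"
        by (rule arg_cong[where f = card]) auto
      also have "\<dots> = card {s \<in> S n. \<phi> s (x n) \<in> A} + card {s \<in> S n. \<phi> s (x n) \<in> B}"
        by (rule card_Un_disjoint) (use fin that in auto)
      finally show ?thesis by (simp add: m_def add_divide_distrib)
    qed
    have m_total: "m n UNIV = 1" for n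
      using card_pos[of n] by (simp add: m_def)
    have m_inv: "m n (\<phi> g -` A) \<le> m n A + h n" if "g \<in> K n" for n g A
    proof -
      have "?count (S n) (x n) (\<phi> g -` A) \<le> ?count (S n) (x n) A + real (card ((\<lambda>s. g \<otimes> s) ` S n - S n))"
        using card_translate_hits_le[OF fin sub, of g n "x n" A] that K(3)[of n] by fastforce
      also have "\<dots> \<le> ?count (S n) (x n) A + h n * real (card (S n))"
        using invariant_finset_translate[OF S K(1) that K(3)] by simp
      finally show ?thesis using card_pos[of n] by (simp add: m_def divide_simps)
    qed
    obtain F l where F: "F \<noteq> bot" "F \<le> sequentially" and lim: "\<And>A. ((\<lambda>n. m n A) \<longlongrightarrow> l A) F"
      using bounded_functions_cluster[of m] m_bounds by blast
    have h_lim: "(h \<longlongrightarrow> 0) F"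
      unfolding h_def using LIMSEQ_inverse_real_of_nat F(2) by (simp add: inverse_eq_divide tendsto_mono)
    have ev: "eventually P F" if "\<And>n. n \<ge> N \<Longrightarrow> P n" for P and N :: nat
      using F(2) that unfolding le_filter_def eventually_sequentially by blast
    have l_nonneg: "0 \<le> l A" for A
      using m_bounds by (intro tendsto_lowerbound[OF lim _ F(1)]) auto
    have l_add: "l (A \<union> B) = l A + l B" if "A \<inter> B = {}" for A B
      using tendsto_unique[OF F(1) lim, of "A \<union> B"] tendsto_add[OF lim lim, of A B] m_add[OF that]
      by simp
    have l_total: "l UNIV = 1"
      using tendsto_unique[OF F(1) lim, of UNIV] m_total by simp
    \<comment> \<open>The finite sets K n exhaust the group, so g belongs to K n for all large n.\<close>
    have l_inv: "l (\<phi> g -` A) \<le> l A" if g: "g \<in> carrier G" for g A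
    proof -
      obtain N where "from_nat_into (carrier G) N = g"
        using from_nat_into_surj[OF countable_carrier g] by blast
      then have "g \<in> K n" if "n \<ge> N" for n using that by (auto simp: K_def)
      then have "eventually (\<lambda>n. m n (\<phi> g -` A) \<le> m n A + h n) F"
        by (intro ev[of N]) (rule m_inv)
      moreover have "((\<lambda>n. m n A + h n) \<longlongrightarrow> l A + 0) F" by (intro tendsto_add lim h_lim)
      ultimately show ?thesis using tendsto_le[OF F(1) _ lim] by fastforce
    qed
    \<comment> \<open>For fixed k the neighbourhoods of radius h n are contained in that of radius h k
        as soon as n exceeds k, so the bad bounds pass to the limit.\<close>
    have l_ge: "a \<le> l (closure (nbhd (h k) C)) + l (closure (nbhd (h k) D))" for k
    proof -
      have "a - h n \<le> m n (closure (nbhd (h k) C)) + m n (closure (nbhd (h k) D))" if "n \<ge> k" for n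
      proof -
        have "h n \<le> h k" using that by (simp add: h_def divide_simps)
        then have sub: "nbhd (h n) A \<subseteq> closure (nbhd (h k) A)" for A :: "'x set"
          using nbhd_mono closure_subset by blast
        have mono: "m n (nbhd (h n) A) \<le> m n (closure (nbhd (h k) A))" for A
          unfolding m_def using fin sub[of A] by (intro divide_right_mono of_nat_mono card_mono) auto
        have "a - h n \<le> m n (nbhd (h n) C) + m n (nbhd (h n) D)"
          using bad[of n] card_pos[of n] by (simp add: m_def divide_simps)
        then show ?thesis using mono[of C] mono[of D] by linarith
      qed
      then have "eventually (\<lambda>n. a - h n \<le> m n (closure (nbhd (h k) C)) + m n (closure (nbhd (h k) D))) F"
        by (rule ev)
      moreover have "((\<lambda>n. a - h n) \<longlongrightarrow> a - 0) F" by (intro tendsto_diff tendsto_const h_lim)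
      ultimately show ?thesis
        using tendsto_le[OF F(1) tendsto_add[OF lim lim]] by fastforce
    qed
    obtain \<mu> where \<mu>: "\<mu> \<in> IM" and ge: "\<And>K. closed K \<Longrightarrow> l K \<le> measure \<mu> K"
      using invariant_measure_of_mean[of l, OF l_nonneg l_add l_total l_inv] by blast
    have "a \<le> measure \<mu> (closure (nbhd (h k) C)) + measure \<mu> (closure (nbhd (h k) D))" for k
      using l_ge[of k] ge[OF closed_closure, of "nbhd (h k) C"] ge[OF closed_closure, of "nbhd (h k) D"]
      by linarith
    then have "a \<le> measure \<mu> C + measure \<mu> D"
      unfolding h_def
      using tendsto_add[OF measure_closure_nbhd_tendsto[OF invariant_measureD(1,2)[OF \<mu>] C]
        measure_closure_nbhd_tendsto[OF invariant_measureD(1,2)[OF \<mu>] D]]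
      by (intro LIMSEQ_le_const[where X = "\<lambda>k. measure \<mu> (closure (nbhd (1 / real (Suc k)) C)) + measure \<mu> (closure (nbhd (1 / real (Suc k)) D))"]) auto
    then show False using less[OF \<mu>] by simp
  qed
  then obtain n where n: "\<And>S x. invariant_finset G (K n) (h n) S \<Longrightarrow>
      ?count S x (nbhd (h n) C) + ?count S x (nbhd (h n) D) \<le> (a - h n) * real (card S)"
    by blast
  show ?thesis by (rule that[of "h n" "h n" "K n" "h n", OF h_pos h_pos K h_pos n])
qed

lemma invariant_finset_exists:
  assumes "finite K" "K \<noteq> {}" "K \<subseteq> carrier G" "0 < \<delta>"
  obtains F where "invariant_finset G K \<delta> F"
  using amenable assms unfolding amenable_group_def by blast

text \<open>
  Were there no invariant measure, the hypothesis of \<open>uniform_density_bound\<close> would hold vacuously for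
  empty sets and \<open>a = 0\<close>, and its conclusion would bound a count by a negative number.
\<close>

lemma invariant_measure_exists: "IM \<noteq> {}"
proof
  assume "IM = {}"
  then have "measure \<mu> {} + measure \<mu> {} < 0" if "\<mu> \<in> IM" for \<mu>
    using that by simp
  then obtain \<eta> r K \<delta> where *: "0 < \<eta>" "0 < r" "finite K" "K \<noteq> {}" "K \<subseteq> carrier G" "0 < \<delta>"
    and count: "\<And>S x. invariant_finset G K \<delta> S \<Longrightarrow>
      real (card {s \<in> S. \<phi> s x \<in> nbhd r {}}) + real (card {s \<in> S. \<phi> s x \<in> nbhd r {}})
        \<le> (0 - \<eta>) * real (card S)"
    by (rule uniform_density_bound[OF closed_empty closed_empty]) (assumption, rule that)
  obtain F where F: "invariant_finset G K \<delta> F" using invariant_finset_exists *(3-6) by metis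
  then have "0 < real (card F)" by (auto simp: invariant_finset_def card_gt_0_iff)
  then have "0 < \<eta> * real (card F)" using *(1) by simp
  then show False using count[OF F] by (simp add: nbhd_def)
qed

text \<open>
  Smallness of a closed set for all invariant measures extends to a whole neighbourhood, uniformly in
  the measure.  This is the form in which compactness of the space of invariant measures is used.
\<close>

lemma small_closed_set_density:
  assumes C: "closed C" and less: "\<And>\<mu>. \<mu> \<in> IM \<Longrightarrow> measure \<mu> C < a"
  obtains r F where "0 < r" "finite F" "F \<noteq> {}" "F \<subseteq> carrier G"
    and "\<And>x. real (card {f \<in> F. \<phi> f x \<in> nbhd r C}) \<le> a * real (card F)"
    and "\<And>\<mu>. \<mu> \<in> IM \<Longrightarrow> measure \<mu> (nbhd r C) < a"
proof -
  have less': "measure \<mu> C + measure \<mu> {} < a" if "\<mu> \<in> IM" for \<mu>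
    using less[OF that] by simp
  obtain \<eta> r K \<delta> where *: "0 < \<eta>" "0 < r" "finite K" "K \<noteq> {}" "K \<subseteq> carrier G" "0 < \<delta>"
    and count: "\<And>S x. invariant_finset G K \<delta> S \<Longrightarrow>
      real (card {s \<in> S. \<phi> s x \<in> nbhd r C}) + real (card {s \<in> S. \<phi> s x \<in> nbhd r {}})
        \<le> (a - \<eta>) * real (card S)"
    by (rule uniform_density_bound[OF C closed_empty less']) (assumption, rule that)
  obtain F where F: "invariant_finset G K \<delta> F" using invariant_finset_exists *(3-6) by metis
  have F': "finite F" "F \<noteq> {}" "F \<subseteq> carrier G" using F by (auto simp: invariant_finset_def)
  have c: "real (card {f \<in> F. \<phi> f x \<in> nbhd r C}) \<le> (a - \<eta>) * real (card F)" for x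
    using count[OF F, of x] by (simp add: nbhd_def)
  have "real (card {f \<in> F. \<phi> f x \<in> nbhd r C}) \<le> a * real (card F)" for x
    using c[of x] *(1) by (simp add: algebra_simps)
      (smt (verit) mult_nonneg_nonneg of_nat_0_le_iff)
  moreover have "measure \<mu> (nbhd r C) < a" if "\<mu> \<in> IM" for \<mu>
    using invariant_measures_le_of_counting[OF that F' borel_open[OF open_nbhd] sets.empty_sets, of r C "a - \<eta>"] c *(1)
    by simp
  ultimately show ?thesis using that *(2) F' by blast
qed

end

section \<open>From castles to small boundaries\<close>

text \<open>
  Pointwise description of castles: the level and the tower of a point of the footprint are determined
  by the point.
\<close>

lemma castle_iff:
  "castle G \<phi> \<C> \<longleftrightarrow> finite \<C> \<and> (\<forall>S V. (S, V) \<in> \<C> \<longrightarrow> finite S \<and> S \<subseteq> carrier G) \<and>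
     (\<forall>S V s v S' V' s' v'. (S, V) \<in> \<C> \<longrightarrow> (S', V') \<in> \<C> \<longrightarrow> s \<in> S \<longrightarrow> s' \<in> S' \<longrightarrow> v \<in> V \<longrightarrow>
        v' \<in> V' \<longrightarrow> \<phi> s v = \<phi> s' v' \<longrightarrow> S = S' \<and> V = V' \<and> s = s')"
  (is "_ \<longleftrightarrow> _ \<and> ?shapes \<and> ?disj")
proof
  assume c: "castle G \<phi> \<C>"
  have ?disj
  proof (intro allI impI)
    fix S V s v S' V' s' v'
    assume a: "(S, V) \<in> \<C>" "(S', V') \<in> \<C>" "s \<in> S" "s' \<in> S'" "v \<in> V" "v' \<in> V'" "\<phi> s v = \<phi> s' v'"
    show "S = S' \<and> V = V' \<and> s = s'"
    proof (rule ccontr)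
      assume "\<not> ?thesis"
      then have "((S, V), s) \<noteq> ((S', V'), s')" by auto
      moreover have "((S, V), s) \<in> (SIGMA T:\<C>. fst T)" "((S', V'), s') \<in> (SIGMA T:\<C>. fst T)"
        using a by auto
      ultimately have "\<phi> s ` V \<inter> \<phi> s' ` V' = {}"
        using c unfolding castle_def disjoint_family_on_def by fastforce
      then show False using a by (metis IntI empty_iff imageI)
    qed
  qed
  moreover have "finite \<C>" ?shapes using c by (auto simp: castle_def tower_def)
  ultimately show "finite \<C> \<and> ?shapes \<and> ?disj" by simp
next
  assume *: "finite \<C> \<and> ?shapes \<and> ?disj"
  then have D: "S = S' \<and> V = V' \<and> s = s'" if "(S, V) \<in> \<C>" "(S', V') \<in> \<C>" "s \<in> S" "s' \<in> S'"
      "x \<in> \<phi> s ` V" "x \<in> \<phi> s' ` V'" for S V s S' V' s' x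
    using that by (elim conjE imageE) metis
  have "disjoint_family_on (\<lambda>s. \<phi> s ` V) S" if "(S, V) \<in> \<C>" for S V
    unfolding disjoint_family_on_def using D[OF that that] by blast
  moreover have "disjoint_family_on (\<lambda>((S, V), s). \<phi> s ` V) (SIGMA T:\<C>. fst T)"
    unfolding disjoint_family_on_def
  proof (intro ballI impI)
    fix p q assume pq: "p \<in> (SIGMA T:\<C>. fst T)" "q \<in> (SIGMA T:\<C>. fst T)" "p \<noteq> q"
    obtain S V s where p: "p = ((S, V), s)" by (metis prod.exhaust)
    obtain S' V' s' where q: "q = ((S', V'), s')" by (metis prod.exhaust)
    have "\<phi> s ` V \<inter> \<phi> s' ` V' = {}"
      using pq D[of S V S' V' s s'] unfolding p q by auto
    then show "(case p of (T, s) \<Rightarrow> (case T of (S, V) \<Rightarrow> \<lambda>s. \<phi> s ` V) s) \<inter>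
        (case q of (T, s) \<Rightarrow> (case T of (S, V) \<Rightarrow> \<lambda>s. \<phi> s ` V) s) = {}"
      by (simp add: p q)
  qed
  ultimately show "castle G \<phi> \<C>" using * by (auto simp: castle_def tower_def)
qed

lemma castleD:
  assumes "castle G \<phi> \<C>"
  shows "finite \<C>" and "\<And>S V. (S, V) \<in> \<C> \<Longrightarrow> finite S" and "\<And>S V. (S, V) \<in> \<C> \<Longrightarrow> S \<subseteq> carrier G"
  using assms by (auto simp: castle_iff)

lemma castle_unique_level:
  assumes "castle G \<phi> \<C>" and "(S, V) \<in> \<C>" "(S', V') \<in> \<C>" "s \<in> S" "s' \<in> S'" "v \<in> V" "v' \<in> V'"
    and "\<phi> s v = \<phi> s' v'"
  shows "S = S'" and "V = V'" and "s = s'"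
proof -
  have "S = S' \<and> V = V' \<and> s = s'"
    using assms unfolding castle_iff by (elim conjE) metis
  then show "S = S'" "V = V'" "s = s'" by simp_all
qed

lemma in_footprint_iff: "x \<in> footprint \<phi> \<C> \<longleftrightarrow> (\<exists>S V s v. (S, V) \<in> \<C> \<and> s \<in> S \<and> v \<in> V \<and> x = \<phi> s v)"
  unfolding footprint_def by auto

lemma in_levels_iff:
  "x \<in> (\<Union>(S, V)\<in>\<C>. \<Union>s\<in>{s \<in> S. P s V}. \<phi> s ` V) \<longleftrightarrow>
     (\<exists>S V s. (S, V) \<in> \<C> \<and> s \<in> S \<and> P s V \<and> x \<in> \<phi> s ` V)"
  by (simp add: Bex_def split_paired_Ex)

context compact_amenable_action
begin

lemma open_footprint: "open_castle G \<phi> \<C> \<Longrightarrow> open (footprint \<phi> \<C>)"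
  unfolding open_castle_def footprint_def
  by (auto intro!: open_UN open_act_image dest: castleD(3))

text \<open>
  A union of levels and the union of the remaining levels are disjoint open sets that exhaust the
  footprint, so no boundary point of the first lies in either.
\<close>

lemma frontier_Union_levels:
  assumes \<C>: "open_castle G \<phi> \<C>"
  shows "frontier (\<Union>(S, V)\<in>\<C>. \<Union>s\<in>{s \<in> S. P s V}. \<phi> s ` V) \<subseteq> - footprint \<phi> \<C>"
proof -
  let ?L = "\<lambda>P. \<Union>(S, V)\<in>\<C>. \<Union>s\<in>{s \<in> S. P s V}. \<phi> s ` V"
  have c: "castle G \<phi> \<C>" and "\<And>S V. (S, V) \<in> \<C> \<Longrightarrow> open V"
    using \<C> by (auto simp: open_castle_def)
  then have op: "open (?L P)" for P
    by (auto intro!: open_UN open_act_image dest: castleD(3))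
  have "?L P \<inter> ?L (\<lambda>s V. \<not> P s V) = {}"
    using castle_unique_level[OF c] by (auto; metis)
  then have "closure (?L P) \<inter> ?L (\<lambda>s V. \<not> P s V) = {}"
    using open_Int_closure_eq_empty[OF op[of "\<lambda>s V. \<not> P s V"], of "?L P"] by (simp only: Int_commute)
  moreover have fr: "frontier A \<subseteq> - (A \<union> B)" if "open A" "closure A \<inter> B = {}" for A B :: "'x set"
    using that by (auto simp: frontier_def interior_open)
  ultimately have "frontier (?L P) \<subseteq> - (?L P \<union> ?L (\<lambda>s V. \<not> P s V))"
    by (intro fr op)
  also have "?L P \<union> ?L (\<lambda>s V. \<not> P s V) = footprint \<phi> \<C>"
  proof (rule Set.set_eqI)
    show "x \<in> ?L P \<union> ?L (\<lambda>s V. \<not> P s V) \<longleftrightarrow> x \<in> footprint \<phi> \<C>" for x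
      unfolding Un_iff in_levels_iff in_footprint_iff image_iff by blast
  qed
  finally show ?thesis .
qed

text \<open>
  The density condition of the definitions, expressed through measures.
\<close>

definition fills_up_to :: "real \<Rightarrow> ('g set \<times> 'x set) set \<Rightarrow> bool" where
  "fills_up_to \<epsilon> \<C> \<longleftrightarrow> (\<forall>\<mu>\<in>IM. measure \<mu> (- footprint \<phi> \<C>) < \<epsilon>)"

text \<open>
  The diameter bound, in the pointwise form that passes to subsets of the bases without a
  boundedness argument.
\<close>

definition levels_finer :: "real \<Rightarrow> ('g set \<times> 'x set) set \<Rightarrow> bool" where
  "levels_finer \<delta> \<C> \<longleftrightarrow> (\<forall>(S, V)\<in>\<C>. \<forall>s\<in>S. \<forall>u\<in>V. \<forall>v\<in>V. dist (\<phi> s u) (\<phi> s v) \<le> \<delta>)"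

lemma levels_finer_iff_diameter:
  assumes "0 \<le> \<delta>"
  shows "levels_finer \<delta> \<C> \<longleftrightarrow> (\<forall>(S, V)\<in>\<C>. \<forall>s\<in>S. diameter (\<phi> s ` V) \<le> \<delta>)"
proof -
  have "diameter A \<le> \<delta> \<longleftrightarrow> (\<forall>u\<in>A. \<forall>v\<in>A. dist u v \<le> \<delta>)" for A :: "'x set"
  proof
    have "bounded A" using compact_space bounded_subset compact_imp_bounded by blast
    then show "diameter A \<le> \<delta> \<Longrightarrow> \<forall>u\<in>A. \<forall>v\<in>A. dist u v \<le> \<delta>"
      using diameter_bounded_bound by fastforce
    show "\<forall>u\<in>A. \<forall>v\<in>A. dist u v \<le> \<delta> \<Longrightarrow> diameter A \<le> \<delta>"
      using assms by (auto simp: diameter_def intro!: cSUP_least)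
  qed
  then show ?thesis by (simp add: levels_finer_def)
qed

lemma levels_finerD:
  "levels_finer \<delta> \<C> \<Longrightarrow> (S, V) \<in> \<C> \<Longrightarrow> s \<in> S \<Longrightarrow> u \<in> V \<Longrightarrow> v \<in> V \<Longrightarrow> dist (\<phi> s u) (\<phi> s v) \<le> \<delta>"
  by (auto simp: levels_finer_def)

text \<open>
  Take the levels that meet \<open>C\<close>, and cover the part of \<open>C\<close> outside the footprint by a small
  neighbourhood.  Both contributions to the boundary lie in a neighbourhood of the complement of the
  footprint, whose measure is small.
\<close>

lemma separation_small_boundary:
  assumes castles: "\<And>\<delta> \<epsilon>. 0 < \<delta> \<Longrightarrow> 0 < \<epsilon> \<Longrightarrow> \<exists>\<C>. open_castle G \<phi> \<C> \<and> levels_finer \<delta> \<C> \<and> fills_up_to \<epsilon> \<C>"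
    and C: "closed C" and U: "open U" "C \<subseteq> U" and \<epsilon>: "0 < \<epsilon>"
  obtains V where "open V" "C \<subseteq> V" "closure V \<subseteq> U" "\<And>\<mu>. \<mu> \<in> IM \<Longrightarrow> measure \<mu> (frontier V) < \<epsilon>"
proof -
  obtain r where r: "0 < r" "nbhd r C \<subseteq> U"
    using nbhd_separated[OF compact_of_closed[OF C] U] by blast
  obtain \<C> where \<C>: "open_castle G \<phi> \<C>" and fine: "levels_finer (r / 4) \<C>" and fill: "fills_up_to \<epsilon> \<C>"
    using castles[of "r / 4" \<epsilon>] r \<epsilon> by auto
  define R where "R = - footprint \<phi> \<C>"
  have "closed R" using open_footprint[OF \<C>] by (simp add: R_def closed_def)
  obtain \<rho> where \<rho>: "0 < \<rho>" "\<And>\<mu>. \<mu> \<in> IM \<Longrightarrow> measure \<mu> (nbhd \<rho> R) < \<epsilon>"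
    using small_closed_set_density[OF \<open>closed R\<close>] fill unfolding fills_up_to_def R_def by metis
  \<comment> \<open>With this radius the closure of N stays in U and in the neighbourhood of R of small measure.\<close>
  define t where "t = min (\<rho> / 2) (r / 4)"
  have t: "0 < t" "2 * t \<le> \<rho>" "2 * t \<le> r" using r \<rho> by (auto simp: t_def)
  define N where "N = nbhd t (R \<inter> C)"
  have clN: "closure N \<subseteq> nbhd (2 * t) (R \<inter> C)"
    unfolding N_def using t by (intro closure_nbhd_subset)
  have clN_R: "closure N \<subseteq> nbhd \<rho> R" and clN_U: "closure N \<subseteq> U"
    using clN t r(2) nbhd_mono[of "2 * t" \<rho> R] nbhd_mono[of "2 * t" r C] by (fastforce simp: nbhd_def)+
  define W where "W = (\<Union>(S, V)\<in>\<C>. \<Union>s\<in>{s \<in> S. \<phi> s ` V \<inter> C \<noteq> {}}. \<phi> s ` V)"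
  have "open W"
    unfolding W_def using \<C> by (auto simp: open_castle_def intro!: open_UN open_act_image dest: castleD(3))
  have "W \<subseteq> nbhd (r / 2) C"
  proof
    fix y assume "y \<in> W"
    then obtain S V s where l: "(S, V) \<in> \<C>" "s \<in> S" "\<phi> s ` V \<inter> C \<noteq> {}" "y \<in> \<phi> s ` V"
      unfolding W_def in_levels_iff by blast
    then obtain u v where *: "u \<in> V" "\<phi> s u \<in> C" "v \<in> V" "y = \<phi> s v" by blast
    then have "dist (\<phi> s u) y \<le> r / 4" using fine l unfolding levels_finer_def by fast
    then show "y \<in> nbhd (r / 2) C" using * r by (force simp: nbhd_def)
  qed
  then have "closure W \<subseteq> closure (nbhd (r / 2) C)" by (rule closure_mono)
  then have clW: "closure W \<subseteq> U"
    using closure_nbhd_subset[of "r / 2" C] r by simp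
  have frW: "frontier W \<subseteq> R"
    unfolding W_def R_def by (rule frontier_Union_levels[OF \<C>])
  show ?thesis
  proof (rule that[of "W \<union> N"])
    show "open (W \<union> N)" unfolding N_def using \<open>open W\<close> by (intro open_Un open_nbhd)
    show "C \<subseteq> W \<union> N"
    proof
      fix x assume "x \<in> C"
      show "x \<in> W \<union> N"
      proof (cases "x \<in> R")
        case True
        then show ?thesis using \<open>x \<in> C\<close> subset_nbhd[OF t(1), of "R \<inter> C"] by (auto simp: N_def)
      next
        case False
        then obtain S V s v where "(S, V) \<in> \<C>" "s \<in> S" "v \<in> V" "x = \<phi> s v"
          by (auto simp: R_def in_footprint_iff)
        then have "x \<in> W" unfolding W_def in_levels_iff using \<open>x \<in> C\<close> by blast
        then show ?thesis by simp
      qed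
    qed
    show "closure (W \<union> N) \<subseteq> U" using clW clN_U by (simp add: closure_Un)
    fix \<mu> assume \<mu>: "\<mu> \<in> IM"
    interpret prob_space \<mu> using \<mu> by (rule invariant_measureD)
    have "frontier (W \<union> N) \<subseteq> nbhd \<rho> R"
      using frontier_Un_subset[of W N] frW clN_R subset_nbhd[OF \<rho>(1), of R] by (auto simp: frontier_def)
    then have "measure \<mu> (frontier (W \<union> N)) \<le> measure \<mu> (nbhd \<rho> R)"
      using invariant_measureD(2)[OF \<mu>] borel_open[OF open_nbhd] by (intro finite_measure_mono) auto
    then show "measure \<mu> (frontier (W \<union> N)) < \<epsilon>" using \<rho>(2)[OF \<mu>] by simp
  qed
qed

text \<open>
  One step of the iteration.  Cutting a neighbourhood \<open>N\<close> of the small boundary of \<open>V\<close> out of \<open>V\<close>,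
  respectively adding it to \<open>V\<close>, gives a closed set and an open set that differ only within \<open>N\<close>.
\<close>

lemma shrink_gap:
  assumes castles: "\<And>\<delta> \<epsilon>. 0 < \<delta> \<Longrightarrow> 0 < \<epsilon> \<Longrightarrow> \<exists>\<C>. open_castle G \<phi> \<C> \<and> levels_finer \<delta> \<C> \<and> fills_up_to \<epsilon> \<C>"
    and C: "closed C" and U: "open U" "C \<subseteq> U" and \<epsilon>: "0 < \<epsilon>"
  obtains C' U' where "closed C'" "open U'" "C \<subseteq> interior C'" "C' \<subseteq> U'" "closure U' \<subseteq> U"
    "\<And>\<mu>. \<mu> \<in> IM \<Longrightarrow> measure \<mu> (U' - C') < \<epsilon>"
proof -
  obtain V where V: "open V" "C \<subseteq> V" "closure V \<subseteq> U" and small: "\<And>\<mu>. \<mu> \<in> IM \<Longrightarrow> measure \<mu> (frontier V) < \<epsilon>"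
    using separation_small_boundary[OF castles C U \<epsilon>] by blast
  obtain \<rho> where \<rho>: "0 < \<rho>" "\<And>\<mu>. \<mu> \<in> IM \<Longrightarrow> measure \<mu> (nbhd \<rho> (frontier V)) < \<epsilon>"
    using small_closed_set_density[OF frontier_closed small] by metis
  have "frontier V \<subseteq> U \<inter> - C" using V by (auto simp: frontier_def interior_open)
  then obtain r where r: "0 < r" "nbhd r (frontier V) \<subseteq> U \<inter> - C"
    using nbhd_separated[OF compact_of_closed[OF frontier_closed]] U(1) C by (metis open_Compl open_Int)
  define N where "N = nbhd (min \<rho> (r / 2)) (frontier V)"
  have "open N" unfolding N_def by (rule open_nbhd)
  have fr: "frontier V \<subseteq> N" unfolding N_def using r \<rho> by (intro subset_nbhd) auto
  have "closure N \<subseteq> closure (nbhd (r / 2) (frontier V))"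
    unfolding N_def by (intro closure_mono nbhd_mono) simp
  also have "\<dots> \<subseteq> nbhd r (frontier V)" using closure_nbhd_subset[of "r / 2"] r by simp
  finally have clN: "closure N \<subseteq> U \<inter> - C" using r by blast
  show ?thesis
  proof (rule that[of "V - N" "V \<union> N"])
    have "V - N = closure V - N" using fr V(1) by (auto simp: frontier_def interior_open closure_subset[THEN subsetD])
    then show "closed (V - N)" using \<open>open N\<close> by (simp add: closed_Diff)
    show "open (V \<union> N)" using V(1) \<open>open N\<close> by (rule open_Un)
    have "V - closure N \<subseteq> interior (V - N)"
      using V(1) closure_subset[of N] by (intro interior_maximal) (auto intro: open_Diff)
    then show "C \<subseteq> interior (V - N)" using V(2) clN by blast
    show "V - N \<subseteq> V \<union> N" by blast
    show "closure (V \<union> N) \<subseteq> U" using V(3) clN by (simp add: closure_Un)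
    fix \<mu> assume \<mu>: "\<mu> \<in> IM"
    interpret prob_space \<mu> using \<mu> by (rule invariant_measureD)
    have "measure \<mu> (V \<union> N - (V - N)) \<le> measure \<mu> (nbhd \<rho> (frontier V))"
      using invariant_measureD(2)[OF \<mu>] borel_open[OF open_nbhd] nbhd_mono[of "min \<rho> (r / 2)" \<rho> "frontier V"]
      by (intro finite_measure_mono) (auto simp: N_def)
    then show "measure \<mu> (V \<union> N - (V - N)) < \<epsilon>" using \<rho>(2)[OF \<mu>] by simp
  qed
qed

text \<open>
  Iterating \<open>shrink_gap\<close> gives increasing closed sets \<open>c n\<close> and decreasing open sets \<open>u n\<close>.  The union
  of the \<open>c n\<close> is open, and its boundary lies in all the gaps \<open>u n - c n\<close>, whose measures tend to
  zero.
\<close>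

lemma separation_null_boundary:
  assumes castles: "\<And>\<delta> \<epsilon>. 0 < \<delta> \<Longrightarrow> 0 < \<epsilon> \<Longrightarrow> \<exists>\<C>. open_castle G \<phi> \<C> \<and> levels_finer \<delta> \<C> \<and> fills_up_to \<epsilon> \<C>"
    and C: "closed C" and U: "open U" "C \<subseteq> U"
  obtains V where "open V" "C \<subseteq> V" "V \<subseteq> U" "\<And>\<mu>. \<mu> \<in> IM \<Longrightarrow> measure \<mu> (frontier V) = 0"
proof -
  define P where "P p \<longleftrightarrow> closed (fst p) \<and> open (snd p) \<and> fst p \<subseteq> snd p" for p :: "'x set \<times> 'x set"
  define Q where "Q n p q \<longleftrightarrow> fst p \<subseteq> interior (fst q) \<and> closure (snd q) \<subseteq> snd p \<and>
    (\<forall>\<mu>\<in>IM. measure \<mu> (snd q - fst q) < 1 / real (Suc n))" for n and p q :: "'x set \<times> 'x set"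
  have "\<exists>q. P q \<and> Q n p q" if "P p" for n p
  proof -
    have p: "closed (fst p)" "open (snd p)" "fst p \<subseteq> snd p" using that by (auto simp: P_def)
    obtain C' U' where "closed C'" "open U'" "fst p \<subseteq> interior C'" "C' \<subseteq> U'" "closure U' \<subseteq> snd p"
      "\<And>\<mu>. \<mu> \<in> IM \<Longrightarrow> measure \<mu> (U' - C') < 1 / real (Suc n)"
      using shrink_gap[OF castles p, of "1 / real (Suc n)"] by auto
    then have "P (C', U') \<and> Q n p (C', U')" by (simp add: P_def Q_def)
    then show ?thesis by blast
  qed
  moreover have "P (C, U)" using C U by (simp add: P_def)
  ultimately obtain p where p: "\<And>n. (P (p n) \<and> (n = 0 \<longrightarrow> p n = (C, U))) \<and> Q n (p n) (p (Suc n))"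
    using dependent_nat_choice[of "\<lambda>n q. P q \<and> (n = 0 \<longrightarrow> q = (C, U))" Q] by blast
  have p0: "p 0 = (C, U)" and P: "P (p n)" and Q: "Q n (p n) (p (Suc n))" for n
    using p[of 0] p[of n] by auto
  define c u where "c = (\<lambda>n. fst (p n))" and "u = (\<lambda>n. snd (p n))"
  have cu: "c n \<subseteq> u n" "c n \<subseteq> interior (c (Suc n))" "closure (u (Suc n)) \<subseteq> u n" for n
    using P[of n] Q[of n] by (auto simp: P_def Q_def c_def u_def)
  have small: "measure \<mu> (u (Suc n) - c (Suc n)) < 1 / real (Suc n)" if "\<mu> \<in> IM" for \<mu> n
    using Q[of n] that by (simp add: Q_def c_def u_def)
  have "c n \<subseteq> c (Suc n)" for n using cu(2) interior_subset by blast
  then have "incseq c" by (rule incseq_SucI)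
  have "u (Suc n) \<subseteq> u n" for n using cu(3) closure_subset by blast
  then have "decseq u" by (rule decseq_SucI)
  have c_sub_u: "c m \<subseteq> u n" for m n
    using cu(1)[of "max m n"] incseqD[OF \<open>incseq c\<close>, of m "max m n"] decseqD[OF \<open>decseq u\<close>, of n "max m n"] by auto
  define V where "V = (\<Union>n. c n)"
  have V_u: "V \<subseteq> u n" for n using c_sub_u by (auto simp: V_def)
  have "V = (\<Union>n. interior (c (Suc n)))"
    unfolding V_def using cu(2) interior_subset by blast
  then have "open V" by auto
  have "frontier V \<subseteq> u (Suc n) - c (Suc n)" for n
  proof -
    have "closure V \<subseteq> u (Suc n)" using closure_mono[OF V_u[of "Suc (Suc n)"]] cu(3)[of "Suc n"] by blast
    moreover have "c (Suc n) \<subseteq> V" by (auto simp: V_def)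
    ultimately show ?thesis using \<open>open V\<close> by (auto simp: frontier_def interior_open)
  qed
  note frV = this
  show ?thesis
  proof (rule that[of V])
    show "open V" by fact
    have "c 0 \<subseteq> V" by (auto simp: V_def)
    then show "C \<subseteq> V" using p0 by (simp add: c_def)
    show "V \<subseteq> U" using V_u[of 0] p0 by (simp add: u_def)
    fix \<mu> assume \<mu>: "\<mu> \<in> IM"
    interpret prob_space \<mu> using \<mu> by (rule invariant_measureD)
    have "measure \<mu> (frontier V) \<le> 1 / real (Suc n)" for n
    proof -
      have "closed (c (Suc n))" "open (u (Suc n))" using P[of "Suc n"] by (auto simp: P_def c_def u_def)
      then have "measure \<mu> (frontier V) \<le> measure \<mu> (u (Suc n) - c (Suc n))"
        using invariant_measureD(2)[OF \<mu>] frV[of n] by (intro finite_measure_mono) auto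
      then show ?thesis using small[OF \<mu>, of n] by simp
    qed
    then have "measure \<mu> (frontier V) \<le> 0"
      using LIMSEQ_le_const[OF LIMSEQ_inverse_real_of_nat, of "measure \<mu> (frontier V)"]
      by (auto simp: inverse_eq_divide)
    then show "measure \<mu> (frontier V) = 0" by (simp add: measure_le_0_iff)
  qed
qed

theorem small_boundary_of_castles:
  assumes castles: "\<And>\<delta> \<epsilon>. 0 < \<delta> \<Longrightarrow> 0 < \<epsilon> \<Longrightarrow> \<exists>\<C>. open_castle G \<phi> \<C> \<and> levels_finer \<delta> \<C> \<and> fills_up_to \<epsilon> \<C>"
  shows "small_boundary_property G \<phi>"
proof -
  have "topological_basis {V. open V \<and> (\<forall>\<mu>\<in>IM. measure \<mu> (frontier V) = 0)}"
  proof (rule topological_basisI)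
    fix U :: "'x set" and x assume "open U" "x \<in> U"
    then obtain V where "open V" "{x} \<subseteq> V" "V \<subseteq> U" "\<And>\<mu>. \<mu> \<in> IM \<Longrightarrow> measure \<mu> (frontier V) = 0"
      using separation_null_boundary[OF castles, of "{x}" U] by auto
    then show "\<exists>V\<in>{V. open V \<and> (\<forall>\<mu>\<in>IM. measure \<mu> (frontier V) = 0)}. x \<in> V \<and> V \<subseteq> U" by auto
  qed simp
  then show ?thesis unfolding small_boundary_property_def by blast
qed

lemma lower_density_on_bounds:
  assumes "finite F" "F \<noteq> {}"
  shows "bdd_below (range (\<lambda>x. real (card {t \<in> F. \<phi> t x \<in> A}) / real (card F)))"
    and "lower_density_on \<phi> F A \<le> 1"
proof -
  show bdd: "bdd_below (range (\<lambda>x. real (card {t \<in> F. \<phi> t x \<in> A}) / real (card F)))"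
    by (rule bdd_belowI[of _ 0]) auto
  have "lower_density_on \<phi> F A \<le> real (card {t \<in> F. \<phi> t undefined \<in> A}) / real (card F)"
    unfolding lower_density_on_def by (rule cINF_lower[OF bdd]) simp
  also have "\<dots> \<le> 1" using assms by (auto simp: divide_le_eq_1 card_gt_0_iff intro: card_mono)
  finally show "lower_density_on \<phi> F A \<le> 1" .
qed

lemma invariant_measure_ge_lower_banach_density:
  assumes \<mu>: "\<mu> \<in> IM" and A: "A \<in> sets borel"
  shows "lower_banach_density G \<phi> A \<le> measure \<mu> A"
  unfolding lower_banach_density_def
proof (rule cSUP_least)
  have "{\<one>} \<in> {F. finite F \<and> F \<noteq> {} \<and> F \<subseteq> carrier G}" by simp
  then show "{F. finite F \<and> F \<noteq> {} \<and> F \<subseteq> carrier G} \<noteq> {}" by (metis empty_iff)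
  fix F assume "F \<in> {F. finite F \<and> F \<noteq> {} \<and> F \<subseteq> carrier G}"
  then have F: "finite F" "F \<noteq> {}" "F \<subseteq> carrier G" by auto
  have "lower_density_on \<phi> F A \<le> real (card {t \<in> F. \<phi> t x \<in> A}) / real (card F)" for x
    unfolding lower_density_on_def by (rule cINF_lower[OF lower_density_on_bounds(1)[OF F(1,2)]]) simp
  then have "lower_density_on \<phi> F A * real (card F) \<le> real (card {t \<in> F. \<phi> t x \<in> A})" for x
    using F by (simp add: le_divide_eq card_gt_0_iff)
  then have "lower_density_on \<phi> F A * measure \<mu> UNIV \<le> measure \<mu> A"
    by (intro invariant_measure_ge_of_counting[OF \<mu> F A]) auto
  then show "lower_density_on \<phi> F A \<le> measure \<mu> A"
    using prob_space.prob_space[OF invariant_measureD(1)[OF \<mu>]] invariant_measureD(3)[OF \<mu>] by simp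
qed

lemma lower_banach_density_ge:
  assumes A: "open A" and less: "\<And>\<mu>. \<mu> \<in> IM \<Longrightarrow> measure \<mu> (- A) < \<epsilon>"
  shows "1 - \<epsilon> \<le> lower_banach_density G \<phi> A"
proof -
  obtain r F where r: "0 < r" and F: "finite F" "F \<noteq> {}" "F \<subseteq> carrier G"
    and count: "\<And>x. real (card {f \<in> F. \<phi> f x \<in> nbhd r (- A)}) \<le> \<epsilon> * real (card F)"
    by (rule small_closed_set_density[OF closed_Compl[OF A] less]) (assumption, rule that)
  have "1 - \<epsilon> \<le> lower_density_on \<phi> F A"
    unfolding lower_density_on_def
  proof (rule cINF_greatest)
    fix x
    have "card F \<le> card ({t \<in> F. \<phi> t x \<in> A} \<union> {f \<in> F. \<phi> f x \<in> nbhd r (- A)})"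
      using subset_nbhd[OF r, of "- A"] F by (intro card_mono) auto
    also have "\<dots> \<le> card {t \<in> F. \<phi> t x \<in> A} + card {f \<in> F. \<phi> f x \<in> nbhd r (- A)}"
      by (rule card_Un_le)
    finally have "(1 - \<epsilon>) * real (card F) \<le> real (card {t \<in> F. \<phi> t x \<in> A})"
      using count[of x] by (simp add: algebra_simps)
    then show "1 - \<epsilon> \<le> real (card {t \<in> F. \<phi> t x \<in> A}) / real (card F)"
      using F by (simp add: le_divide_eq card_gt_0_iff)
  qed simp
  also have "\<dots> \<le> lower_banach_density G \<phi> A"
    unfolding lower_banach_density_def
    using F lower_density_on_bounds(2) by (intro cSUP_upper bdd_aboveI2[where M = 1]) auto
  finally show ?thesis .
qed

theorem almost_finite_in_measure_imp_small_boundary: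
  assumes "almost_finite_in_measure G \<phi>"
  shows "small_boundary_property G \<phi>"
proof (rule small_boundary_of_castles)
  fix \<delta> \<epsilon> :: real assume "0 < \<delta>" "0 < \<epsilon>"
  then obtain \<C> where \<C>: "open_castle G \<phi> \<C>" and "\<forall>(S, V)\<in>\<C>. \<forall>s\<in>S. diameter (\<phi> s ` V) \<le> \<delta>"
    and dens: "lower_banach_density G \<phi> (footprint \<phi> \<C>) \<ge> 1 - \<epsilon> / 2"
    using assms[unfolded almost_finite_in_measure_def, rule_format, of "{\<one>}" \<delta> "\<epsilon> / 2"] by auto
  moreover have "fills_up_to \<epsilon> \<C>"
    unfolding fills_up_to_def
  proof
    fix \<mu> assume \<mu>: "\<mu> \<in> IM"
    interpret prob_space \<mu> using \<mu> by (rule invariant_measureD)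
    have "1 - \<epsilon> / 2 \<le> measure \<mu> (footprint \<phi> \<C>)"
      using dens invariant_measure_ge_lower_banach_density[OF \<mu> borel_open[OF open_footprint[OF \<C>]]] by simp
    then show "measure \<mu> (- footprint \<phi> \<C>) < \<epsilon>"
      using prob_compl[of "footprint \<phi> \<C>"] invariant_measureD[OF \<mu>] open_footprint[OF \<C>] \<open>0 < \<epsilon>\<close>
      by (simp add: Compl_eq_Diff_UNIV)
  qed
  ultimately show "\<exists>\<C>. open_castle G \<phi> \<C> \<and> levels_finer \<delta> \<C> \<and> fills_up_to \<epsilon> \<C>"
    using levels_finer_iff_diameter[of \<delta> \<C>] \<open>0 < \<delta>\<close> by auto
qed

end

section \<open>Almost invariant sets and their large subsets\<close>

lemma castle_subset:
  assumes "castle G \<phi> \<C>" "\<D> \<subseteq> \<C>"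
  shows "castle G \<phi> \<D>"
  unfolding castle_iff
proof (intro conjI allI impI)
  show "finite \<D>" using castleD(1)[OF assms(1)] assms(2) by (rule rev_finite_subset)
  show "finite S" "S \<subseteq> carrier G" if "(S, V) \<in> \<D>" for S V
    using castleD(2,3)[OF assms(1), of S V] that assms(2) by auto
  fix S V s v S' V' s' v'
  assume *: "(S, V) \<in> \<D>" "(S', V') \<in> \<D>" "s \<in> S" "s' \<in> S'" "v \<in> V" "v' \<in> V'" "\<phi> s v = \<phi> s' v'"
  then have "(S, V) \<in> \<C>" "(S', V') \<in> \<C>" using assms(2) by auto
  then show "S = S'" "V = V'" "s = s'"
    using castle_unique_level[OF assms(1) _ _ *(3-7)] by simp_all
qed

lemma card_Diff_swap:
  assumes "finite A" "finite B" "card A = card B"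
  shows "card (A - B) = card (B - A)"
proof -
  have "card (A - B) = card A - card (A \<inter> B)" "card (B - A) = card B - card (B \<inter> A)"
    using assms by (simp_all add: card_Diff_subset_Int)
  then show ?thesis using assms(3) by (simp add: Int_commute)
qed

context compact_amenable_action
begin

text \<open>
  Unlike \<^const>\<open>invariant_finset\<close>, this condition passes to subsets of \<open>K\<close>: it bounds \<open>k F - F\<close> for each \<open>k\<close>
  separately and does not involve \<open>F - K F\<close>.  So one set \<open>F\<close> can serve several finite sets \<open>K\<close>.
\<close>

definition almost_invariant :: "'g set \<Rightarrow> real \<Rightarrow> 'g set \<Rightarrow> bool" where
  "almost_invariant K d F \<longleftrightarrow> finite F \<and> F \<noteq> {} \<and> F \<subseteq> carrier G \<and>
     (\<forall>k\<in>K. real (card ((\<lambda>f. k \<otimes> f) ` F - F)) \<le> d * real (card F))"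

lemma almost_invariant_exists:
  assumes K: "finite K" "K \<subseteq> carrier G" and d: "0 < d"
  obtains F where "almost_invariant K d F"
proof -
  obtain F where F: "invariant_finset G (insert \<one> K) d F"
    by (rule invariant_finset_exists[of "insert \<one> K" d]) (use K d in auto)
  have "almost_invariant K d F"
    unfolding almost_invariant_def
    using F invariant_finset_translate[OF F] K by (auto simp: invariant_finset_def)
  then show ?thesis by (rule that)
qed

text \<open>
  The shapes of the quasi-tiling are subsets of Foelner sets that miss a fraction \<open>e\<close>.  They
  stay invariant because \<open>k S - S\<close> is contained in \<open>(k F - F) \<union> (F - S)\<close>; the factor \<open>2\<close> compares
  \<open>card F\<close> with \<open>card S\<close>.  The part \<open>S - K S\<close> of the symmetric difference is controlled by a
  single \<open>k\<close>, since \<open>S - k S\<close> and \<open>k S - S\<close> are equally large.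
\<close>

lemma invariant_finset_of_almost_invariant:
  assumes F: "almost_invariant K d F" and K: "finite K" "K \<noteq> {}" "K \<subseteq> carrier G"
    and S: "S \<subseteq> F" "real (card (F - S)) \<le> e * real (card F)" "e \<le> 1 / 2"
    and \<delta>: "2 * real (card K + 1) * (d + e) < \<delta>"
  shows "invariant_finset G K \<delta> S"
proof -
  let ?t = "\<lambda>k A. (\<lambda>f. k \<otimes> f) ` A"
  have fin: "finite F" "F \<noteq> {}" "F \<subseteq> carrier G" and trans: "\<And>k. k \<in> K \<Longrightarrow> real (card (?t k F - F)) \<le> d * real (card F)"
    using F by (auto simp: almost_invariant_def)
  have finS: "finite S" using S(1) fin(1) by (rule finite_subset)
  have cF: "0 < real (card F)" using fin by (simp add: card_gt_0_iff)
  have "card F = card S + card (F - S)"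
    using card_mono[OF fin(1) S(1)] by (simp add: card_Diff_subset[OF finS S(1)])
  moreover have "e * real (card F) \<le> 1 / 2 * real (card F)"
    using S(3) cF by (intro mult_right_mono) auto
  ultimately have half: "real (card F) \<le> 2 * real (card S)" using S(2) by simp
  then have cS: "0 < real (card S)" using cF by simp
  have one: "real (card (?t k S - S)) \<le> (d + e) * real (card F)" if "k \<in> K" for k
  proof -
    have "?t k S - S \<subseteq> (?t k F - F) \<union> (F - S)" using S(1) by auto
    then have "card (?t k S - S) \<le> card ((?t k F - F) \<union> (F - S))"
      using fin by (intro card_mono) auto
    also have "\<dots> \<le> card (?t k F - F) + card (F - S)" by (rule card_Un_le)
    finally show ?thesis using trans[OF that] S(2) by (simp add: distrib_right)
  qed
  obtain k0 where k0: "k0 \<in> K" using K by blast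
  have "inj_on (\<lambda>f. k0 \<otimes> f) S"
    using inj_on_cmult[of k0] k0 K(3) S(1) fin(3) by (meson inj_on_subset subset_iff)
  then have "card (S - ?t k0 S) = card (?t k0 S - S)"
    using finS by (intro card_Diff_swap) (auto simp: card_image)
  then have deficit: "real (card (S - ?t k0 S)) \<le> (d + e) * real (card F)" using one[OF k0] by simp
  have "sym_diff (K <#> S) S \<subseteq> (\<Union>k\<in>K. ?t k S - S) \<union> (S - ?t k0 S)"
    using k0 by (auto simp: set_mult_def)
  then have "card (sym_diff (K <#> S) S) \<le> card ((\<Union>k\<in>K. ?t k S - S) \<union> (S - ?t k0 S))"
    using K finS by (intro card_mono) auto
  also have "\<dots> \<le> card (\<Union>k\<in>K. ?t k S - S) + card (S - ?t k0 S)" by (rule card_Un_le)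
  also have "\<dots> \<le> (\<Sum>k\<in>K. card (?t k S - S)) + card (S - ?t k0 S)"
    by (intro add_right_mono card_UN_le K)
  finally have "real (card (sym_diff (K <#> S) S)) \<le> real ((\<Sum>k\<in>K. card (?t k S - S)) + card (S - ?t k0 S))"
    by (rule of_nat_mono)
  also have "\<dots> = (\<Sum>k\<in>K. real (card (?t k S - S))) + real (card (S - ?t k0 S))" by simp
  also have "\<dots> \<le> (\<Sum>k\<in>K. (d + e) * real (card F)) + (d + e) * real (card F)"
    by (intro add_mono sum_mono one deficit)
  also have "\<dots> = real (card K + 1) * ((d + e) * real (card F))" by (simp add: algebra_simps)
  also have "\<dots> \<le> real (card K + 1) * ((d + e) * (2 * real (card S)))"
  proof -
    have "0 \<le> (d + e) * real (card F)" using one[OF k0] by linarith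
    then have "0 \<le> d + e" using cF by (simp add: zero_le_mult_iff)
    then show ?thesis using half by (intro mult_left_mono) auto
  qed
  also have "\<dots> = 2 * real (card K + 1) * (d + e) * real (card S)" by (simp add: algebra_simps)
  also have "\<dots> < \<delta> * real (card S)" using \<delta> cS by (intro mult_strict_right_mono) auto
  finally have "real (card (sym_diff (K <#> S) S)) / real (card S) < \<delta>"
    using cS by (simp add: divide_less_eq)
  then show ?thesis using S(1) fin finS cS by (auto simp: invariant_finset_def)
qed

section \<open>Sets with null boundary\<close>

definition null_boundary :: "'x set \<Rightarrow> bool" where
  "null_boundary A \<longleftrightarrow> A \<in> sets borel \<and> (\<forall>\<mu>\<in>IM. measure \<mu> (frontier A) = 0)"

lemma null_boundary_borel: "null_boundary A \<Longrightarrow> A \<in> sets borel"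
  by (simp add: null_boundary_def)

lemma null_boundary_empty: "null_boundary {}"
  by (simp add: null_boundary_def)

lemma null_boundary_Compl: "null_boundary A \<Longrightarrow> null_boundary (- A)"
  by (simp add: null_boundary_def frontier_complement borel_comp)

lemma null_boundary_Un:
  assumes "null_boundary A" "null_boundary B"
  shows "null_boundary (A \<union> B)"
proof -
  have "measure \<mu> (frontier (A \<union> B)) = 0" if \<mu>: "\<mu> \<in> IM" for \<mu>
  proof -
    interpret prob_space \<mu> using \<mu> by (rule invariant_measureD)
    have fr: "frontier D \<in> events" for D
      using borel_closed[OF frontier_closed] invariant_measureD(2)[OF \<mu>] by simp
    have "measure \<mu> (frontier (A \<union> B)) \<le> measure \<mu> (frontier A \<union> frontier B)"
      by (intro finite_measure_mono frontier_Un_subset sets.Un fr)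
    also have "\<dots> \<le> measure \<mu> (frontier A) + measure \<mu> (frontier B)"
      by (intro measure_Un_le fr)
    also have "\<dots> = 0" using assms \<mu> by (simp add: null_boundary_def)
    finally show ?thesis by (simp add: measure_le_0_iff)
  qed
  then show ?thesis using assms by (auto simp: null_boundary_def)
qed

lemma null_boundary_Int: "null_boundary A \<Longrightarrow> null_boundary B \<Longrightarrow> null_boundary (A \<inter> B)"
  by (metis null_boundary_Compl null_boundary_Un Compl_Int double_complement)

lemma null_boundary_UN:
  "finite I \<Longrightarrow> (\<And>i. i \<in> I \<Longrightarrow> null_boundary (A i)) \<Longrightarrow> null_boundary (\<Union>i\<in>I. A i)"
  by (induction I rule: finite_induct) (simp_all add: null_boundary_Un null_boundary_empty)

lemma null_boundary_INT:
  assumes "finite I" "\<And>i. i \<in> I \<Longrightarrow> null_boundary (A i)"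
  shows "null_boundary (\<Inter>i\<in>I. A i)"
proof -
  have "null_boundary (- (\<Union>i\<in>I. - A i))" using assms by (intro null_boundary_Compl null_boundary_UN)
  then show ?thesis by simp
qed

lemma null_boundary_vimage:
  assumes "null_boundary A" "g \<in> carrier G"
  shows "null_boundary (\<phi> g -` A)"
  using assms borel_closed[OF frontier_closed[of A]]
  by (simp add: null_boundary_def frontier_act_vimage borel_act_vimage invariant_measure_act_vimage)

lemma null_boundary_image: "null_boundary A \<Longrightarrow> g \<in> carrier G \<Longrightarrow> null_boundary (\<phi> g ` A)"
  by (simp add: act_image_eq_vimage null_boundary_vimage)

lemma null_boundary_footprint:
  assumes "castle G \<phi> \<C>" "\<And>S V. (S, V) \<in> \<C> \<Longrightarrow> null_boundary V"
  shows "null_boundary (footprint \<phi> \<C>)"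
  unfolding footprint_def
proof (rule null_boundary_UN)
  show "finite \<C>" using assms(1) by (rule castleD)
  fix T assume T: "T \<in> \<C>"
  obtain S V where SV: "T = (S, V)" by (cases T)
  have "finite S" "S \<subseteq> carrier G" "null_boundary V"
    using T castleD(2,3)[OF assms(1), of S V] assms(2)[of S V] by (simp_all add: SV)
  then show "null_boundary (case T of (S, V) \<Rightarrow> \<Union>s\<in>S. \<phi> s ` V)"
    unfolding SV by (auto intro!: null_boundary_UN null_boundary_image)
qed

section \<open>One round of the greedy tiling\<close>

lemma tower_neighbourhood:
  assumes F: "finite F" "F \<subseteq> carrier G" and inj: "inj_on (\<lambda>f. \<phi> f x) F" and \<delta>: "0 < \<delta>"
  obtains W where "open W" "x \<in> W"
    and "\<And>f u v. f \<in> F \<Longrightarrow> u \<in> W \<Longrightarrow> v \<in> W \<Longrightarrow> dist (\<phi> f u) (\<phi> f v) \<le> \<delta>"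
    and "\<And>f f' u v. f \<in> F \<Longrightarrow> f' \<in> F \<Longrightarrow> u \<in> W \<Longrightarrow> v \<in> W \<Longrightarrow> \<phi> f u = \<phi> f' v \<Longrightarrow> f = f'"
proof -
  define D where "D = insert \<delta> ((\<lambda>(f, f'). dist (\<phi> f x) (\<phi> f' x)) ` (F \<times> F - Id))"
  have "finite D" "D \<noteq> {}" using F by (auto simp: D_def)
  moreover have "0 < y" if "y \<in> D" for y
  proof -
    consider "y = \<delta>" | f f' where "f \<in> F" "f' \<in> F" "f \<noteq> f'" "y = dist (\<phi> f x) (\<phi> f' x)"
      using \<open>y \<in> D\<close> unfolding D_def by auto
    then show ?thesis
    proof cases
      case 2
      then have "\<phi> f x \<noteq> \<phi> f' x" using inj by (metis inj_onD)
      then show ?thesis using 2 by simp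
    qed (use \<delta> in simp)
  qed
  ultimately have "0 < Min D" by simp
  define r where "r = Min D / 2"
  have r: "0 < r" "2 * r \<le> \<delta>" using \<open>0 < Min D\<close> \<open>finite D\<close> by (auto simp: r_def D_def)
  have sep: "2 * r \<le> dist (\<phi> f x) (\<phi> f' x)" if "f \<in> F" "f' \<in> F" "f \<noteq> f'" for f f'
  proof -
    have "dist (\<phi> f x) (\<phi> f' x) \<in> D" using that by (auto simp: D_def)
    then show ?thesis using \<open>finite D\<close> by (simp add: r_def)
  qed
  define W where "W = (\<Inter>f\<in>F. \<phi> f -` ball (\<phi> f x) r)"
  have W: "dist (\<phi> f x) (\<phi> f u) < r" if "f \<in> F" "u \<in> W" for f u
    using that by (auto simp: W_def)
  show ?thesis
  proof (rule that[of W])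
    show "open W" unfolding W_def using F by (auto intro!: open_INT open_act_vimage)
    show "x \<in> W" using r by (simp add: W_def)
    show "dist (\<phi> f u) (\<phi> f v) \<le> \<delta>" if "f \<in> F" "u \<in> W" "v \<in> W" for f u v
      using W[of f u] W[of f v] that r dist_triangle3[of "\<phi> f u" "\<phi> f v" "\<phi> f x"] by simp
    show "f = f'" if "f \<in> F" "f' \<in> F" "u \<in> W" "v \<in> W" "\<phi> f u = \<phi> f' v" for f f' u v
    proof (rule ccontr)
      assume "f \<noteq> f'"
      then show False
        using W[of f u] W[of f' v] that sep[of f f'] dist_triangle2[of "\<phi> f x" "\<phi> f' x" "\<phi> f u"] by simp
    qed
  qed
qed

text \<open>
  The castle \<open>\<D>\<close> is added to \<open>\<C>\<close> in one round with the Foelner shape \<open>F\<close> and the candidate bases \<open>\<U>\<close>.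
  The new shapes are large parts of \<open>F\<close>, and the whole of \<open>F v\<close> ends up in the footprint for every
  point \<open>v\<close> of a new base: the part of \<open>F v\<close> missing in the new tower was occupied before.  That is
  what makes the new footprint nearly invariant, although the shapes themselves are only as
  invariant as the missing fraction \<open>e\<close> permits.
\<close>

definition greedy_extension ::
    "'g set \<Rightarrow> real \<Rightarrow> 'x set set \<Rightarrow> ('g set \<times> 'x set) set \<Rightarrow> ('g set \<times> 'x set) set \<Rightarrow> bool" where
  "greedy_extension F e \<U> \<C> \<D> \<longleftrightarrow> castle G \<phi> (\<C> \<union> \<D>) \<and>
     (\<forall>S V. (S, V) \<in> \<D> \<longrightarrow> S \<subseteq> F \<and> real (card (F - S)) \<le> e * real (card F) \<and>
        (\<exists>U\<in>\<U>. V \<subseteq> U) \<and> null_boundary V \<and> (\<forall>v\<in>V. \<forall>f\<in>F. \<phi> f v \<in> footprint \<phi> (\<C> \<union> \<D>))) \<and>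
     (\<forall>x\<in>\<Union>\<U>. e * real (card F) \<le> real (card {f \<in> F. \<phi> f x \<in> footprint \<phi> (\<C> \<union> \<D>)}))"

lemma greedy_extensionD:
  assumes "greedy_extension F e \<U> \<C> \<D>"
  shows "castle G \<phi> (\<C> \<union> \<D>)"
    and "\<And>S V. (S, V) \<in> \<D> \<Longrightarrow> S \<subseteq> F"
    and "\<And>S V. (S, V) \<in> \<D> \<Longrightarrow> real (card (F - S)) \<le> e * real (card F)"
    and "\<And>S V. (S, V) \<in> \<D> \<Longrightarrow> \<exists>U\<in>\<U>. V \<subseteq> U"
    and "\<And>S V. (S, V) \<in> \<D> \<Longrightarrow> null_boundary V"
    and "\<And>S V v f. (S, V) \<in> \<D> \<Longrightarrow> v \<in> V \<Longrightarrow> f \<in> F \<Longrightarrow> \<phi> f v \<in> footprint \<phi> (\<C> \<union> \<D>)"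
    and "\<And>x. x \<in> \<Union>\<U> \<Longrightarrow> e * real (card F) \<le> real (card {f \<in> F. \<phi> f x \<in> footprint \<phi> (\<C> \<union> \<D>)})"
  using assms unfolding greedy_extension_def by (simp_all, blast)

text \<open>
  The points \<open>x\<close> of \<open>U\<close> are sorted by the set \<open>T\<close> of those \<open>f\<close> for which \<open>\<phi> f x\<close> is occupied.  If \<open>T\<close> is
  at most a fraction \<open>e\<close> of \<open>F\<close>, a tower of shape \<open>F - T\<close> is put over these points; if not, at
  least the fraction \<open>e\<close> of \<open>F x\<close> was covered already.
\<close>

lemma greedy_tower:
  assumes c: "castle G \<phi> \<C>" and nb: "\<And>S V. (S, V) \<in> \<C> \<Longrightarrow> null_boundary V"
    and F: "finite F" "F \<subseteq> carrier G" and U: "null_boundary U"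
    and inj: "\<And>f f' u v. f \<in> F \<Longrightarrow> f' \<in> F \<Longrightarrow> u \<in> U \<Longrightarrow> v \<in> U \<Longrightarrow> \<phi> f u = \<phi> f' v \<Longrightarrow> f = f'"
    and e: "e \<le> 1"
  shows "\<exists>\<D>. greedy_extension F e {U} \<C> \<D>"
proof -
  define A where "A = footprint \<phi> \<C>"
  have nbA: "null_boundary A" unfolding A_def by (rule null_boundary_footprint[OF c nb])
  define hit where "hit x = {f \<in> F. \<phi> f x \<in> A}" for x
  define base where "base T = {x \<in> U. hit x = T}" for T
  define \<D> where "\<D> = (\<lambda>T. (F - T, base T)) ` {T. T \<subseteq> F \<and> real (card T) \<le> e * real (card F)}"
  have finD: "finite \<D>" unfolding \<D>_def using F(1) by (intro finite_imageI) auto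
  have D: "\<exists>T. T \<subseteq> F \<and> real (card T) \<le> e * real (card F) \<and> S = F - T \<and> V = base T" if "(S, V) \<in> \<D>" for S V
    using that by (auto simp: \<D>_def)
  have nb_base: "null_boundary (base T)" if "T \<subseteq> F" for T
  proof -
    have "base T = U \<inter> ((\<Inter>f\<in>T. \<phi> f -` A) \<inter> (\<Inter>f\<in>F - T. \<phi> f -` (- A)))"
      using that by (auto simp: base_def hit_def)
    also have "null_boundary \<dots>"
      using F that finite_subset[OF that F(1)]
      by (intro null_boundary_Int U null_boundary_INT null_boundary_vimage nbA null_boundary_Compl) auto
    finally show ?thesis .
  qed
  \<comment> \<open>Old levels lie in A and new levels outside A, so only levels of the same kind can meet.\<close>
  have outside: "\<phi> s v \<notin> A" if "(S, V) \<in> \<D>" "s \<in> S" "v \<in> V" for S V s v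
    using D[OF that(1)] that(2,3) by (auto simp: base_def hit_def)
  have inside: "\<phi> s v \<in> A" if "(S, V) \<in> \<C>" "s \<in> S" "v \<in> V" for S V s v
    using that by (auto simp: A_def in_footprint_iff)
  have castle: "castle G \<phi> (\<C> \<union> \<D>)"
    unfolding castle_iff
  proof (intro conjI allI impI)
    show "finite (\<C> \<union> \<D>)" using castleD(1)[OF c] finD by simp
    show "finite S" "S \<subseteq> carrier G" if "(S, V) \<in> \<C> \<union> \<D>" for S V
      using that castleD(2,3)[OF c, of S V] D[of S V] F by auto
    fix S V s v S' V' s' v'
    assume *: "(S, V) \<in> \<C> \<union> \<D>" "(S', V') \<in> \<C> \<union> \<D>" "s \<in> S" "s' \<in> S'" "v \<in> V" "v' \<in> V'" "\<phi> s v = \<phi> s' v'"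
    have "S = S' \<and> V = V' \<and> s = s'"
    proof (cases "\<phi> s v \<in> A")
      case True
      then have "(S, V) \<in> \<C>" "(S', V') \<in> \<C>" using * outside[of S V s v] outside[of S' V' s' v'] by auto
      then show ?thesis using castle_unique_level[OF c _ _ *(3-7)] by blast
    next
      case False
      then have "(S, V) \<in> \<D>" "(S', V') \<in> \<D>" using * inside[of S V s v] inside[of S' V' s' v'] by auto
      then obtain T T' where T: "S = F - T" "V = base T" and T': "S' = F - T'" "V' = base T'"
        using D[of S V] D[of S' V'] by auto
      note T = T T'
      then have "v \<in> U" "v' \<in> U" "s \<in> F" "s' \<in> F" using * by (auto simp: base_def)
      then have "s = s'" using inj *(7) by blast
      then have "v = v'" using *(7) \<open>s \<in> F\<close> F(2) by auto
      then have "T = T'" using * T by (auto simp: base_def)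
      then show ?thesis using T \<open>s = s'\<close> by simp
    qed
    then show "S = S'" "V = V'" "s = s'" by simp_all
  qed
  have full: "\<phi> f v \<in> footprint \<phi> (\<C> \<union> \<D>)" if SV: "(S, V) \<in> \<D>" "v \<in> V" "f \<in> F" for S V v f
  proof (cases "\<phi> f v \<in> A")
    case True
    then show ?thesis by (auto simp: A_def footprint_def)
  next
    case False
    obtain T where "S = F - T" "V = base T" using D[OF SV(1)] by blast
    then have "f \<in> S" using False SV by (auto simp: base_def hit_def)
    then show ?thesis using SV unfolding in_footprint_iff by blast
  qed
  have cover: "e * real (card F) \<le> real (card {f \<in> F. \<phi> f x \<in> footprint \<phi> (\<C> \<union> \<D>)})" if x: "x \<in> U" for x
  proof (cases "real (card (hit x)) \<le> e * real (card F)")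
    case True
    then have "(F - hit x, base (hit x)) \<in> \<D>" by (auto simp: \<D>_def hit_def)
    then have "{f \<in> F. \<phi> f x \<in> footprint \<phi> (\<C> \<union> \<D>)} = F"
      using full[of "F - hit x" "base (hit x)" x] x by (auto simp: base_def)
    then show ?thesis using mult_right_mono[OF e, of "real (card F)"] by simp
  next
    case False
    have "hit x \<subseteq> {f \<in> F. \<phi> f x \<in> footprint \<phi> (\<C> \<union> \<D>)}" by (auto simp: hit_def A_def footprint_def)
    then have "card (hit x) \<le> card {f \<in> F. \<phi> f x \<in> footprint \<phi> (\<C> \<union> \<D>)}" using F(1) by (intro card_mono) auto
    then show ?thesis using False by linarith
  qed
  have props: "S \<subseteq> F \<and> real (card (F - S)) \<le> e * real (card F) \<and> V \<subseteq> U \<and> null_boundary V" if SV: "(S, V) \<in> \<D>" for S V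
  proof -
    obtain T where "T \<subseteq> F" "real (card T) \<le> e * real (card F)" "S = F - T" "V = base T" using D[OF SV] by blast
    then show ?thesis using nb_base by (auto simp: double_diff base_def)
  qed
  have "greedy_extension F e {U} \<C> \<D>"
    unfolding greedy_extension_def using castle props full cover by simp
  then show ?thesis ..
qed

lemma footprint_mono: "\<C> \<subseteq> \<D> \<Longrightarrow> footprint \<phi> \<C> \<subseteq> footprint \<phi> \<D>"
  by (auto simp: footprint_def)

text \<open>
  The candidate bases are used one after the other, each time with the enlarged castle.
\<close>

lemma greedy_towers:
  assumes "finite \<U>"
    and c: "castle G \<phi> \<C>" and nb: "\<And>S V. (S, V) \<in> \<C> \<Longrightarrow> null_boundary V"
    and F: "finite F" "F \<subseteq> carrier G" and U: "\<And>U. U \<in> \<U> \<Longrightarrow> null_boundary U"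
    and inj: "\<And>U f f' u v. U \<in> \<U> \<Longrightarrow> f \<in> F \<Longrightarrow> f' \<in> F \<Longrightarrow> u \<in> U \<Longrightarrow> v \<in> U \<Longrightarrow> \<phi> f u = \<phi> f' v \<Longrightarrow> f = f'"
    and e: "e \<le> 1"
  shows "\<exists>\<D>. greedy_extension F e \<U> \<C> \<D>"
  using \<open>finite \<U>\<close> U inj
proof (induction \<U> rule: finite_induct)
  case empty
  have "greedy_extension F e {} \<C> {}" using c by (simp add: greedy_extension_def)
  then show ?case ..
next
  case (insert U \<U>)
  have "\<exists>\<D>. greedy_extension F e \<U> \<C> \<D>"
  proof (rule insert.IH)
    show "null_boundary W" if "W \<in> \<U>" for W using insert.prems(1) that by simp
    show "f = f'" if "W \<in> \<U>" "f \<in> F" "f' \<in> F" "u \<in> W" "v \<in> W" "\<phi> f u = \<phi> f' v" for W f f' u v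
      using insert.prems(2)[of W f f' u v] that by simp
  qed
  then obtain \<D> where ext: "greedy_extension F e \<U> \<C> \<D>" by blast
  note \<D> = greedy_extensionD[OF ext]
  have "\<exists>\<E>. greedy_extension F e {U} (\<C> \<union> \<D>) \<E>"
  proof (rule greedy_tower[OF \<D>(1) _ F _ _ e])
    show "null_boundary V" if "(S, V) \<in> \<C> \<union> \<D>" for S V
      using that nb[of S V] \<D>(5)[of S V] by auto
    show "null_boundary U" using insert.prems(1) by simp
    show "f = f'" if "f \<in> F" "f' \<in> F" "u \<in> U" "v \<in> U" "\<phi> f u = \<phi> f' v" for f f' u v
      using insert.prems(2)[of U f f' u v] that by simp
  qed
  then obtain \<E> where ext': "greedy_extension F e {U} (\<C> \<union> \<D>) \<E>" by blast
  note \<E> = greedy_extensionD[OF ext']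
  have mono: "footprint \<phi> (\<C> \<union> \<D>) \<subseteq> footprint \<phi> (\<C> \<union> (\<D> \<union> \<E>))" by (rule footprint_mono) auto
  have assoc: "(\<C> \<union> \<D>) \<union> \<E> = \<C> \<union> (\<D> \<union> \<E>)" by auto
  have "greedy_extension F e (insert U \<U>) \<C> (\<D> \<union> \<E>)"
    unfolding greedy_extension_def
  proof (intro conjI allI impI ballI)
    show "castle G \<phi> (\<C> \<union> (\<D> \<union> \<E>))" using \<E>(1) by (simp only: assoc)
    fix S V assume SV: "(S, V) \<in> \<D> \<union> \<E>"
    show "S \<subseteq> F" "real (card (F - S)) \<le> e * real (card F)" "null_boundary V"
      using SV \<D>(2,3,5)[of S V] \<E>(2,3,5)[of S V] by auto
    show "\<exists>U\<in>insert U \<U>. V \<subseteq> U" using SV \<D>(4)[of S V] \<E>(4)[of S V] by auto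
    show "\<phi> f v \<in> footprint \<phi> (\<C> \<union> (\<D> \<union> \<E>))" if "v \<in> V" "f \<in> F" for v f
      using SV that \<D>(6)[of S V v f] \<E>(6)[of S V v f] mono assoc by auto
  next
    fix x assume x: "x \<in> \<Union>(insert U \<U>)"
    show "e * real (card F) \<le> real (card {f \<in> F. \<phi> f x \<in> footprint \<phi> (\<C> \<union> (\<D> \<union> \<E>))})"
    proof (cases "x \<in> U")
      case True
      then show ?thesis using \<E>(7)[of x] by (simp only: assoc) simp
    next
      case False
      then have "e * real (card F) \<le> real (card {f \<in> F. \<phi> f x \<in> footprint \<phi> (\<C> \<union> \<D>)})"
        using \<D>(7)[of x] x by simp
      also have "card {f \<in> F. \<phi> f x \<in> footprint \<phi> (\<C> \<union> \<D>)} \<le> card {f \<in> F. \<phi> f x \<in> footprint \<phi> (\<C> \<union> (\<D> \<union> \<E>))}"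
        using F(1) mono by (intro card_mono) auto
      finally show ?thesis by simp
    qed
  qed
  then show ?case ..
qed


section \<open>The measure gained in one round\<close>

lemma sum_castle_measure:
  assumes c: "castle G \<phi> \<C>" and B: "\<And>S V. (S, V) \<in> \<C> \<Longrightarrow> V \<in> sets borel" and \<mu>: "\<mu> \<in> IM"
  shows "(\<Sum>(S, V)\<in>\<C>. real (card S) * measure \<mu> V) = measure \<mu> (footprint \<phi> \<C>)"
proof -
  interpret prob_space \<mu> using \<mu> by (rule invariant_measureD)
  let ?level = "\<lambda>((S, V), s). \<phi> s ` V" and ?I = "SIGMA T:\<C>. fst T"
  have fin: "finite \<C>" "\<forall>T\<in>\<C>. finite (fst T)" using castleD[OF c] by auto
  have carr: "s \<in> carrier G" if "(S, V) \<in> \<C>" "s \<in> S" for S V s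
    using castleD(3)[OF c that(1)] that(2) by blast
  have "footprint \<phi> \<C> = (\<Union>p\<in>?I. ?level p)"
  proof (rule Set.set_eqI)
    fix x
    have "x \<in> (\<Union>p\<in>?I. ?level p) \<longleftrightarrow> (\<exists>S V s. (S, V) \<in> \<C> \<and> s \<in> S \<and> x \<in> \<phi> s ` V)"
      by (simp add: Bex_def split_paired_Ex)
    then show "x \<in> footprint \<phi> \<C> \<longleftrightarrow> x \<in> (\<Union>p\<in>?I. ?level p)"
      unfolding in_footprint_iff by blast
  qed
  also have "measure \<mu> \<dots> = (\<Sum>p\<in>?I. measure \<mu> (?level p))"
  proof (rule finite_measure_finite_Union)
    show "finite ?I" using fin by (intro finite_SigmaI) auto
    show "?level ` ?I \<subseteq> events"
      using B carr borel_act_image invariant_measureD(2)[OF \<mu>] by auto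
    show "disjoint_family_on ?level ?I" using c by (simp add: castle_def)
  qed
  also have "\<dots> = (\<Sum>T\<in>\<C>. \<Sum>s\<in>fst T. measure \<mu> (?level (T, s)))"
    using fin by (subst sum.Sigma) (auto intro!: sum.cong simp: split_beta)
  also have "\<dots> = (\<Sum>(S, V)\<in>\<C>. real (card S) * measure \<mu> V)"
  proof (rule sum.cong)
    fix T assume T: "T \<in> \<C>"
    obtain S V where SV: "T = (S, V)" by (cases T)
    have "(\<Sum>s\<in>S. measure \<mu> (\<phi> s ` V)) = (\<Sum>s\<in>S. measure \<mu> V)"
      using T carr[of S V] B[of S V] by (intro sum.cong invariant_measure_act_image[OF \<mu>]) (auto simp: SV)
    then show "(\<Sum>s\<in>fst T. measure \<mu> (?level (T, s))) = (case T of (S, V) \<Rightarrow> real (card S) * measure \<mu> V)"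
      by (simp add: SV)
  qed simp
  finally show ?thesis by simp
qed

text \<open>
  The boundary layer of \<open>A\<close>: the points outside \<open>A\<close> that some element of \<open>L\<close> moves into \<open>A\<close>.
\<close>

definition entering :: "'g set \<Rightarrow> 'x set \<Rightarrow> 'x set" where
  "entering L A = (\<Union>l\<in>L. \<phi> l -` A) - A"

lemma borel_entering: "finite L \<Longrightarrow> L \<subseteq> carrier G \<Longrightarrow> A \<in> sets borel \<Longrightarrow> entering L A \<in> sets borel"
  unfolding entering_def by (intro sets.Diff sets.finite_UN) (auto intro: borel_act_vimage)

text \<open>
  A point outside the old footprint \<open>A\<close>, outside the boundary layer and outside \<open>Y\<close> has no visits to \<open>A\<close>
  along \<open>F\<close>, so all its visits to the new footprint are to the part that was added.  Counting gives this
  part at least \<open>e\<close> times the measure of the set of these points.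
\<close>

lemma greedy_extension_remainder:
  assumes ext: "greedy_extension F e \<U> \<C> \<D>"
    and nb: "\<And>S V. (S, V) \<in> \<C> \<union> \<D> \<Longrightarrow> null_boundary V"
    and F: "finite F" "F \<noteq> {}" "F \<subseteq> carrier G" and e: "0 \<le> e"
    and \<mu>: "\<mu> \<in> IM" and Y: "Y \<in> sets borel" "- Y \<subseteq> \<Union>\<U>"
    and small: "measure \<mu> Y \<le> a" "measure \<mu> (entering F (footprint \<phi> \<C>)) \<le> b"
  shows "measure \<mu> (- footprint \<phi> (\<C> \<union> \<D>)) \<le> (1 - e) * measure \<mu> (- footprint \<phi> \<C>) + e * (a + b)"
proof -
  interpret prob_space \<mu> using \<mu> by (rule invariant_measureD)
  note S = invariant_measureD(2)[OF \<mu>]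
  define A A' where "A = footprint \<phi> \<C>" and "A' = footprint \<phi> (\<C> \<union> \<D>)"
  note c' = greedy_extensionD(1)[OF ext]
  have "castle G \<phi> \<C>" using c' by (rule castle_subset) simp
  then have A: "A \<in> sets borel" and A': "A' \<in> sets borel" "A \<subseteq> A'"
    unfolding A_def A'_def using c' nb null_boundary_footprint null_boundary_borel
    by (blast, blast, simp add: footprint_mono)
  define Q where "Q = - A - (Y \<union> entering F A)"
  have E: "entering F A \<in> sets borel" using F A by (intro borel_entering)
  have Q: "Q \<in> sets borel" unfolding Q_def using A Y E by (intro sets.Diff borel_comp sets.Un)
  have "e * real (card F) \<le> real (card {f \<in> F. \<phi> f x \<in> A' - A})" if "x \<in> Q" for x
  proof -
    have "x \<in> \<Union>\<U>" using that Y by (auto simp: Q_def)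
    moreover have "\<phi> f x \<notin> A" if "f \<in> F" for f using that \<open>x \<in> Q\<close> by (auto simp: Q_def entering_def)
    then have "{f \<in> F. \<phi> f x \<in> A' - A} = {f \<in> F. \<phi> f x \<in> A'}" by auto
    ultimately show ?thesis using greedy_extensionD(7)[OF ext, of x] by (simp add: A'_def)
  qed
  then have gain: "e * measure \<mu> Q \<le> measure \<mu> (A' - A)"
    using A A' Q by (intro invariant_measure_ge_of_counting[OF \<mu> F]) auto
  have "measure \<mu> (- A) \<le> measure \<mu> (Q \<union> (Y \<union> entering F A))"
  proof (rule finite_measure_mono)
    show "- A \<subseteq> Q \<union> (Y \<union> entering F A)" by (auto simp: Q_def)
    show "Q \<union> (Y \<union> entering F A) \<in> events" using S sets.Un[OF Q sets.Un[OF Y(1) E]] by simp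
  qed
  also have "\<dots> \<le> measure \<mu> Q + (measure \<mu> Y + measure \<mu> (entering F A))"
    using S Q Y E by (intro order_trans[OF measure_Un_le] add_left_mono measure_Un_le) auto
  finally have "measure \<mu> (- A) - (a + b) \<le> measure \<mu> Q" using small by (simp add: A_def)
  then have "e * (measure \<mu> (- A) - (a + b)) \<le> e * measure \<mu> Q" using e by (rule mult_left_mono)
  moreover have "measure \<mu> (- A') = measure \<mu> (- A) - measure \<mu> (A' - A)"
  proof -
    have "- A' = - A - (A' - A)" using A'(2) by auto
    then have "measure \<mu> (- A') = measure \<mu> (- A - (A' - A))" by simp
    also have "\<dots> = measure \<mu> (- A) - measure \<mu> (A' - A)"
      using S A A' borel_comp[OF A] by (intro finite_measure_Diff) auto
    finally show ?thesis .
  qed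
  ultimately show ?thesis using gain unfolding A_def[symmetric] A'_def[symmetric] by (simp add: algebra_simps)
qed

text \<open>
  Let \<open>l\<close> move \<open>x\<close> into a new level \<open>s V\<close>, say to \<open>\<phi> s v\<close>.  If \<open>inv l \<otimes> s\<close> were in \<open>F\<close>, then \<open>x\<close> would lie
  in \<open>F v\<close>, hence in the footprint.  So \<open>s\<close> is one of the few elements of \<open>F\<close> that \<open>inv l\<close> moves out of
  \<open>F\<close>, and the boundary layer grows by at most the total measure of the corresponding translates of \<open>V\<close>.
\<close>

lemma greedy_extension_entering:
  assumes ext: "greedy_extension F e \<U> \<C> \<D>"
    and nb: "\<And>S V. (S, V) \<in> \<C> \<union> \<D> \<Longrightarrow> null_boundary V"
    and L: "finite L" "L \<subseteq> carrier G" and F: "almost_invariant (m_inv G ` L) d F"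
    and e: "e \<le> 1 / 2" and \<mu>: "\<mu> \<in> IM"
  shows "measure \<mu> (entering L (footprint \<phi> (\<C> \<union> \<D>))) \<le>
    measure \<mu> (entering L (footprint \<phi> \<C>)) + 2 * (real (card L) * d)"
proof -
  interpret prob_space \<mu> using \<mu> by (rule invariant_measureD)
  note Sm = invariant_measureD(2)[OF \<mu>]
  note c' = greedy_extensionD(1)[OF ext]
  have c: "castle G \<phi> \<C>" using c' by (rule castle_subset) simp
  have cD: "castle G \<phi> \<D>" using c' by (rule castle_subset) simp
  have Ff: "finite F" "F \<noteq> {}" "F \<subseteq> carrier G" using F by (auto simp: almost_invariant_def)
  define A A' where "A = footprint \<phi> \<C>" and "A' = footprint \<phi> (\<C> \<union> \<D>)"
  have A: "A \<in> sets borel"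
    unfolding A_def using nb by (intro null_boundary_borel null_boundary_footprint[OF c]) auto
  define E where "E T = (\<Union>l\<in>L. \<Union>s\<in>{s \<in> F. inv l \<otimes> s \<notin> F}. \<phi> (inv l \<otimes> s) ` snd T)" for T :: "'g set \<times> 'x set"
  have carr: "inv l \<otimes> s \<in> carrier G" if "l \<in> L" "s \<in> F" for l s using that L Ff by auto
  have snd_borel: "snd T \<in> sets borel" if "T \<in> \<D>" for T
    using nb[of "fst T" "snd T"] that by (simp add: null_boundary_borel)
  have level_borel: "\<phi> (inv l \<otimes> s) ` snd T \<in> sets borel" if "l \<in> L" "s \<in> F" "T \<in> \<D>" for l s T
    using carr[OF that(1,2)] snd_borel[OF that(3)] by (rule borel_act_image)
  have inner_borel: "(\<Union>s\<in>{s \<in> F. inv l \<otimes> s \<notin> F}. \<phi> (inv l \<otimes> s) ` snd T) \<in> sets borel" if "l \<in> L" "T \<in> \<D>" for l T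
    using Ff(1) level_borel that by (intro sets.finite_UN) auto
  have E_borel: "E T \<in> sets borel" if "T \<in> \<D>" for T
    unfolding E_def by (rule sets.finite_UN[OF L(1) inner_borel[OF _ that]])
  have finD: "finite \<D>" using cD by (rule castleD)
  have E_UN: "(\<Union>T\<in>\<D>. E T) \<in> sets borel" by (rule sets.finite_UN[OF finD E_borel])
  have sub: "entering L A' \<subseteq> entering L A \<union> (\<Union>T\<in>\<D>. E T)"
  proof
    fix x assume "x \<in> entering L A'"
    then obtain l where l: "l \<in> L" "\<phi> l x \<in> A'" and x: "x \<notin> A'" by (auto simp: entering_def)
    have "x \<notin> A" using x by (auto simp: A_def A'_def footprint_def)
    show "x \<in> entering L A \<union> (\<Union>T\<in>\<D>. E T)"
    proof (cases "\<phi> l x \<in> A")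
      case True
      then show ?thesis using l \<open>x \<notin> A\<close> by (auto simp: entering_def)
    next
      case False
      then obtain S V s v where T: "(S, V) \<in> \<D>" "s \<in> S" "v \<in> V" "\<phi> l x = \<phi> s v"
        using l(2) unfolding A_def A'_def in_footprint_iff by blast
      have "s \<in> F" using greedy_extensionD(2)[OF ext T(1)] T(2) by blast
      have lG: "l \<in> carrier G" and sG: "s \<in> carrier G" using l L \<open>s \<in> F\<close> Ff by auto
      have xv: "x = \<phi> (inv l \<otimes> s) v"
        using lG sG T(4)[symmetric] by simp
      have "inv l \<otimes> s \<notin> F"
        using greedy_extensionD(6)[OF ext T(1,3)] x xv by (auto simp: A'_def)
      then have "x \<in> E (S, V)" unfolding E_def using l \<open>s \<in> F\<close> T(3) xv by auto
      then show ?thesis using T(1) by blast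
    qed
  qed
  have d_nonneg: "0 \<le> real (card L) * d"
  proof (cases "L = {}")
    case False
    then obtain l where "l \<in> L" by blast
    then have "0 \<le> d * real (card F)"
      using F unfolding almost_invariant_def by (meson imageI of_nat_0_le_iff order_trans)
    then show ?thesis using Ff by (simp add: zero_le_mult_iff card_gt_0_iff)
  qed simp
  have E_le: "measure \<mu> (E T) \<le> real (card L) * d * (2 * (real (card (fst T)) * measure \<mu> (snd T)))" if T: "T \<in> \<D>" for T
  proof -
    have "measure \<mu> (E T) \<le> (\<Sum>l\<in>L. measure \<mu> (\<Union>s\<in>{s \<in> F. inv l \<otimes> s \<notin> F}. \<phi> (inv l \<otimes> s) ` snd T))"
      unfolding E_def using L inner_borel[OF _ T] Sm by (intro measure_UNION_le) auto
    also have "\<dots> \<le> (\<Sum>l\<in>L. d * real (card F) * measure \<mu> (snd T))"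
    proof (rule sum_mono)
      fix l assume l: "l \<in> L"
      have "measure \<mu> (\<Union>s\<in>{s \<in> F. inv l \<otimes> s \<notin> F}. \<phi> (inv l \<otimes> s) ` snd T)
          \<le> (\<Sum>s\<in>{s \<in> F. inv l \<otimes> s \<notin> F}. measure \<mu> (\<phi> (inv l \<otimes> s) ` snd T))"
        using Ff level_borel[OF l _ T] Sm by (intro measure_UNION_le) auto
      also have "\<dots> = (\<Sum>s\<in>{s \<in> F. inv l \<otimes> s \<notin> F}. measure \<mu> (snd T))"
        using carr[OF l] by (intro sum.cong refl invariant_measure_act_image[OF \<mu> _ snd_borel[OF T]]) auto
      also have "\<dots> = real (card {s \<in> F. inv l \<otimes> s \<notin> F}) * measure \<mu> (snd T)" by simp
      also have "card {s \<in> F. inv l \<otimes> s \<notin> F} = card ((\<lambda>f. inv l \<otimes> f) ` F - F)"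
      proof -
        have inj: "inj_on (\<lambda>f. inv l \<otimes> f) {s \<in> F. inv l \<otimes> s \<notin> F}"
          by (rule inj_on_subset[OF inj_on_cmult]) (use l L Ff in auto)
        have eq: "(\<lambda>f. inv l \<otimes> f) ` {s \<in> F. inv l \<otimes> s \<notin> F} = (\<lambda>f. inv l \<otimes> f) ` F - F" by auto
        show ?thesis by (simp only: eq[symmetric] card_image[OF inj])
      qed
      also have "real (card ((\<lambda>f. inv l \<otimes> f) ` F - F)) * measure \<mu> (snd T) \<le> d * real (card F) * measure \<mu> (snd T)"
        using F l by (intro mult_right_mono) (auto simp: almost_invariant_def)
      finally show "measure \<mu> (\<Union>s\<in>{s \<in> F. inv l \<otimes> s \<notin> F}. \<phi> (inv l \<otimes> s) ` snd T)
          \<le> d * real (card F) * measure \<mu> (snd T)" .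
    qed
    also have "\<dots> = real (card L) * d * (real (card F) * measure \<mu> (snd T))" by simp
    also have "\<dots> \<le> real (card L) * d * (2 * real (card (fst T)) * measure \<mu> (snd T))"
    proof -
      have sub: "fst T \<subseteq> F" and le: "real (card (F - fst T)) \<le> e * real (card F)"
        using greedy_extensionD(2,3)[OF ext, of "fst T" "snd T"] T by auto
      have "e * real (card F) \<le> 1 / 2 * real (card F)" using e by (intro mult_right_mono) auto
      moreover have "card F = card (fst T) + card (F - fst T)"
        using card_mono[OF Ff(1) sub] card_Diff_subset[OF finite_subset[OF sub Ff(1)] sub] by simp
      ultimately have "real (card F) \<le> 2 * real (card (fst T))" using le by simp
      then have "real (card F) * measure \<mu> (snd T) \<le> 2 * real (card (fst T)) * measure \<mu> (snd T)"
        by (rule mult_right_mono) simp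
      then show ?thesis using d_nonneg by (rule mult_left_mono)
    qed
    finally show ?thesis by (simp add: mult.assoc)
  qed
  have "measure \<mu> (entering L A') \<le> measure \<mu> (entering L A \<union> (\<Union>T\<in>\<D>. E T))"
    using sets.Un[OF borel_entering[OF L A] E_UN] by (intro finite_measure_mono sub) (simp only: Sm)
  also have "\<dots> \<le> measure \<mu> (entering L A) + measure \<mu> (\<Union>T\<in>\<D>. E T)"
    using borel_entering[OF L A] E_UN by (intro measure_Un_le) (simp_all only: Sm)
  also have "measure \<mu> (\<Union>T\<in>\<D>. E T) \<le> (\<Sum>T\<in>\<D>. measure \<mu> (E T))"
    using Sm E_borel finD by (intro measure_UNION_le) auto
  also have "\<dots> \<le> (\<Sum>T\<in>\<D>. real (card L) * d * (2 * (real (card (fst T)) * measure \<mu> (snd T))))"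
    by (intro sum_mono E_le)
  also have "\<dots> = 2 * (real (card L) * d) * (\<Sum>(S, V)\<in>\<D>. real (card S) * measure \<mu> V)"
    by (simp add: sum_distrib_left split_beta mult_ac)
  also have "\<dots> = 2 * (real (card L) * d) * measure \<mu> (footprint \<phi> \<D>)"
  proof -
    have "V \<in> sets borel" if "(S, V) \<in> \<D>" for S V
      using nb[of S V] that by (simp add: null_boundary_borel)
    then show ?thesis using sum_castle_measure[OF cD _ \<mu>] by simp
  qed
  also have "\<dots> \<le> 2 * (real (card L) * d) * 1"
    using d_nonneg by (intro mult_left_mono) auto
  finally show ?thesis by (simp add: A_def A'_def)
qed

section \<open>Quasi-tilings by open castles\<close>

text \<open>
  This is the one place where essential freeness enters.
\<close>

lemma null_non_free_points:
  assumes free: "essentially_free G \<phi>" and F: "finite F" "F \<subseteq> carrier G"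
  shows "closed {x. \<not> inj_on (\<lambda>f. \<phi> f x) F}"
    and "\<And>\<mu>. \<mu> \<in> IM \<Longrightarrow> measure \<mu> {x. \<not> inj_on (\<lambda>f. \<phi> f x) F} = 0"
proof -
  let ?coincide = "\<lambda>(f, f'). {x. \<phi> f x = \<phi> f' x}"
  have eq: "{x. \<not> inj_on (\<lambda>f. \<phi> f x) F} = (\<Union>p\<in>F \<times> F - Id. ?coincide p)"
    by (auto simp: inj_on_def)
  have fin: "finite (F \<times> F - Id)" using F by simp
  have closed: "closed (?coincide p)" if "p \<in> F \<times> F - Id" for p
    using that F by (auto intro!: closed_Collect_eq continuous_action)
  show cl: "closed {x. \<not> inj_on (\<lambda>f. \<phi> f x) F}"
    unfolding eq by (intro closed_UN fin ballI closed)
  fix \<mu> assume \<mu>: "\<mu> \<in> IM"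
  interpret prob_space \<mu> using \<mu> by (rule invariant_measureD)
  have "measure \<mu> (?coincide p) = 0" if "p \<in> F \<times> F - Id" for p
  proof -
    obtain f f' where p: "p = (f, f')" "f \<in> carrier G" "f' \<in> carrier G" "f \<noteq> f'"
      using \<open>p \<in> F \<times> F - Id\<close> F by auto
    have "\<phi> f x = \<phi> f' x \<longleftrightarrow> \<phi> (inv f \<otimes> f') x = x" for x
      using p(2,3) act_inv_left[of f x] act_inv_right[of f "\<phi> f' x"] by (metis act_mult inv_closed)
    then have eq: "?coincide p = {x. \<phi> (inv f \<otimes> f') x = x}"
      by (simp only: p(1) prod.case)
    have "inv f \<otimes> f' \<noteq> \<one>" using p by (metis inv_closed inv_equality inv_inv)
    then have "inv f \<otimes> f' \<in> carrier G - {\<one>}" using p by simp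
    then have "measure \<mu> {x. \<phi> (inv f \<otimes> f') x = x} = 0"
      using free \<mu> unfolding essentially_free_def by blast
    then show ?thesis by (simp only: eq)
  qed
  then have zero: "(\<Sum>p\<in>F \<times> F - Id. measure \<mu> (?coincide p)) = 0" by (simp del: split_paired_All)
  have "measure \<mu> {x. \<not> inj_on (\<lambda>f. \<phi> f x) F} \<le> (\<Sum>p\<in>F \<times> F - Id. measure \<mu> (?coincide p))"
    unfolding eq using closed invariant_measureD(2)[OF \<mu>]
    by (intro measure_UNION_le fin) (simp only: borel_closed)
  then show "measure \<mu> {x. \<not> inj_on (\<lambda>f. \<phi> f x) F} = 0"
    unfolding zero by (simp add: measure_le_0_iff)
qed

text \<open>
  The exceptional set \<open>Y\<close> is a neighbourhood of the closed null set of points that are not free for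
  \<open>F\<close>; its complement is compact and consists of points that have a tower neighbourhood.
\<close>

lemma tower_cover:
  assumes free: "essentially_free G \<phi>" and sbp: "small_boundary_property G \<phi>"
    and F: "finite F" "F \<subseteq> carrier G" and \<delta>: "0 < \<delta>" and \<eta>: "0 < \<eta>"
  obtains \<U> Y where "finite \<U>" "\<And>U. U \<in> \<U> \<Longrightarrow> null_boundary U"
    and "\<And>U f u v. U \<in> \<U> \<Longrightarrow> f \<in> F \<Longrightarrow> u \<in> U \<Longrightarrow> v \<in> U \<Longrightarrow> dist (\<phi> f u) (\<phi> f v) \<le> \<delta>"
    and "\<And>U f f' u v. U \<in> \<U> \<Longrightarrow> f \<in> F \<Longrightarrow> f' \<in> F \<Longrightarrow> u \<in> U \<Longrightarrow> v \<in> U \<Longrightarrow> \<phi> f u = \<phi> f' v \<Longrightarrow> f = f'"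
    and "Y \<in> sets borel" "- Y \<subseteq> \<Union>\<U>" "\<And>\<mu>. \<mu> \<in> IM \<Longrightarrow> measure \<mu> Y \<le> \<eta>"
proof -
  define N where "N = {x. \<not> inj_on (\<lambda>f. \<phi> f x) F}"
  have N: "closed N" "\<And>\<mu>. \<mu> \<in> IM \<Longrightarrow> measure \<mu> N < \<eta>"
    using null_non_free_points[OF free F] \<eta> by (simp_all add: N_def)
  obtain r where r: "0 < r" "\<And>\<mu>. \<mu> \<in> IM \<Longrightarrow> measure \<mu> (nbhd r N) < \<eta>"
    using small_closed_set_density[OF N] by metis
  obtain \<B> where \<B>: "topological_basis \<B>" "\<And>U \<mu>. U \<in> \<B> \<Longrightarrow> \<mu> \<in> IM \<Longrightarrow> measure \<mu> (frontier U) = 0"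
    using sbp by (auto simp: small_boundary_property_def)
  define good where "good U \<longleftrightarrow>
    (\<forall>f\<in>F. \<forall>u\<in>U. \<forall>v\<in>U. dist (\<phi> f u) (\<phi> f v) \<le> \<delta>) \<and>
    (\<forall>f\<in>F. \<forall>f'\<in>F. \<forall>u\<in>U. \<forall>v\<in>U. \<phi> f u = \<phi> f' v \<longrightarrow> f = f')" for U
  have ex: "\<exists>U\<in>\<B>. x \<in> U \<and> good U" if x: "x \<notin> N" for x
  proof -
    have "inj_on (\<lambda>f. \<phi> f x) F" using x by (simp add: N_def)
    then obtain W where W: "open W" "x \<in> W"
      "\<And>f u v. f \<in> F \<Longrightarrow> u \<in> W \<Longrightarrow> v \<in> W \<Longrightarrow> dist (\<phi> f u) (\<phi> f v) \<le> \<delta>"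
      "\<And>f f' u v. f \<in> F \<Longrightarrow> f' \<in> F \<Longrightarrow> u \<in> W \<Longrightarrow> v \<in> W \<Longrightarrow> \<phi> f u = \<phi> f' v \<Longrightarrow> f = f'"
      by (rule tower_neighbourhood[OF F _ \<delta>]) (rule that)
    obtain U where U: "U \<in> \<B>" "x \<in> U" "U \<subseteq> W" using topological_basisE[OF \<B>(1) W(1,2)] .
    have WU: "u \<in> W" if "u \<in> U" for u using that U(3) by blast
    have "good U"
      unfolding good_def
    proof (intro conjI ballI impI)
      show "dist (\<phi> f u) (\<phi> f v) \<le> \<delta>" if "f \<in> F" "u \<in> U" "v \<in> U" for f u v
        by (rule W(3)[OF that(1) WU[OF that(2)] WU[OF that(3)]])
      show "f = f'" if "f \<in> F" "f' \<in> F" "u \<in> U" "v \<in> U" "\<phi> f u = \<phi> f' v" for f f' u v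
        by (rule W(4)[OF that(1,2) WU[OF that(3)] WU[OF that(4)] that(5)])
    qed
    then show ?thesis using U by blast
  qed
  have cmp: "compact (- nbhd r N)"
    by (intro compact_of_closed closed_Compl open_nbhd)
  have cov: "- nbhd r N \<subseteq> \<Union>{U \<in> \<B>. good U}"
  proof
    fix x assume "x \<in> - nbhd r N"
    then have "x \<notin> N" using subset_nbhd[OF r(1), of N] by auto
    then show "x \<in> \<Union>{U \<in> \<B>. good U}" using ex[of x] by auto
  qed
  have op: "open U" if "U \<in> {U \<in> \<B>. good U}" for U
    using that topological_basis_open[OF \<B>(1)] by simp
  obtain \<U> where \<U>: "\<U> \<subseteq> {U \<in> \<B>. good U}" "finite \<U>" "- nbhd r N \<subseteq> \<Union>\<U>"
    by (rule compactE[OF cmp cov]) (erule op, rule that)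
  have good: "good U" and basic: "U \<in> \<B>" if "U \<in> \<U>" for U using that \<U>(1) by auto
  show ?thesis
  proof (rule that[of \<U> "nbhd r N"])
    show "finite \<U>" by (rule \<U>(2))
    show "null_boundary U" if "U \<in> \<U>" for U
      using \<B>(2)[OF basic[OF that]] topological_basis_open[OF \<B>(1) basic[OF that]]
      by (simp add: null_boundary_def)
    show "dist (\<phi> f u) (\<phi> f v) \<le> \<delta>" if "U \<in> \<U>" "f \<in> F" "u \<in> U" "v \<in> U" for U f u v
      using good[OF that(1)] that unfolding good_def by simp
    show "f = f'" if "U \<in> \<U>" "f \<in> F" "f' \<in> F" "u \<in> U" "v \<in> U" "\<phi> f u = \<phi> f' v" for U f f' u v
      using good[OF that(1)] that(2-6) unfolding good_def by blast
    show "nbhd r N \<in> sets borel" by (rule borel_open[OF open_nbhd])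
    show "- nbhd r N \<subseteq> \<Union>\<U>" by (rule \<U>(3))
    show "measure \<mu> (nbhd r N) \<le> \<eta>" if "\<mu> \<in> IM" for \<mu> using r(2)[OF that] by simp
  qed
qed

definition quasi_tiling :: "'g set \<Rightarrow> real \<Rightarrow> real \<Rightarrow> ('g set \<times> 'x set) set \<Rightarrow> bool" where
  "quasi_tiling K \<delta> \<delta>' \<C> \<longleftrightarrow> castle G \<phi> \<C> \<and> levels_finer \<delta> \<C> \<and>
     (\<forall>S V. (S, V) \<in> \<C> \<longrightarrow> invariant_finset G K \<delta>' S \<and> null_boundary V)"

text \<open>
  The statement is quantified over \<open>L\<close> because the shape \<open>F\<close> of the last round must be known before
  the earlier rounds are made: they are obtained from the induction hypothesis for \<open>L \<union> F\<close>, and \<open>F\<close>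
  itself is chosen almost invariant under the inverses of \<open>L\<close>.
\<close>

lemma quasi_tiling_exists:
  assumes free: "essentially_free G \<phi>" and sbp: "small_boundary_property G \<phi>"
    and K: "finite K" "K \<noteq> {}" "K \<subseteq> carrier G"
    and \<delta>: "0 < \<delta>" and d: "0 < d" and e: "0 < e" "e \<le> 1 / 2"
    and \<delta>': "2 * real (card K + 1) * (d + e) < \<delta>'"
  shows "finite L \<Longrightarrow> L \<subseteq> carrier G \<Longrightarrow> 0 < \<eta> \<Longrightarrow> \<exists>\<C>. quasi_tiling K \<delta> \<delta>' \<C> \<and>
    (\<forall>\<mu>\<in>IM. measure \<mu> (entering L (footprint \<phi> \<C>)) \<le> \<eta> \<and>
      measure \<mu> (- footprint \<phi> \<C>) \<le> (1 - e) ^ n + \<eta>)"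
proof (induction n arbitrary: L \<eta>)
  case 0
  have "castle G \<phi> {}" by (simp add: castle_iff)
  then have "quasi_tiling K \<delta> \<delta>' {}" by (simp add: quasi_tiling_def levels_finer_def)
  moreover have "measure \<mu> (entering L (footprint \<phi> {})) \<le> \<eta> \<and>
      measure \<mu> (- footprint \<phi> {}) \<le> (1 - e) ^ 0 + \<eta>" if \<mu>: "\<mu> \<in> IM" for \<mu>
    using prob_space.prob_le_1[OF invariant_measureD(1)[OF \<mu>], of UNIV] 0
    by (simp add: footprint_def entering_def)
  ultimately show ?case by blast
next
  case (Suc n)
  \<comment> \<open>The second bound makes the new part of the boundary layer at most half of \<eta>.\<close>
  define d' where "d' = min d (\<eta> / (4 * real (card L + 1)))"
  have d': "0 < d'" "d' \<le> d" using d Suc.prems by (auto simp: d'_def)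
  have "real (card L) * d' \<le> real (card L + 1) * (\<eta> / (4 * real (card L + 1)))"
    using d' by (intro mult_mono) (auto simp: d'_def)
  also have "\<dots> = \<eta> / 4" by (simp add: field_simps)
  finally have Ld: "2 * (real (card L) * d') \<le> \<eta> / 2" by simp
  obtain F where F: "almost_invariant (K \<union> m_inv G ` L) d' F"
    by (rule almost_invariant_exists[of "K \<union> m_inv G ` L" d']) (use K Suc.prems d' in auto)
  have Ff: "finite F" "F \<noteq> {}" "F \<subseteq> carrier G" using F by (auto simp: almost_invariant_def)
  have FL: "almost_invariant (m_inv G ` L) d' F" using F by (auto simp: almost_invariant_def)
  have "d' * real (card F) \<le> d * real (card F)" using d' by (intro mult_right_mono) auto
  then have FK: "almost_invariant K d F" using F unfolding almost_invariant_def by force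
  obtain \<C> where \<C>: "quasi_tiling K \<delta> \<delta>' \<C>"
    and ent: "\<And>\<mu>. \<mu> \<in> IM \<Longrightarrow> measure \<mu> (entering (L \<union> F) (footprint \<phi> \<C>)) \<le> \<eta> / 2"
    and rem: "\<And>\<mu>. \<mu> \<in> IM \<Longrightarrow> measure \<mu> (- footprint \<phi> \<C>) \<le> (1 - e) ^ n + \<eta> / 2"
    using Suc.IH[of "L \<union> F" "\<eta> / 2"] Suc.prems Ff by auto
  have c: "castle G \<phi> \<C>" and nbC: "\<And>S V. (S, V) \<in> \<C> \<Longrightarrow> null_boundary V"
    using \<C> by (auto simp: quasi_tiling_def)
  have \<eta>2: "0 < \<eta> / 2" using Suc.prems by simp
  obtain \<U> Y where \<U>: "finite \<U>" "\<And>U. U \<in> \<U> \<Longrightarrow> null_boundary U"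
    and small: "\<And>U f u v. U \<in> \<U> \<Longrightarrow> f \<in> F \<Longrightarrow> u \<in> U \<Longrightarrow> v \<in> U \<Longrightarrow> dist (\<phi> f u) (\<phi> f v) \<le> \<delta>"
    and inj: "\<And>U f f' u v. U \<in> \<U> \<Longrightarrow> f \<in> F \<Longrightarrow> f' \<in> F \<Longrightarrow> u \<in> U \<Longrightarrow> v \<in> U \<Longrightarrow> \<phi> f u = \<phi> f' v \<Longrightarrow> f = f'"
    and Y: "Y \<in> sets borel" "- Y \<subseteq> \<Union>\<U>" "\<And>\<mu>. \<mu> \<in> IM \<Longrightarrow> measure \<mu> Y \<le> \<eta> / 2"
    by (rule tower_cover[OF free sbp Ff(1,3) \<delta> \<eta>2]) (rule that)
  have "e \<le> 1" using e by simp
  have "\<exists>\<D>. greedy_extension F e \<U> \<C> \<D>"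
    by (rule greedy_towers[OF \<U>(1) c _ Ff(1,3)]) (fact nbC \<U>(2) inj \<open>e \<le> 1\<close>)+
  then obtain \<D> where ext: "greedy_extension F e \<U> \<C> \<D>" by blast
  note \<D> = greedy_extensionD[OF ext]
  have nb: "null_boundary V" if "(S, V) \<in> \<C> \<union> \<D>" for S V
    using that nbC[of S V] \<D>(5)[of S V] by auto
  have inv: "invariant_finset G K \<delta>' S" if "(S, V) \<in> \<C> \<union> \<D>" for S V
    using that \<C> invariant_finset_of_almost_invariant[OF FK K \<D>(2,3) e(2) \<delta>', of S V V]
    by (auto simp: quasi_tiling_def)
  have "dist (\<phi> s u) (\<phi> s v) \<le> \<delta>" if "(S, V) \<in> \<D>" "s \<in> S" "u \<in> V" "v \<in> V" for S V s u v
  proof -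
    obtain U where "U \<in> \<U>" "V \<subseteq> U" using \<D>(4)[OF \<open>(S, V) \<in> \<D>\<close>] by blast
    then show ?thesis using small[of U s u v] \<D>(2)[OF \<open>(S, V) \<in> \<D>\<close>] that by blast
  qed
  then have "levels_finer \<delta> (\<C> \<union> \<D>)"
    using \<C> levels_finerD[of \<delta> \<C>] by (auto simp: quasi_tiling_def levels_finer_def)
  then have "quasi_tiling K \<delta> \<delta>' (\<C> \<union> \<D>)"
    using \<D>(1) nb inv by (simp add: quasi_tiling_def)
  moreover have "measure \<mu> (entering L (footprint \<phi> (\<C> \<union> \<D>))) \<le> \<eta> \<and>
      measure \<mu> (- footprint \<phi> (\<C> \<union> \<D>)) \<le> (1 - e) ^ Suc n + \<eta>" if \<mu>: "\<mu> \<in> IM" for \<mu>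
  proof
    interpret prob_space \<mu> using \<mu> by (rule invariant_measureD)
    have A: "footprint \<phi> \<C> \<in> sets borel"
      by (intro null_boundary_borel null_boundary_footprint[OF c] nbC)
    have part: "measure \<mu> (entering L' (footprint \<phi> \<C>)) \<le> \<eta> / 2" if "L' \<subseteq> L \<union> F" for L'
    proof -
      have "entering L' (footprint \<phi> \<C>) \<subseteq> entering (L \<union> F) (footprint \<phi> \<C>)"
        using that by (auto simp: entering_def)
      moreover have "entering (L \<union> F) (footprint \<phi> \<C>) \<in> events"
        unfolding invariant_measureD(2)[OF \<mu>] using Suc.prems Ff A by (intro borel_entering) auto
      ultimately show ?thesis using finite_measure_mono ent[OF \<mu>] by (meson order_trans)
    qed
    show "measure \<mu> (entering L (footprint \<phi> (\<C> \<union> \<D>))) \<le> \<eta>"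
    proof -
      have "measure \<mu> (entering L (footprint \<phi> (\<C> \<union> \<D>)))
          \<le> measure \<mu> (entering L (footprint \<phi> \<C>)) + 2 * (real (card L) * d')"
        by (rule greedy_extension_entering[OF ext _ Suc.prems(1,2) FL e(2) \<mu>]) (rule nb)
      then show ?thesis using part[of L] Ld by simp
    qed
    have "measure \<mu> (- footprint \<phi> (\<C> \<union> \<D>)) \<le> (1 - e) * measure \<mu> (- footprint \<phi> \<C>) + e * (\<eta> / 2 + \<eta> / 2)"
      by (rule greedy_extension_remainder[OF ext _ Ff _ \<mu> Y(1,2) Y(3)[OF \<mu>] part])
        (use nb e in auto)
    also have "\<dots> \<le> (1 - e) * ((1 - e) ^ n + \<eta> / 2) + e * \<eta>"
      using rem[OF \<mu>] e by (intro add_mono mult_left_mono) auto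
    also have "\<dots> = (1 - e) ^ Suc n + (1 + e) * (\<eta> / 2)" by (simp add: field_simps)
    also have "\<dots> \<le> (1 - e) ^ Suc n + 2 * (\<eta> / 2)"
      using e Suc.prems by (intro add_left_mono mult_right_mono) auto
    finally show "measure \<mu> (- footprint \<phi> (\<C> \<union> \<D>)) \<le> (1 - e) ^ Suc n + \<eta>" by simp
  qed
  ultimately show ?case by blast
qed

text \<open>
  What is lost in passing to interiors is covered by finitely many translates of frontiers of bases.
\<close>

lemma castle_interior:
  assumes c: "castle G \<phi> \<C>" and nb: "\<And>S V. (S, V) \<in> \<C> \<Longrightarrow> null_boundary V"
  defines "\<C>' \<equiv> (\<lambda>(S, V). (S, interior V)) ` \<C>"
  shows "open_castle G \<phi> \<C>'"
    and "\<And>\<mu>. \<mu> \<in> IM \<Longrightarrow> measure \<mu> (- footprint \<phi> \<C>') \<le> measure \<mu> (- footprint \<phi> \<C>)"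
proof -
  have C': "\<exists>W. (S, W) \<in> \<C> \<and> V = interior W" if "(S, V) \<in> \<C>'" for S V
    using that by (auto simp: \<C>'_def)
  have c': "castle G \<phi> \<C>'"
    unfolding castle_iff
  proof (intro conjI allI impI)
    show "finite \<C>'" using castleD(1)[OF c] by (simp add: \<C>'_def)
    show "finite S" "S \<subseteq> carrier G" if "(S, V) \<in> \<C>'" for S V
    proof -
      obtain W where "(S, W) \<in> \<C>" using C'[OF \<open>(S, V) \<in> \<C>'\<close>] by blast
      then show "finite S" "S \<subseteq> carrier G" using castleD(2,3)[OF c] by simp_all
    qed
    fix S V s v S' V' s' v'
    assume *: "(S, V) \<in> \<C>'" "(S', V') \<in> \<C>'" "s \<in> S" "s' \<in> S'" "v \<in> V" "v' \<in> V'" "\<phi> s v = \<phi> s' v'"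
    obtain W where W: "(S, W) \<in> \<C>" "V = interior W" using C'[OF *(1)] by blast
    obtain W' where W': "(S', W') \<in> \<C>" "V' = interior W'" using C'[OF *(2)] by blast
    have "v \<in> W" "v' \<in> W'" using * W W' interior_subset by blast+
    then show "S = S'" "V = V'" "s = s'"
      using castle_unique_level[OF c W(1) W'(1) *(3,4) _ _ *(7)] W(2) W'(2) by simp_all
  qed
  moreover have "\<forall>(S, V)\<in>\<C>'. open V" by (auto simp: \<C>'_def)
  ultimately show op: "open_castle G \<phi> \<C>'" by (simp add: open_castle_def)
  fix \<mu> assume \<mu>: "\<mu> \<in> IM"
  interpret prob_space \<mu> using \<mu> by (rule invariant_measureD)
  note Sm = invariant_measureD(2)[OF \<mu>]
  let ?Z = "\<Union>T\<in>\<C>. \<Union>s\<in>fst T. \<phi> s ` frontier (snd T)"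
  have fin: "finite \<C>" "\<And>T. T \<in> \<C> \<Longrightarrow> finite (fst T)" using castleD(1,2)[OF c] by auto
  have lev: "\<phi> s ` frontier (snd T) \<in> events" "measure \<mu> (\<phi> s ` frontier (snd T)) = 0"
    if "T \<in> \<C>" "s \<in> fst T" for T s
  proof -
    have s: "s \<in> carrier G" using castleD(3)[OF c, of "fst T" "snd T"] that by auto
    then show "\<phi> s ` frontier (snd T) \<in> events"
      unfolding Sm by (intro borel_act_image borel_closed frontier_closed)
    show "measure \<mu> (\<phi> s ` frontier (snd T)) = 0"
      using invariant_measure_act_image[OF \<mu> s borel_closed[OF frontier_closed]] nb[of "fst T" "snd T"] that \<mu>
      by (simp add: null_boundary_def)
  qed
  have in_ev: "(\<Union>s\<in>fst T. \<phi> s ` frontier (snd T)) \<in> events" if "T \<in> \<C>" for T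
    using that by (intro sets.finite_UN fin lev) auto
  have Z: "?Z \<in> events" by (rule sets.finite_UN[OF fin(1) in_ev])
  have "measure \<mu> ?Z \<le> (\<Sum>T\<in>\<C>. measure \<mu> (\<Union>s\<in>fst T. \<phi> s ` frontier (snd T)))"
    by (rule measure_UNION_le[OF fin(1) in_ev])
  also have "\<dots> \<le> (\<Sum>T\<in>\<C>. \<Sum>s\<in>fst T. measure \<mu> (\<phi> s ` frontier (snd T)))"
    by (intro sum_mono measure_UNION_le fin lev)
  also have "\<dots> = 0" using lev(2) by (intro sum.neutral ballI)
  finally have Z0: "measure \<mu> ?Z \<le> 0" .
  have FP: "- footprint \<phi> \<C> \<in> events"
    unfolding Sm by (intro borel_comp null_boundary_borel null_boundary_footprint[OF c nb])
  have "- footprint \<phi> \<C>' \<subseteq> - footprint \<phi> \<C> \<union> ?Z"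
  proof
    fix x assume x: "x \<in> - footprint \<phi> \<C>'"
    show "x \<in> - footprint \<phi> \<C> \<union> ?Z"
    proof (cases "x \<in> footprint \<phi> \<C>")
      case True
      then obtain S V s v where *: "(S, V) \<in> \<C>" "s \<in> S" "v \<in> V" "x = \<phi> s v"
        unfolding in_footprint_iff by blast
      have "(S, interior V) \<in> \<C>'" using *(1) by (force simp: \<C>'_def)
      then have "v \<notin> interior V" using x * unfolding Compl_iff in_footprint_iff by blast
      then have "v \<in> frontier V" using *(3) closure_subset by (auto simp: frontier_def)
      then have "x \<in> (\<Union>s\<in>fst (S, V). \<phi> s ` frontier (snd (S, V)))" using * by auto
      then show ?thesis using *(1) by blast
    qed simp
  qed
  then have "measure \<mu> (- footprint \<phi> \<C>') \<le> measure \<mu> (- footprint \<phi> \<C> \<union> ?Z)"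
    using FP Z by (intro finite_measure_mono sets.Un)
  also have "\<dots> \<le> measure \<mu> (- footprint \<phi> \<C>) + measure \<mu> ?Z" using FP Z by (rule measure_Un_le)
  finally show "measure \<mu> (- footprint \<phi> \<C>') \<le> measure \<mu> (- footprint \<phi> \<C>)" using Z0 by simp
qed

theorem castles_of_small_boundary:
  assumes free: "essentially_free G \<phi>" and sbp: "small_boundary_property G \<phi>"
    and K: "finite K" "K \<noteq> {}" "K \<subseteq> carrier G" and \<delta>: "0 < \<delta>" and \<epsilon>: "0 < \<epsilon>"
  obtains \<C> where "open_castle G \<phi> \<C>" "levels_finer \<delta> \<C>" "fills_up_to \<epsilon> \<C>"
    and "\<And>S V. (S, V) \<in> \<C> \<Longrightarrow> invariant_finset G K \<delta> S"
proof -
  \<comment> \<open>With d = e this gives invariance of the shapes up to half of \<delta>.\<close>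
  define e where "e = min (1 / 2) (\<delta> / (8 * real (card K + 1)))"
  have "0 < e" using \<delta> by (simp add: e_def)
  moreover have "e \<le> 1 / 2" unfolding e_def by (rule min.cobounded1)
  ultimately have e: "0 < e" "e \<le> 1 / 2" by simp_all
  have "2 * real (card K + 1) * (e + e) \<le> 4 * real (card K + 1) * (\<delta> / (8 * real (card K + 1)))"
  proof -
    have "4 * real (card K + 1) * e \<le> 4 * real (card K + 1) * (\<delta> / (8 * real (card K + 1)))"
      by (intro mult_left_mono) (auto simp: e_def)
    then show ?thesis by (simp add: algebra_simps)
  qed
  also have "\<dots> = \<delta> / 2" by (simp add: field_simps)
  also have "\<dots> < \<delta>" using \<delta> by simp
  finally have small: "2 * real (card K + 1) * (e + e) < \<delta>" .
  obtain n where n: "(1 - e) ^ n < \<epsilon> / 2"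
    using real_arch_pow_inv[of "\<epsilon> / 2" "1 - e"] e \<epsilon> by auto
  have "\<exists>\<C>. quasi_tiling K \<delta> \<delta> \<C> \<and>
    (\<forall>\<mu>\<in>IM. measure \<mu> (entering {} (footprint \<phi> \<C>)) \<le> \<epsilon> / 2 \<and>
      measure \<mu> (- footprint \<phi> \<C>) \<le> (1 - e) ^ n + \<epsilon> / 2)"
    by (rule quasi_tiling_exists[OF free sbp K \<delta> e(1) e small]) (use \<epsilon> in auto)
  then obtain \<C> where \<C>: "quasi_tiling K \<delta> \<delta> \<C>"
    and rem: "\<And>\<mu>. \<mu> \<in> IM \<Longrightarrow> measure \<mu> (- footprint \<phi> \<C>) \<le> (1 - e) ^ n + \<epsilon> / 2"
    by blast
  have c: "castle G \<phi> \<C>" and nb: "\<And>S V. (S, V) \<in> \<C> \<Longrightarrow> null_boundary V"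
    using \<C> by (auto simp: quasi_tiling_def)
  define \<C>' where "\<C>' = (\<lambda>(S, V). (S, interior V)) ` \<C>"
  have C': "\<exists>W. (S, W) \<in> \<C> \<and> V \<subseteq> W" if "(S, V) \<in> \<C>'" for S V
    using that interior_subset by (force simp: \<C>'_def)
  show ?thesis
  proof (rule that[of \<C>'])
    show "open_castle G \<phi> \<C>'" unfolding \<C>'_def using c nb by (rule castle_interior(1))
    show "levels_finer \<delta> \<C>'"
      unfolding levels_finer_def
    proof (intro ballI, clarify)
      fix S V s u v assume *: "(S, V) \<in> \<C>'" "s \<in> S" "u \<in> V" "v \<in> V"
      obtain W where "(S, W) \<in> \<C>" "V \<subseteq> W" using C'[OF *(1)] by blast
      then show "dist (\<phi> s u) (\<phi> s v) \<le> \<delta>"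
        using * \<C> levels_finerD[of \<delta> \<C> S W s u v] by (auto simp: quasi_tiling_def)
    qed
    show "fills_up_to \<epsilon> \<C>'"
      unfolding fills_up_to_def
    proof
      fix \<mu> assume \<mu>: "\<mu> \<in> IM"
      show "measure \<mu> (- footprint \<phi> \<C>') < \<epsilon>"
      proof -
        have "measure \<mu> (- footprint \<phi> \<C>') \<le> measure \<mu> (- footprint \<phi> \<C>)"
          unfolding \<C>'_def by (rule castle_interior(2)[OF c _ \<mu>]) (rule nb)
        then show ?thesis using rem[OF \<mu>] n by simp
      qed
    qed
    show "invariant_finset G K \<delta> S" if "(S, V) \<in> \<C>'" for S V
      using C'[OF that] \<C> by (auto simp: quasi_tiling_def)
  qed
qed

theorem small_boundary_imp_almost_finite_in_measure:
  assumes free: "essentially_free G \<phi>" and sbp: "small_boundary_property G \<phi>"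
  shows "almost_finite_in_measure G \<phi>"
  unfolding almost_finite_in_measure_def
proof (intro allI impI, elim conjE)
  fix K and \<delta> \<epsilon> :: real
  assume K: "finite K" "K \<noteq> {}" "K \<subseteq> carrier G" and \<delta>: "0 < \<delta>" and \<epsilon>: "0 < \<epsilon>"
  obtain \<C> where \<C>: "open_castle G \<phi> \<C>" "levels_finer \<delta> \<C>" "fills_up_to \<epsilon> \<C>"
    and inv: "\<And>S V. (S, V) \<in> \<C> \<Longrightarrow> invariant_finset G K \<delta> S"
    by (rule castles_of_small_boundary[OF free sbp K \<delta> \<epsilon>]) (rule that)
  have "1 - \<epsilon> \<le> lower_banach_density G \<phi> (footprint \<phi> \<C>)"
    using \<C>(3) by (intro lower_banach_density_ge open_footprint \<C>(1)) (simp add: fills_up_to_def)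
  moreover have "\<forall>(S, V)\<in>\<C>. \<forall>s\<in>S. diameter (\<phi> s ` V) \<le> \<delta>"
    using \<C>(2) levels_finer_iff_diameter[of \<delta> \<C>] \<delta> by simp
  ultimately show "\<exists>\<C>. open_castle G \<phi> \<C> \<and> (\<forall>(S, V)\<in>\<C>. \<forall>s\<in>S. diameter (\<phi> s ` V) \<le> \<delta>) \<and>
      (\<forall>(S, V)\<in>\<C>. invariant_finset G K \<delta> S) \<and> 1 - \<epsilon> \<le> lower_banach_density G \<phi> (footprint \<phi> \<C>)"
    using \<C>(1) inv by (intro exI[of _ \<C>]) auto
qed


section \<open>Minimal actions\<close>

lemma dyn_subequivalent_mono:
  "dyn_subequivalent G \<phi> A B \<Longrightarrow> A' \<subseteq> A \<Longrightarrow> dyn_subequivalent G \<phi> A' B"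
  unfolding dyn_subequivalent_def by (meson order_trans)

lemma dyn_subequivalentE:
  assumes "dyn_subequivalent G \<phi> A B" "closed A"
  obtains \<U> g where "finite \<U>" "A \<subseteq> \<Union>\<U>" "\<And>U. U \<in> \<U> \<Longrightarrow> open U"
    "\<And>U. U \<in> \<U> \<Longrightarrow> g U \<in> carrier G" "\<And>U. U \<in> \<U> \<Longrightarrow> \<phi> (g U) ` U \<subseteq> B"
    "disjoint_family_on (\<lambda>U. \<phi> (g U) ` U) \<U>"
proof -
  have "\<exists>\<U> g. finite \<U> \<and> (\<forall>U\<in>\<U>. open U) \<and> A \<subseteq> \<Union>\<U> \<and>
      (\<forall>U\<in>\<U>. g U \<in> carrier G \<and> \<phi> (g U) ` U \<subseteq> B) \<and> disjoint_family_on (\<lambda>U. \<phi> (g U) ` U) \<U>"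
    using assms unfolding dyn_subequivalent_def by simp
  then obtain \<U> g where *: "finite \<U> \<and> (\<forall>U\<in>\<U>. open U) \<and> A \<subseteq> \<Union>\<U> \<and>
      (\<forall>U\<in>\<U>. g U \<in> carrier G \<and> \<phi> (g U) ` U \<subseteq> B) \<and> disjoint_family_on (\<lambda>U. \<phi> (g U) ` U) \<U>"
    by (elim exE)
  show ?thesis by (rule that[of \<U> g]) (use * in simp_all)
qed

text \<open>
  A witness may be given as an indexed family.  When several indices carry the same open set, one
  of them is selected, and disjointness is inherited.
\<close>

lemma dyn_subequivalent_witness:
  assumes "finite I" and "\<And>i. i \<in> I \<Longrightarrow> open (U i)" and "C \<subseteq> (\<Union>i\<in>I. U i)"
    and "\<And>i. i \<in> I \<Longrightarrow> h i \<in> carrier G" and "\<And>i. i \<in> I \<Longrightarrow> \<phi> (h i) ` U i \<subseteq> B"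
    and disj: "disjoint_family_on (\<lambda>i. \<phi> (h i) ` U i) I"
  shows "\<exists>\<U> g. finite \<U> \<and> (\<forall>U\<in>\<U>. open U) \<and> C \<subseteq> \<Union>\<U> \<and>
    (\<forall>U\<in>\<U>. g U \<in> carrier G \<and> \<phi> (g U) ` U \<subseteq> B) \<and> disjoint_family_on (\<lambda>U. \<phi> (g U) ` U) \<U>"
proof -
  define k where "k = inv_into I U"
  have k: "k V \<in> I" "U (k V) = V" if "V \<in> U ` I" for V
    using that by (auto simp: k_def inv_into_into f_inv_into_f)
  have "disjoint_family_on (\<lambda>V. \<phi> (h (k V)) ` V) (U ` I)"
    unfolding disjoint_family_on_def
  proof (intro ballI impI)
    fix V W assume VW: "V \<in> U ` I" "W \<in> U ` I" "V \<noteq> W"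
    then have "k V \<noteq> k W" using k(2) by metis
    then have "\<phi> (h (k V)) ` U (k V) \<inter> \<phi> (h (k W)) ` U (k W) = {}"
      using disj k(1) VW by (auto simp: disjoint_family_on_def)
    then show "\<phi> (h (k V)) ` V \<inter> \<phi> (h (k W)) ` W = {}" using k(2) VW by simp
  qed
  moreover have "h (k V) \<in> carrier G \<and> \<phi> (h (k V)) ` V \<subseteq> B" if "V \<in> U ` I" for V
    using assms(4)[OF k(1)[OF that]] assms(5)[OF k(1)[OF that]] k(2)[OF that] by simp
  ultimately show ?thesis
    using assms(1-3) by (intro exI[of _ "U ` I"] exI[of _ "\<lambda>V. h (k V)"]) auto
qed

lemma dyn_subequivalent_measure_le:
  assumes sub: "dyn_subequivalent G \<phi> A B" and A: "closed A" and B: "open B" and \<mu>: "\<mu> \<in> IM"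
  shows "measure \<mu> A \<le> measure \<mu> B"
proof -
  interpret prob_space \<mu> using \<mu> by (rule invariant_measureD)
  note Sm = invariant_measureD(2)[OF \<mu>]
  obtain \<U> g where \<U>: "finite \<U>" "A \<subseteq> \<Union>\<U>" and op: "\<And>U. U \<in> \<U> \<Longrightarrow> open U"
    and g: "\<And>U. U \<in> \<U> \<Longrightarrow> g U \<in> carrier G" "\<And>U. U \<in> \<U> \<Longrightarrow> \<phi> (g U) ` U \<subseteq> B"
    and disj: "disjoint_family_on (\<lambda>U. \<phi> (g U) ` U) \<U>"
    by (rule dyn_subequivalentE[OF sub A]) (rule that)
  have op': "open (\<phi> (g U) ` U)" if "U \<in> \<U>" for U using g(1)[OF that] op[OF that] by (rule open_act_image)
  have "measure \<mu> A \<le> measure \<mu> (\<Union>U\<in>\<U>. U)"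
    using \<U> op Sm by (intro finite_measure_mono) auto
  also have "\<dots> \<le> (\<Sum>U\<in>\<U>. measure \<mu> U)"
    using \<U> op Sm by (intro measure_UNION_le) auto
  also have "\<dots> = (\<Sum>U\<in>\<U>. measure \<mu> (\<phi> (g U) ` U))"
    using g op by (intro sum.cong refl invariant_measure_act_image[OF \<mu>, symmetric]) auto
  also have "\<dots> = measure \<mu> (\<Union>U\<in>\<U>. \<phi> (g U) ` U)"
    using \<U> op' Sm by (intro finite_measure_finite_Union[symmetric] disj) auto
  also have "\<dots> \<le> measure \<mu> B"
    using g(2) B Sm by (intro finite_measure_mono) auto
  finally show ?thesis .
qed

lemma minimal_open_translates_cover:
  assumes min: "minimal_action G \<phi>" and B: "open B" "B \<noteq> {}"
  obtains P where "finite P" "P \<subseteq> carrier G" "(\<Union>g\<in>P. \<phi> g ` B) = UNIV"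
proof -
  define W where "W = (\<Union>g\<in>carrier G. \<phi> g ` B)"
  have "open W" unfolding W_def using B by (auto intro!: open_act_image)
  have "\<phi> g ` (- W) \<subseteq> - W" if g: "g \<in> carrier G" for g
  proof
    fix y assume "y \<in> \<phi> g ` (- W)"
    then obtain x where x: "y = \<phi> g x" "x \<notin> W" by auto
    show "y \<in> - W"
    proof
      assume "y \<in> W"
      then obtain h b where h: "h \<in> carrier G" "b \<in> B" "\<phi> g x = \<phi> h b" using x by (auto simp: W_def)
      then have "x = \<phi> (inv g \<otimes> h) b" using g by (metis act_inv_left act_mult inv_closed)
      moreover have "inv g \<otimes> h \<in> carrier G" using g h by simp
      ultimately show False using x(2) h(2) unfolding W_def by blast
    qed
  qed
  then have "- W = {} \<or> - W = UNIV"
    using min closed_Compl[OF \<open>open W\<close>] unfolding minimal_action_def by simp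
  moreover have "B \<subseteq> W"
  proof
    fix b assume "b \<in> B"
    then have "\<phi> \<one> b \<in> W" unfolding W_def by blast
    then show "b \<in> W" by simp
  qed
  ultimately have "W = UNIV" using B(2) by blast
  then have cov: "UNIV \<subseteq> (\<Union>g\<in>carrier G. \<phi> g ` B)" by (simp only: W_def order_refl)
  have op: "open (\<phi> g ` B)" if "g \<in> carrier G" for g using that B(1) by (rule open_act_image)
  obtain P where P: "P \<subseteq> carrier G" "finite P" "UNIV \<subseteq> (\<Union>g\<in>P. \<phi> g ` B)"
    by (rule compactE_image[OF compact_space op cov]) (assumption, rule that)
  show ?thesis by (rule that[OF P(2,1)]) (use P(3) in blast)
qed

lemma minimal_measure_lower_bound:
  assumes min: "minimal_action G \<phi>" and B: "open B" "B \<noteq> {}"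
  obtains c where "0 < c" "\<And>\<mu>. \<mu> \<in> IM \<Longrightarrow> c \<le> measure \<mu> B"
proof -
  obtain P where P: "finite P" "P \<subseteq> carrier G" "(\<Union>g\<in>P. \<phi> g ` B) = UNIV"
    using minimal_open_translates_cover[OF min B] .
  then have "P \<noteq> {}" by auto
  then have c: "0 < real (card P)" using P(1) by (simp add: card_gt_0_iff)
  show ?thesis
  proof (rule that[of "1 / real (card P)"])
    show "0 < 1 / real (card P)" using c by simp
    fix \<mu> assume \<mu>: "\<mu> \<in> IM"
    interpret prob_space \<mu> using \<mu> by (rule invariant_measureD)
    have "1 = measure \<mu> (\<Union>g\<in>P. \<phi> g ` B)"
      using P(3) prob_space invariant_measureD(3)[OF \<mu>] by simp
    also have "\<dots> \<le> (\<Sum>g\<in>P. measure \<mu> (\<phi> g ` B))"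
      using P B invariant_measureD(2)[OF \<mu>] by (intro measure_UNION_le) (auto intro!: borel_act_image)
    also have "\<dots> = (\<Sum>g\<in>P. measure \<mu> B)"
      using P B by (intro sum.cong refl invariant_measure_act_image[OF \<mu>]) auto
    finally show "1 / real (card P) \<le> measure \<mu> B" using c by (simp add: divide_le_eq mult.commute)
  qed
qed

lemma minimal_orbit_infinite:
  assumes min: "minimal_action G \<phi>" and inf: "infinite (UNIV :: 'x set)"
  shows "infinite ((\<lambda>g. \<phi> g x) ` carrier G)"
proof
  let ?O = "(\<lambda>g. \<phi> g x) ` carrier G"
  assume fin: "finite ?O"
  have "\<phi> g ` ?O \<subseteq> ?O" if "g \<in> carrier G" for g
  proof
    fix y assume "y \<in> \<phi> g ` ?O"
    then obtain h where h: "h \<in> carrier G" "y = \<phi> g (\<phi> h x)" by auto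
    then have "y = \<phi> (g \<otimes> h) x" using that by simp
    then show "y \<in> ?O" using that h(1) by blast
  qed
  then have "closed ?O \<and> (\<forall>g\<in>carrier G. \<phi> g ` ?O \<subseteq> ?O)"
    using finite_imp_closed[OF fin] by (intro conjI ballI)
  then have "?O = {} \<or> ?O = UNIV" by (rule min[unfolded minimal_action_def, rule_format])
  moreover have "\<phi> \<one> x \<in> ?O" by (rule imageI) simp
  ultimately have "?O = UNIV" by (metis empty_iff)
  then show False using fin inf by (simp only:)
qed

text \<open>
  In an infinite orbit \<open>n\<close> distinct points have disjoint neighbourhoods that are translates of one open
  set, whose measure is therefore at most \<open>1 / n\<close>.
\<close>

lemma small_open_subset:
  assumes min: "minimal_action G \<phi>" and inf: "infinite (UNIV :: 'x set)"
    and B: "open B" "B \<noteq> {}" and \<epsilon>: "0 < \<epsilon>"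
  obtains B' where "open B'" "B' \<noteq> {}" "closure B' \<subseteq> B" "\<And>\<mu>. \<mu> \<in> IM \<Longrightarrow> measure \<mu> (closure B') < \<epsilon>"
proof -
  obtain x where x: "x \<in> B" using B by blast
  obtain n where n: "1 / real (Suc n) < \<epsilon>"
    using reals_Archimedean[OF \<epsilon>] by (auto simp: inverse_eq_divide)
  obtain T where T: "T \<subseteq> (\<lambda>g. \<phi> g x) ` carrier G" "card T = Suc n"
    using infinite_arbitrarily_large[OF minimal_orbit_infinite[OF min inf]] by blast
  then obtain P where P: "P \<subseteq> carrier G" "inj_on (\<lambda>g. \<phi> g x) P" "T = (\<lambda>g. \<phi> g x) ` P"
    by (metis subset_image_inj)
  have cP: "card P = Suc n" using T(2) P by (simp add: card_image)
  then have finP: "finite P" by (metis card.infinite nat.distinct(1))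
  obtain W where W: "open W" "x \<in> W"
    and tow: "\<And>f f' u v. f \<in> P \<Longrightarrow> f' \<in> P \<Longrightarrow> u \<in> W \<Longrightarrow> v \<in> W \<Longrightarrow> \<phi> f u = \<phi> f' v \<Longrightarrow> f = f'"
    by (rule tower_neighbourhood[OF finP P(1,2) zero_less_one]) (rule that)
  obtain r where r: "0 < r" "cball x r \<subseteq> W \<inter> B"
    using open_contains_cball_eq[OF open_Int[OF W(1) B(1)], THEN spec, of x] W(2) x by auto
  define B' where "B' = ball x r"
  have cl: "closure B' \<subseteq> cball x r" unfolding B'_def by (intro closure_minimal ball_subset_cball closed_cball)
  have "castle G \<phi> {(P, closure B')}"
    unfolding castle_iff
  proof (intro conjI allI impI)
    fix S V s v S' V' s' v'
    assume *: "(S, V) \<in> {(P, closure B')}" "(S', V') \<in> {(P, closure B')}" "s \<in> S" "s' \<in> S'" "v \<in> V" "v' \<in> V'"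
      "\<phi> s v = \<phi> s' v'"
    then show "S = S'" "V = V'" by simp_all
    have "v \<in> W" "v' \<in> W" using * cl r(2) by auto
    then show "s = s'" using tow[of s s' v v'] * by simp
  qed (use finP P in auto)
  note castle = this
  show ?thesis
  proof (rule that[of B'])
    show "open B'" "B' \<noteq> {}" using r by (simp_all add: B'_def)
    show "closure B' \<subseteq> B" using cl r by blast
    fix \<mu> assume \<mu>: "\<mu> \<in> IM"
    interpret prob_space \<mu> using \<mu> by (rule invariant_measureD)
    have "real (card P) * measure \<mu> (closure B') = measure \<mu> (footprint \<phi> {(P, closure B')})"
      using sum_castle_measure[OF castle _ \<mu>] by simp
    also have "\<dots> \<le> 1" by simp
    finally have "measure \<mu> (closure B') \<le> 1 / real (Suc n)"
      unfolding cP by (simp add: le_divide_eq mult.commute)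
    then show "measure \<mu> (closure B') < \<epsilon>" using n by simp
  qed
qed

theorem comparison_imp_almost_finite:
  assumes min: "minimal_action G \<phi>" and free: "essentially_free G \<phi>"
    and sbp: "small_boundary_property G \<phi>" and comp: "has_comparison G \<phi>"
  shows "almost_finite G \<phi>"
  unfolding almost_finite_def
proof (intro allI impI, elim conjE)
  fix K and B :: "'x set" and \<delta> :: real
  assume K: "finite K" "K \<noteq> {}" "K \<subseteq> carrier G" and B: "open B" "B \<noteq> {}" and \<delta>: "0 < \<delta>"
  obtain c where c: "0 < c" "\<And>\<mu>. \<mu> \<in> IM \<Longrightarrow> c \<le> measure \<mu> B"
    by (rule minimal_measure_lower_bound[OF min B]) (rule that)
  obtain \<C> where \<C>: "open_castle G \<phi> \<C>" "levels_finer \<delta> \<C>" "fills_up_to c \<C>"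
    and inv: "\<And>S V. (S, V) \<in> \<C> \<Longrightarrow> invariant_finset G K \<delta> S"
    by (rule castles_of_small_boundary[OF free sbp K \<delta> c(1)]) (rule that)
  let ?R = "- footprint \<phi> \<C>"
  have R: "closed ?R" "\<And>\<mu>. \<mu> \<in> IM \<Longrightarrow> measure \<mu> ?R < c"
    using open_footprint[OF \<C>(1)] \<C>(3) by (auto simp: fills_up_to_def)
  obtain r where r: "0 < r" "\<And>\<mu>. \<mu> \<in> IM \<Longrightarrow> measure \<mu> (nbhd r ?R) < c"
    by (rule small_closed_set_density[OF R]) (assumption, rule that)
  have "measure \<mu> (nbhd r ?R) < measure \<mu> B" if "\<mu> \<in> IM" for \<mu>
    using r(2)[OF that] c(2)[OF that] by simp
  then have "dyn_subequivalent G \<phi> (nbhd r ?R) B"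
    using comp B(1) open_nbhd unfolding has_comparison_def by blast
  then have "dyn_subequivalent G \<phi> (UNIV - footprint \<phi> \<C>) B"
    by (rule dyn_subequivalent_mono) (use subset_nbhd[OF r(1), of ?R] in auto)
  moreover have "\<forall>(S, V)\<in>\<C>. \<forall>s\<in>S. diameter (\<phi> s ` V) \<le> \<delta>"
    using \<C>(2) levels_finer_iff_diameter[of \<delta> \<C>] \<delta> by simp
  ultimately show "\<exists>\<C>. open_castle G \<phi> \<C> \<and> (\<forall>(S, V)\<in>\<C>. \<forall>s\<in>S. diameter (\<phi> s ` V) \<le> \<delta>) \<and>
      (\<forall>(S, V)\<in>\<C>. invariant_finset G K \<delta> S) \<and> dyn_subequivalent G \<phi> (UNIV - footprint \<phi> \<C>) B"
    using \<C>(1) inv by (intro exI[of _ \<C>]) auto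
qed

lemma almost_finite_castle:
  assumes af: "almost_finite G \<phi>" and K: "finite K" "K \<noteq> {}" "K \<subseteq> carrier G"
    and B: "open B" "B \<noteq> {}" and \<delta>: "0 < \<delta>"
  obtains \<C> where "open_castle G \<phi> \<C>" "levels_finer \<delta> \<C>"
    and "\<And>S V. (S, V) \<in> \<C> \<Longrightarrow> invariant_finset G K \<delta> S"
    and "dyn_subequivalent G \<phi> (- footprint \<phi> \<C>) B"
proof -
  have "\<exists>\<C>. open_castle G \<phi> \<C> \<and> (\<forall>(S, V)\<in>\<C>. \<forall>s\<in>S. diameter (\<phi> s ` V) \<le> \<delta>) \<and>
      (\<forall>(S, V)\<in>\<C>. invariant_finset G K \<delta> S) \<and> dyn_subequivalent G \<phi> (UNIV - footprint \<phi> \<C>) B"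
    using af K B \<delta> unfolding almost_finite_def by (elim allE[of _ K] allE[of _ B] allE[of _ \<delta>] impE) simp_all
  then obtain \<C> where \<C>: "open_castle G \<phi> \<C>" "\<forall>(S, V)\<in>\<C>. \<forall>s\<in>S. diameter (\<phi> s ` V) \<le> \<delta>"
    "\<forall>(S, V)\<in>\<C>. invariant_finset G K \<delta> S" "dyn_subequivalent G \<phi> (UNIV - footprint \<phi> \<C>) B"
    by (elim exE conjE)
  show ?thesis
  proof (rule that[of \<C>])
    show "levels_finer \<delta> \<C>" using \<C>(2) levels_finer_iff_diameter[of \<delta> \<C>] \<delta> by simp
    show "invariant_finset G K \<delta> S" if "(S, V) \<in> \<C>" for S V using \<C>(3) that by auto
    show "dyn_subequivalent G \<phi> (- footprint \<phi> \<C>) B" using \<C>(4) by (simp only: Compl_eq_Diff_UNIV)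
  qed (rule \<C>(1))
qed

lemma finite_space_open:
  assumes "finite (UNIV :: 'x set)"
  shows "open (A :: 'x set)"
proof -
  have "finite (- A)" using subset_UNIV assms by (rule finite_subset)
  then have "closed (- A)" by (rule finite_imp_closed)
  then show ?thesis by (simp add: open_closed)
qed

text \<open>
  A remainder that is subequivalent to an open set of small measure has small measure itself.  A finite
  space is discrete, and there all frontiers are empty.
\<close>

theorem almost_finite_imp_small_boundary:
  assumes min: "minimal_action G \<phi>" and af: "almost_finite G \<phi>"
  shows "small_boundary_property G \<phi>"
proof (cases "finite (UNIV :: 'x set)")
  case True
  have op: "open A" for A :: "'x set" using True by (rule finite_space_open)
  have "frontier A = {}" for A :: "'x set"
    using op[of A] op[of "- A"] by (simp add: frontier_def closed_def[symmetric] interior_open)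
  moreover have "topological_basis (UNIV :: 'x set set)"
    using op by (intro topological_basisI) auto
  ultimately show ?thesis unfolding small_boundary_property_def by (intro exI[of _ UNIV]) simp
next
  case False
  show ?thesis
  proof (rule small_boundary_of_castles)
    fix \<delta> \<epsilon> :: real assume \<delta>: "0 < \<delta>" and \<epsilon>: "0 < \<epsilon>"
    obtain B where B: "open B" "B \<noteq> {}" "\<And>\<mu>. \<mu> \<in> IM \<Longrightarrow> measure \<mu> (closure B) < \<epsilon>"
      by (rule small_open_subset[OF min False open_UNIV UNIV_not_empty \<epsilon>]) (rule that)
    obtain \<C> where \<C>: "open_castle G \<phi> \<C>" "levels_finer \<delta> \<C>"
      and sub: "dyn_subequivalent G \<phi> (- footprint \<phi> \<C>) B"
      by (rule almost_finite_castle[OF af, of "{\<one>}" B \<delta>]) (use B(1,2) \<delta> that in auto)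
    have "fills_up_to \<epsilon> \<C>"
      unfolding fills_up_to_def
    proof
      fix \<mu> assume \<mu>: "\<mu> \<in> IM"
      interpret prob_space \<mu> using \<mu> by (rule invariant_measureD)
      have "measure \<mu> (- footprint \<phi> \<C>) \<le> measure \<mu> B"
        by (rule dyn_subequivalent_measure_le[OF sub closed_Compl[OF open_footprint[OF \<C>(1)]] B(1) \<mu>])
      also have "\<dots> \<le> measure \<mu> (closure B)"
        using invariant_measureD(2)[OF \<mu>] by (intro finite_measure_mono closure_subset) auto
      finally show "measure \<mu> (- footprint \<phi> \<C>) < \<epsilon>" using B(3)[OF \<mu>] by simp
    qed
    then show "\<exists>\<C>. open_castle G \<phi> \<C> \<and> levels_finer \<delta> \<C> \<and> fills_up_to \<epsilon> \<C>" using \<C> by blast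
  qed
qed

text \<open>
  On a finite minimal space an invariant measure is a multiple of the counting measure, so \<open>A\<close> has at
  most as many points as \<open>B\<close>, and single points are moved by transitivity.
\<close>

lemma finite_space_comparison:
  assumes min: "minimal_action G \<phi>" and fin: "finite (UNIV :: 'x set)"
  shows "has_comparison G \<phi>"
  unfolding has_comparison_def
proof (intro allI impI, elim conjE)
  fix A B :: "'x set"
  assume less: "\<forall>\<mu>\<in>IM. measure \<mu> A < measure \<mu> B"
  obtain \<mu> where \<mu>: "\<mu> \<in> IM" using invariant_measure_exists by blast
  interpret prob_space \<mu> using \<mu> by (rule invariant_measureD)
  note Sm = invariant_measureD(2)[OF \<mu>]
  have op: "open D" for D :: "'x set" using fin by (rule finite_space_open)
  have trans: "\<exists>g\<in>carrier G. \<phi> g x = y" for x y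
  proof -
    obtain P where P: "P \<subseteq> carrier G" "(\<Union>g\<in>P. \<phi> g ` {x}) = UNIV"
      by (rule minimal_open_translates_cover[OF min op insert_not_empty]) (rule that)
    then have "y \<in> (\<Union>g\<in>P. \<phi> g ` {x})" by simp
    then show ?thesis using P(1) by auto
  qed
  have point: "measure \<mu> {x} = measure \<mu> {y}" for x y
  proof -
    obtain g where g: "g \<in> carrier G" "\<phi> g x = y" using trans[of x y] by blast
    then show ?thesis using invariant_measure_act_image[OF \<mu> g(1) borel_open[OF op[of "{x}"]]] by simp
  qed
  have card: "measure \<mu> D = real (card D) * measure \<mu> {undefined}" for D
  proof -
    have "measure \<mu> D = (\<Sum>x\<in>D. measure \<mu> {x})"
      using finite_subset[OF subset_UNIV fin, of D] Sm op by (intro finite_measure_eq_sum_singleton) (auto intro: borel_open)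
    also have "\<dots> = (\<Sum>x\<in>D. measure \<mu> {undefined})" by (intro sum.cong refl point)
    finally show ?thesis by simp
  qed
  have "measure \<mu> A < measure \<mu> B" using less \<mu> by blast
  then have lt: "real (card A) * measure \<mu> {undefined} < real (card B) * measure \<mu> {undefined}"
    unfolding card[of A] card[of B] .
  have "card A \<le> card B"
  proof (rule ccontr)
    assume "\<not> card A \<le> card B"
    then have "real (card B) * measure \<mu> {undefined} \<le> real (card A) * measure \<mu> {undefined}"
      by (intro mult_right_mono) auto
    then show False using lt by simp
  qed
  then obtain f where f: "f ` A \<subseteq> B" "inj_on f A"
    using card_le_inj[OF finite_subset[OF subset_UNIV fin] finite_subset[OF subset_UNIV fin], of A B] by blast
  have "\<exists>g. g \<in> carrier G \<and> \<phi> g x = f x" for x using trans[of x "f x"] by blast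
  then obtain h where h: "\<And>x. h x \<in> carrier G" "\<And>x. \<phi> (h x) x = f x" by metis
  show "dyn_subequivalent G \<phi> A B"
    unfolding dyn_subequivalent_def
  proof (intro allI impI, elim conjE)
    fix C assume "C \<subseteq> A"
    then have fC: "f ` C \<subseteq> B" "inj_on f C" using f by (auto intro: inj_on_subset)
    show "\<exists>\<U> g. finite \<U> \<and> (\<forall>U\<in>\<U>. open U) \<and> C \<subseteq> \<Union>\<U> \<and>
      (\<forall>U\<in>\<U>. g U \<in> carrier G \<and> \<phi> (g U) ` U \<subseteq> B) \<and> disjoint_family_on (\<lambda>U. \<phi> (g U) ` U) \<U>"
    proof (rule dyn_subequivalent_witness[where I = C and U = "\<lambda>x. {x}" and h = h])
      show "finite C" using finite_subset[OF subset_UNIV fin] .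
      show "disjoint_family_on (\<lambda>x. \<phi> (h x) ` {x}) C"
        using fC(2) h(2) by (auto simp: disjoint_family_on_def inj_on_def)
    qed (use op h fC in auto)
  qed
qed

text \<open>
  The counting bound along a single almost invariant finite set has a margin, and it integrates to a
  bound for all invariant measures at once.
\<close>

lemma comparison_gap:
  assumes C: "closed C" "closed D" and less: "\<And>\<mu>. \<mu> \<in> IM \<Longrightarrow> measure \<mu> C + measure \<mu> D < 1"
  obtains \<eta> where "0 < \<eta>" "\<And>\<mu>. \<mu> \<in> IM \<Longrightarrow> measure \<mu> C + measure \<mu> D \<le> 1 - \<eta>"
proof -
  obtain \<eta> r K \<delta> where *: "0 < \<eta>" "0 < r" "finite K" "K \<noteq> {}" "K \<subseteq> carrier G" "0 < \<delta>"
    and count: "\<And>S x. invariant_finset G K \<delta> S \<Longrightarrow>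
      real (card {s \<in> S. \<phi> s x \<in> nbhd r C}) + real (card {s \<in> S. \<phi> s x \<in> nbhd r D})
        \<le> (1 - \<eta>) * real (card S)"
    by (rule uniform_density_bound[OF C less]) (assumption, rule that)
  obtain F where F: "invariant_finset G K \<delta> F" using invariant_finset_exists *(3-6) by metis
  then have F': "finite F" "F \<noteq> {}" "F \<subseteq> carrier G" by (auto simp: invariant_finset_def)
  show ?thesis
  proof (rule that[OF *(1)])
    fix \<mu> assume \<mu>: "\<mu> \<in> IM"
    interpret prob_space \<mu> using \<mu> by (rule invariant_measureD)
    have op: "nbhd r E \<in> events" for E
      using borel_open[OF open_nbhd] invariant_measureD(2)[OF \<mu>] by simp
    have "measure \<mu> C + measure \<mu> D \<le> measure \<mu> (nbhd r C) + measure \<mu> (nbhd r D)"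
      by (intro add_mono finite_measure_mono subset_nbhd *(2) op)
    also have "\<dots> \<le> 1 - \<eta>"
      by (rule invariant_measures_le_of_counting[OF \<mu> F' borel_open[OF open_nbhd] borel_open[OF open_nbhd] count[OF F]])
    finally show "measure \<mu> C + measure \<mu> D \<le> 1 - \<eta>" .
  qed
qed

text \<open>
  The margin of \<open>comparison_gap\<close> makes room for a reserved open set \<open>B\<^sub>0\<close> with closure in \<open>B\<close>: the sets \<open>C\<close>
  and \<open>D = - B \<union> closure B\<^sub>0\<close> still satisfy \<open>\<mu> C + \<mu> D < 1\<close>.  Counting along a shape \<open>S\<close> then shows
  that the levels that meet \<open>C\<close> together with the levels that meet \<open>D\<close> are at most \<open>card S\<close> in
  number, which gives an injection from the former into the levels that avoid \<open>D\<close>.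
\<close>

theorem almost_finite_imp_comparison:
  assumes min: "minimal_action G \<phi>" and af: "almost_finite G \<phi>"
  shows "has_comparison G \<phi>"
proof (cases "finite (UNIV :: 'x set)")
  case True
  then show ?thesis by (rule finite_space_comparison[OF min])
next
  case inf: False
  show ?thesis
    unfolding has_comparison_def dyn_subequivalent_def
  proof (intro allI impI, elim conjE)
    fix A B C :: "'x set"
    assume A: "open A" and B: "open B" and less: "\<forall>\<mu>\<in>IM. measure \<mu> A < measure \<mu> B"
      and C: "closed C" "C \<subseteq> A"
    have clB: "closed (- B)" using B by (rule closed_Compl)
    have lt: "measure \<mu> C + measure \<mu> (- B) < 1" if \<mu>: "\<mu> \<in> IM" for \<mu>
    proof -
      interpret prob_space \<mu> using \<mu> by (rule invariant_measureD)
      have "measure \<mu> C \<le> measure \<mu> A"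
        using A C invariant_measureD(2)[OF \<mu>] by (intro finite_measure_mono) auto
      moreover have "measure \<mu> (- B) = 1 - measure \<mu> B"
        using prob_compl[of B] B invariant_measureD[OF \<mu>] by (simp add: Compl_eq_Diff_UNIV)
      ultimately show ?thesis using less \<mu> by force
    qed
    obtain \<eta> where \<eta>: "0 < \<eta>" "\<And>\<mu>. \<mu> \<in> IM \<Longrightarrow> measure \<mu> C + measure \<mu> (- B) \<le> 1 - \<eta>"
      by (rule comparison_gap[OF C(1) clB lt]) (assumption, rule that)
    obtain \<nu> where \<nu>: "\<nu> \<in> IM" using invariant_measure_exists by blast
    have "B \<noteq> {}" using less \<nu> by (metis measure_empty measure_nonneg not_less)
    then obtain B\<^sub>0 where B0: "open B\<^sub>0" "B\<^sub>0 \<noteq> {}" "closure B\<^sub>0 \<subseteq> B"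
      and small: "\<And>\<mu>. \<mu> \<in> IM \<Longrightarrow> measure \<mu> (closure B\<^sub>0) < \<eta>"
      using small_open_subset[OF min inf B _ \<eta>(1)] by metis
    define D where "D = - B \<union> closure B\<^sub>0"
    have D: "closed D" using clB by (simp add: D_def closed_Un)
    have lt': "measure \<mu> C + measure \<mu> D < 1" if \<mu>: "\<mu> \<in> IM" for \<mu>
    proof -
      have "measure \<mu> D \<le> measure \<mu> (- B) + measure \<mu> (closure B\<^sub>0)"
        unfolding D_def using clB invariant_measureD(2)[OF \<mu>] by (intro measure_Un_le) auto
      then show ?thesis using \<eta>(2)[OF \<mu>] small[OF \<mu>] by simp
    qed
    obtain \<theta> r K \<delta> where *: "0 < \<theta>" "0 < r" "finite K" "K \<noteq> {}" "K \<subseteq> carrier G" "0 < \<delta>"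
      and count: "\<And>S x. invariant_finset G K \<delta> S \<Longrightarrow>
        real (card {s \<in> S. \<phi> s x \<in> nbhd r C}) + real (card {s \<in> S. \<phi> s x \<in> nbhd r D})
          \<le> (1 - \<theta>) * real (card S)"
      by (rule uniform_density_bound[OF C(1) D lt']) (assumption, rule that)
    \<comment> \<open>Levels of diameter less than r that meet C or D stay in the neighbourhoods that are counted.\<close>
    define \<rho> where "\<rho> = min \<delta> (r / 2)"
    have \<rho>: "0 < \<rho>" "\<rho> \<le> \<delta>" "\<rho> < r" using * by (auto simp: \<rho>_def)
    obtain \<C> where \<C>: "open_castle G \<phi> \<C>" "levels_finer \<rho> \<C>"
      and inv: "\<And>S V. (S, V) \<in> \<C> \<Longrightarrow> invariant_finset G K \<rho> S"
      and sub: "dyn_subequivalent G \<phi> (- footprint \<phi> \<C>) B\<^sub>0"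
      by (rule almost_finite_castle[OF af *(3-5) B0(1,2) \<rho>(1)]) (rule that)
    have c: "castle G \<phi> \<C>" and opV: "\<And>S V. (S, V) \<in> \<C> \<Longrightarrow> open V"
      using \<C>(1) by (auto simp: open_castle_def)
    \<comment> \<open>Within each tower the levels that meet C are sent to levels that avoid D.\<close>
    define src where "src T = {s \<in> fst T. \<phi> s ` snd T \<inter> C \<noteq> {}}" for T :: "'g set \<times> 'x set"
    define tgt where "tgt T = {s \<in> fst T. \<phi> s ` snd T \<inter> D = {}}" for T :: "'g set \<times> 'x set"
    have "\<exists>j. j ` src T \<subseteq> tgt T \<and> inj_on j (src T)" if T: "T \<in> \<C>" for T
    proof -
      obtain S V where SV: "T = (S, V)" by (cases T)
      have finS: "finite S" using castleD(2)[OF c, of S V] T SV by simp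
      have "card (src T) \<le> card (tgt T)"
      proof (cases "V = {}")
        case True
        then show ?thesis by (simp add: src_def SV)
      next
        case False
        then obtain v where v: "v \<in> V" by blast
        have near: "\<phi> s v \<in> nbhd r E" if "s \<in> S" "\<phi> s ` V \<inter> E \<noteq> {}" for s E
        proof -
          obtain u where u: "u \<in> V" "\<phi> s u \<in> E" using \<open>\<phi> s ` V \<inter> E \<noteq> {}\<close> by blast
          have "dist (\<phi> s u) (\<phi> s v) \<le> \<rho>"
            using levels_finerD[OF \<C>(2), of S V s u v] T SV \<open>s \<in> S\<close> u(1) v by simp
          then show ?thesis using u(2) \<rho>(3) by (force simp: nbhd_def)
        qed
        have "invariant_finset G K \<delta> S"
          using inv[of S V] T SV \<rho>(2) by (auto simp: invariant_finset_def)
        then have cnt: "real (card {s \<in> S. \<phi> s v \<in> nbhd r C}) + real (card {s \<in> S. \<phi> s v \<in> nbhd r D})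
            \<le> (1 - \<theta>) * real (card S)" by (rule count)
        have "(1 - \<theta>) * real (card S) \<le> 1 * real (card S)" using *(1) by (intro mult_right_mono) auto
        moreover have "card (src T) \<le> card {s \<in> S. \<phi> s v \<in> nbhd r C}"
          using finS near by (intro card_mono) (auto simp: src_def SV)
        moreover have "card (S - tgt T) \<le> card {s \<in> S. \<phi> s v \<in> nbhd r D}"
          using finS near by (intro card_mono) (auto simp: tgt_def SV)
        moreover have "tgt T \<subseteq> S" by (auto simp: tgt_def SV)
        then have "card (S - tgt T) = card S - card (tgt T)" "card (tgt T) \<le> card S"
          using finS by (auto simp: card_Diff_subset finite_subset card_mono)
        ultimately show ?thesis using cnt by linarith
      qed
      moreover have "finite (src T)" "finite (tgt T)" using finS by (auto simp: src_def tgt_def SV)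
      ultimately show ?thesis using card_le_inj by blast
    qed
    then obtain j where j: "\<And>T. T \<in> \<C> \<Longrightarrow> j T ` src T \<subseteq> tgt T" "\<And>T. T \<in> \<C> \<Longrightarrow> inj_on (j T) (src T)"
      by metis
    have clR: "closed (- footprint \<phi> \<C>)" by (rule closed_Compl[OF open_footprint[OF \<C>(1)]])
    obtain \<W> g where \<W>: "finite \<W>" "- footprint \<phi> \<C> \<subseteq> \<Union>\<W>" and opW: "\<And>W. W \<in> \<W> \<Longrightarrow> open W"
      and g: "\<And>W. W \<in> \<W> \<Longrightarrow> g W \<in> carrier G" "\<And>W. W \<in> \<W> \<Longrightarrow> \<phi> (g W) ` W \<subseteq> B\<^sub>0"
      and disjW: "disjoint_family_on (\<lambda>W. \<phi> (g W) ` W) \<W>"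
      by (rule dyn_subequivalentE[OF sub clR]) (rule that)
    \<comment> \<open>The open sets to be moved: levels that meet C, moved inside their tower, and a cover of
        the remainder, moved into the reserved set.\<close>
    define I where "I = (SIGMA T:\<C>. src T) <+> \<W>"
    define U where "U = case_sum (\<lambda>(T :: 'g set \<times> 'x set, s). \<phi> s ` snd T) (\<lambda>W. W)"
    define h where "h = case_sum (\<lambda>(T, s). j T s \<otimes> inv s) g"
    have level: "s \<in> carrier G" "j T s \<in> fst T" "j T s \<in> carrier G" "\<phi> (j T s) ` snd T \<inter> D = {}"
      if "T \<in> \<C>" "s \<in> src T" for T s
    proof -
      have "fst T \<subseteq> carrier G" using castleD(3)[OF c, of "fst T" "snd T"] that by simp
      moreover have "j T s \<in> tgt T" using j(1) that by blast
      ultimately show "s \<in> carrier G" "j T s \<in> fst T" "j T s \<in> carrier G" "\<phi> (j T s) ` snd T \<inter> D = {}"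
        using that by (auto simp: src_def tgt_def)
    qed
    have img_l: "\<phi> (h (Inl (T, s))) ` U (Inl (T, s)) = \<phi> (j T s) ` snd T" if "T \<in> \<C>" "s \<in> src T" for T s
      using level[OF that] by (auto simp: h_def U_def image_image)
    have img_r: "\<phi> (h (Inr W)) ` U (Inr W) = \<phi> (g W) ` W" for W by (simp add: h_def U_def)
    have cases_I: "(\<exists>T s. i = Inl (T, s) \<and> T \<in> \<C> \<and> s \<in> src T) \<or> (\<exists>W. i = Inr W \<and> W \<in> \<W>)" if "i \<in> I" for i
      using that by (auto simp: I_def)
    have disj_lr: "\<phi> (j T s) ` snd T \<inter> \<phi> (g W) ` W = {}" if "T \<in> \<C>" "s \<in> src T" "W \<in> \<W>" for T s W
      using level(4)[OF that(1,2)] g(2)[OF that(3)] closure_subset[of B\<^sub>0] by (auto simp: D_def)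
    have disj_ll: "T = T' \<and> s = s'" if l: "T \<in> \<C>" "s \<in> src T" "T' \<in> \<C>" "s' \<in> src T'"
      and x: "x \<in> \<phi> (j T s) ` snd T" "x \<in> \<phi> (j T' s') ` snd T'" for T s T' s' x
    proof -
      obtain v v' where v: "v \<in> snd T" "v' \<in> snd T'" "\<phi> (j T s) v = \<phi> (j T' s') v'" using x by auto
      have "(fst T, snd T) \<in> \<C>" "(fst T', snd T') \<in> \<C>" using l by simp_all
      note u = castle_unique_level[OF c this level(2)[OF l(1,2)] level(2)[OF l(3,4)] v]
      then have "T = T'" by (simp add: prod_eq_iff)
      then show ?thesis using u(3) j(2)[OF l(1)] l by (simp add: inj_on_eq_iff)
    qed
    show "\<exists>\<U> g. finite \<U> \<and> (\<forall>U\<in>\<U>. open U) \<and> C \<subseteq> \<Union>\<U> \<and>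
      (\<forall>U\<in>\<U>. g U \<in> carrier G \<and> \<phi> (g U) ` U \<subseteq> B) \<and> disjoint_family_on (\<lambda>U. \<phi> (g U) ` U) \<U>"
    proof (rule dyn_subequivalent_witness[where I = I and U = U and h = h])
      have "finite (src T)" if "T \<in> \<C>" for T
        using castleD(2)[OF c, of "fst T" "snd T"] that by (simp add: src_def)
      then show "finite I" unfolding I_def using castleD(1)[OF c] \<W>(1) by simp
      show "open (U i)" "h i \<in> carrier G" "\<phi> (h i) ` U i \<subseteq> B" if i: "i \<in> I" for i
      proof -
        have "open (U i) \<and> h i \<in> carrier G \<and> \<phi> (h i) ` U i \<subseteq> B"
          using cases_I[OF i]
        proof (elim disjE exE conjE)
          fix T s assume l: "i = Inl (T, s)" "T \<in> \<C>" "s \<in> src T"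
          have "open (snd T)" using opV[of "fst T" "snd T"] l by simp
          then have "open (U i)" using level(1)[OF l(2,3)] by (simp add: U_def l(1) open_act_image)
          moreover have "h i \<in> carrier G" using level[OF l(2,3)] by (simp add: h_def l(1))
          moreover have "\<phi> (h i) ` U i \<subseteq> B"
            unfolding l(1) img_l[OF l(2,3)] using level(4)[OF l(2,3)] by (auto simp: D_def)
          ultimately show ?thesis by simp
        next
          fix W assume W: "i = Inr W" "W \<in> \<W>"
          have "B\<^sub>0 \<subseteq> B" using B0(3) closure_subset by blast
          then show ?thesis
            using opW[OF W(2)] g[OF W(2)] by (simp add: W(1) img_r) (auto simp: U_def h_def)
        qed
        then show "open (U i)" "h i \<in> carrier G" "\<phi> (h i) ` U i \<subseteq> B" by simp_all
      qed
      show "C \<subseteq> (\<Union>i\<in>I. U i)"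
      proof
        fix x assume x: "x \<in> C"
        show "x \<in> (\<Union>i\<in>I. U i)"
        proof (cases "x \<in> footprint \<phi> \<C>")
          case True
          then obtain S V s v where f: "(S, V) \<in> \<C>" "s \<in> S" "v \<in> V" "x = \<phi> s v"
            unfolding in_footprint_iff by blast
          then have "s \<in> src (S, V)" using x by (auto simp: src_def)
          then have "Inl ((S, V), s) \<in> I" using f(1) by (auto simp: I_def)
          moreover have "x \<in> U (Inl ((S, V), s))" using f by (simp add: U_def)
          ultimately show ?thesis by blast
        next
          case False
          then obtain W where "W \<in> \<W>" "x \<in> W" using \<W>(2) by blast
          then have "Inr W \<in> I" "x \<in> U (Inr W)" by (auto simp: I_def U_def)
          then show ?thesis by blast
        qed
      qed
      show "disjoint_family_on (\<lambda>i. \<phi> (h i) ` U i) I"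
        unfolding disjoint_family_on_def
      proof (intro ballI impI)
        fix i k assume ik: "i \<in> I" "k \<in> I" "i \<noteq> k"
        show "\<phi> (h i) ` U i \<inter> \<phi> (h k) ` U k = {}"
          using cases_I[OF ik(1)] cases_I[OF ik(2)]
        proof (elim disjE exE conjE)
          fix T s T' s'
          assume l: "i = Inl (T, s)" "T \<in> \<C>" "s \<in> src T" and l': "k = Inl (T', s')" "T' \<in> \<C>" "s' \<in> src T'"
          show ?thesis
            unfolding l(1) l'(1) img_l[OF l(2,3)] img_l[OF l'(2,3)]
            using disj_ll[OF l(2,3) l'(2,3)] ik(3) l(1) l'(1) by blast
        next
          fix T s W assume l: "i = Inl (T, s)" "T \<in> \<C>" "s \<in> src T" and W: "k = Inr W" "W \<in> \<W>"
          show ?thesis unfolding l(1) W(1) img_l[OF l(2,3)] img_r by (rule disj_lr[OF l(2,3) W(2)])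
        next
          fix W T s assume W: "i = Inr W" "W \<in> \<W>" and l: "k = Inl (T, s)" "T \<in> \<C>" "s \<in> src T"
          show ?thesis unfolding l(1) W(1) img_l[OF l(2,3)] img_r using disj_lr[OF l(2,3) W(2)] by (simp only: Int_commute)
        next
          fix W W' assume W: "i = Inr W" "W \<in> \<W>" and W': "k = Inr W'" "W' \<in> \<W>"
          then have "W \<noteq> W'" using ik(3) by simp
          then show ?thesis
            unfolding W(1) W'(1) img_r using disjW W(2) W'(2) by (simp add: disjoint_family_on_def)
        qed
      qed
    qed
  qed
qed

end

theorem theorem2:
  fixes G :: "('g, 'm) monoid_scheme"
    and \<phi> :: "'g \<Rightarrow> 'x::metric_space \<Rightarrow> 'x"
  assumes "countable (carrier G)"
    and "amenable_group G"
    and "compact (UNIV :: 'x set)"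
    and "topological_action G \<phi>"
    and "essentially_free G \<phi>"
  shows "(small_boundary_property G \<phi> \<longleftrightarrow> almost_finite_in_measure G \<phi>) \<and>
    (minimal_action G \<phi> \<longrightarrow>
       (almost_finite G \<phi> \<longleftrightarrow> small_boundary_property G \<phi> \<and> has_comparison G \<phi>))"
proof -
  interpret compact_amenable_action G \<phi>
    using assms(1-4) by (simp add: compact_amenable_action_def compact_amenable_action_axioms_def)
  show ?thesis
    using small_boundary_imp_almost_finite_in_measure[OF assms(5)] almost_finite_in_measure_imp_small_boundary
      almost_finite_imp_small_boundary almost_finite_imp_comparison comparison_imp_almost_finite[OF _ assms(5)]
    by blast
qed

end
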